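(* Let $n\ge 2$. For the $\mathfrak{S}_{n}$-representations $E_n^{(j)}$ ($1\le j\le n$), the $\mathfrak{S}_{n-1}$-representations $E_{n-1}^{(j)}$ ($1\le j\le n-1$) and the $\mathfrak{S}_n$-representations $F_n^{(j)}$ ($1\le j\le n-1$), the system of identities of virtual $\mathfrak{S}_n$-representations $$F^{(j)}_n = \sum_{i=1}^j \left( E^{(i)}_{n-1} \uparrow^{\mathfrak{S}_n}_{\mathfrak{S}_{n-1}} - E_n^{(i)} \right),\qquad j=1,2,\ldots,n-1,$$ is equivalent to the following relation in $R(\mathfrak{S}_n)[[t]]$: $$\sum_{j=1}^n E^{(j)}_n\, t^{n-j} = \left( 1 + t \, V^{(n-1,1)} \right) \sum_{j=1}^{n-1} F^{(j)}_n\, t^{n-1-j}.$$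
   Context: $\mathfrak{S}_n$ is the symmetric group, and $\mathfrak{S}_{n-1}\subset\mathfrak{S}_n$ is the subgroup of permutations fixing $n$; $\uparrow^{\mathfrak{S}_n}_{\mathfrak{S}_{n-1}}$ denotes induction. All representations are over $\mathbb{Q}$. $R(\mathfrak{S}_n)$ is the Grothendieck (representation) ring of finite-dimensional $\mathbb{Q}\mathfrak{S}_n$-modules (product given by tensor product, $1$ the trivial representation), and $R(\mathfrak{S}_n)[[t]]$ is the Grothendieck ring of graded $\mathbb{Q}\mathfrak{S}_n$-modules, where $V\cdot t^k$ is the class of $V$ placed in degree $k$. $V^\lambda$ is the irreducible $\mathfrak{S}_n$-representation indexed by the partition $\lambda$ of $n$; in particular $V^{(n-1,1)}$ is the irreducible $(n-1)$-dimensional reflection representation. Eulerian representations: for $1\le i\le n-1$ let $s_{i,n-i}=\sum_w \mathrm{sgn}(w)\,w\in\mathbb{Q}\mathfrak{S}_n$, the sum over all $w=(w_1,\ldots,w_n)\in\mathfrak{S}_n$ with $w_1<\cdots<w_i$ and $w_{i+1}<\cdots<w_n$. Let $s_n=\sum_{i=1}^{n-1}s_{i,n-i}$. It acts semisimply on $\mathbb{Q}\mathfrak{S}_n$ by left multiplication with eigenvalues $2^j-2$, $j=1,\ldots,n$. The $j$-th Eulerian idempotent $e_n^{(j)}$ is the polynomial in $s_n$ that projects onto the $(2^j-2)$-eigenspace, and $E_n^{(j)}:=e_n^{(j)}\mathbb{Q}\mathfrak{S}_n$, a right $\mathfrak{S}_n$-representation. Whitehouse's lifts: let $c=(1,2,\ldots,n)$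 be the $n$-cycle and $\Lambda_n=\sum_{i=0}^{n-1}\mathrm{sgn}(c)^i c^i\in\mathbb{Q}\mathfrak{S}_n$. The element $\Lambda_n$ commutes with all $e_{n-1}^{(j)}$ (viewed in $\mathbb{Q}\mathfrak{S}_n$ via $\mathfrak{S}_{n-1}\subset\mathfrak{S}_n$), and $F_n^{(j)}:=\Lambda_n e_{n-1}^{(j)}\mathbb{Q}\mathfrak{S}_n=e_{n-1}^{(j)}\Lambda_n\mathbb{Q}\mathfrak{S}_n$ for $j=1,\ldots,n-1$, a right $\mathfrak{S}_n$-representation. (Whitehouse proved that the first displayed system of identities holds for these representations.) *)

theory Defs
  imports
    Complex_Main
    "HOL-Algebra.Sym_Groups"
    "HOL-Algebra.QuotRing"
    "HOL-Algebra.Free_Abelian_Groups"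
    "HOL-Library.Function_Algebras"
begin

section \<open>Rational vector spaces of functions\<close>

definition qscale :: "rat \<Rightarrow> ('i \<Rightarrow> rat) \<Rightarrow> 'i \<Rightarrow> rat" where
  "qscale c x = (\<lambda>i. c * x i)"

global_interpretation qvs: vector_space "qscale :: rat \<Rightarrow> ('i \<Rightarrow> rat) \<Rightarrow> 'i \<Rightarrow> rat"
  by standard (simp_all add: qscale_def fun_eq_iff algebra_simps)

definition linear_on :: "('i \<Rightarrow> rat) set \<Rightarrow> (('i \<Rightarrow> rat) \<Rightarrow> 'j \<Rightarrow> rat) \<Rightarrow> bool" where
  "linear_on V f \<longleftrightarrow>
     (\<forall>x\<in>V. \<forall>y\<in>V. f (x + y) = f x + f y) \<and>
     (\<forall>c. \<forall>x\<in>V. f (qscale c x) = qscale c (f x))"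

section \<open>Finite-dimensional right modules over a rational group algebra\<close>

text \<open>
  The underlying space of a module is a subspace of a space of rational-valued functions on some
  index type. The action is only meaningful on vectors of that subspace and elements of the group.
\<close>

record ('g, 'i) rmodule =
  vecs :: "('i \<Rightarrow> rat) set"
  act :: "('i \<Rightarrow> rat) \<Rightarrow> 'g \<Rightarrow> 'i \<Rightarrow> rat"

definition fd_rmodule :: "('g, 'b) monoid_scheme \<Rightarrow> ('g, 'i) rmodule \<Rightarrow> bool" where
  "fd_rmodule G M \<longleftrightarrow>
     (\<exists>B. finite B \<and> vecs M = qvs.span B) \<and>
     (\<forall>g\<in>carrier G. (\<forall>x\<in>vecs M. act M x g \<in> vecs M) \<and> linear_on (vecs M) (\<lambda>x. act M x g)) \<and>
     (\<forall>x\<in>vecs M. act M x \<one>\<^bsub>G\<^esub> = x) \<and>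
     (\<forall>x\<in>vecs M. \<forall>g\<in>carrier G. \<forall>h\<in>carrier G. act M (act M x g) h = act M x (g \<otimes>\<^bsub>G\<^esub> h))"

definition rmodule_hom ::
  "('g, 'b) monoid_scheme \<Rightarrow> ('g, 'i) rmodule \<Rightarrow> ('g, 'j) rmodule \<Rightarrow> (('i \<Rightarrow> rat) \<Rightarrow> 'j \<Rightarrow> rat) \<Rightarrow> bool"
where
  "rmodule_hom G M N f \<longleftrightarrow>
     f \<in> vecs M \<rightarrow> vecs N \<and> linear_on (vecs M) f \<and>
     (\<forall>x\<in>vecs M. \<forall>g\<in>carrier G. f (act M x g) = act N (f x) g)"

definition rmodule_iso ::
  "('g, 'b) monoid_scheme \<Rightarrow> ('g, 'i) rmodule \<Rightarrow> ('g, 'j) rmodule \<Rightarrow> bool" where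
  "rmodule_iso G M N \<longleftrightarrow> (\<exists>f. rmodule_hom G M N f \<and> bij_betw f (vecs M) (vecs N))"

definition short_exact ::
  "('g, 'b) monoid_scheme \<Rightarrow> ('g, 'i) rmodule \<Rightarrow> ('g, 'j) rmodule \<Rightarrow> ('g, 'k) rmodule \<Rightarrow> bool"
where
  "short_exact G A B C \<longleftrightarrow>
     (\<exists>f p. rmodule_hom G A B f \<and> rmodule_hom G B C p \<and>
        inj_on f (vecs A) \<and> p ` vecs B = vecs C \<and> f ` vecs A = {y \<in> vecs B. p y = 0})"

definition trivial_rmodule :: "('g, unit) rmodule" where
  "trivial_rmodule = \<lparr>vecs = UNIV, act = (\<lambda>x g. x)\<rparr>"

definition pure_tensor :: "('i \<Rightarrow> rat) \<Rightarrow> ('j \<Rightarrow> rat) \<Rightarrow> 'i \<times> 'j \<Rightarrow> rat" where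
  "pure_tensor x y = (\<lambda>(i, j). x i * y j)"

text \<open>
  The diagonal action on a tensor product over the rationals: apply \<open>g\<close> to every row of a tensor
  (an element of \<open>N\<close>) and then to every column of the result (an element of \<open>M\<close>). This is the
  linear map that sends \<open>x \<otimes> y\<close> to \<open>xg \<otimes> yg\<close>, see \<open>act_pure_tensor\<close> below.
\<close>

definition tensor_rmodule :: "('g, 'i) rmodule \<Rightarrow> ('g, 'j) rmodule \<Rightarrow> ('g, 'i \<times> 'j) rmodule" where
  "tensor_rmodule M N =
     \<lparr>vecs = qvs.span {pure_tensor x y | x y. x \<in> vecs M \<and> y \<in> vecs N},
      act = (\<lambda>z g (i, j). act M (\<lambda>i'. act N (\<lambda>j'. z (i', j')) g j) g i)\<rparr>"

lemma act_pure_tensor: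
  assumes "fd_rmodule G M" "fd_rmodule G N" "x \<in> vecs M" "y \<in> vecs N" "g \<in> carrier G"
  shows "act (tensor_rmodule M N) (pure_tensor x y) g = pure_tensor (act M x g) (act N y g)"
proof -
  have N: "act N (\<lambda>j'. c * y j') g j = c * act N y g j" for c j
    using assms by (auto simp: fd_rmodule_def linear_on_def qscale_def fun_eq_iff)
  have "act M (qscale d x) g = qscale d (act M x g)" for d
    using assms by (auto simp: fd_rmodule_def linear_on_def)
  then have M: "act M (\<lambda>i'. x i' * d) g i = act M x g i * d" for d i
    by (simp add: qscale_def fun_eq_iff mult.commute)
  show ?thesis
    by (auto simp: tensor_rmodule_def pure_tensor_def N M)
qed

text \<open>
  Induction from a subgroup \<open>H\<close> of a finite group, in the function model: the maps
  \<open>f : G \<rightarrow> M\<close> with \<open>f (g h) = f (g) h\<close> for \<open>h \<in> H\<close>, acted upon by \<open>(f \<sigma>) (g) = f (\<sigma> g)\<close>.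
  The usual isomorphism from the tensor product of \<open>M\<close> with the group algebra of \<open>G\<close> over that of
  \<open>H\<close> sends \<open>m \<otimes> \<sigma>\<close> to the map supported on the coset of \<open>\<sigma>\<^sup>-\<^sup>1\<close> modulo \<open>H\<close> with value \<open>m h\<close> at
  \<open>\<sigma>\<^sup>-\<^sup>1 h\<close>.
\<close>

definition induced_rmodule ::
  "('g, 'b) monoid_scheme \<Rightarrow> 'g set \<Rightarrow> ('g, 'i) rmodule \<Rightarrow> ('g, 'g \<times> 'i) rmodule" where
  "induced_rmodule G H M =
     \<lparr>vecs = {f. (\<forall>g\<in>carrier G. curry f g \<in> vecs M) \<and>
                 (\<forall>g. g \<notin> carrier G \<longrightarrow> curry f g = 0) \<and>
                 (\<forall>g\<in>carrier G. \<forall>h\<in>H. curry f (g \<otimes>\<^bsub>G\<^esub> h) = act M (curry f g) h)},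
      act = (\<lambda>f \<sigma> (g, i). if g \<in> carrier G then f (\<sigma> \<otimes>\<^bsub>G\<^esub> g, i) else 0)\<rparr>"

section \<open>The representation ring\<close>

text \<open>
  Every finite-dimensional module has an isomorphic copy whose vectors are functions on \<open>nat\<close>; these
  copies serve as the generators of the Grothendieck group.
\<close>

definition nat_copy :: "('g, 'b) monoid_scheme \<Rightarrow> ('g, 'i) rmodule \<Rightarrow> ('g, nat) rmodule" where
  "nat_copy G M = (SOME N. fd_rmodule G N \<and> rmodule_iso G M N)"

text \<open>
  The free abelian group on the modules, with the bilinear extension of the tensor product. It
  becomes a ring only modulo the relations coming from short exact sequences.
\<close>

definition rep_prering :: "('g, 'b) monoid_scheme \<Rightarrow> (('g, nat) rmodule \<Rightarrow>\<^sub>0 int) ring" where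
  "rep_prering G =
     \<lparr>carrier = {c. Poly_Mapping.keys c \<subseteq> {M. fd_rmodule G M}},
      mult = (\<lambda>a b. frag_extend (\<lambda>M. frag_extend
                (\<lambda>N. frag_of (nat_copy G (tensor_rmodule M N))) b) a),
      one = frag_of (nat_copy G trivial_rmodule),
      ring.zero = 0,
      add = (+)\<rparr>"

definition exact_relations :: "('g, 'b) monoid_scheme \<Rightarrow> (('g, nat) rmodule \<Rightarrow>\<^sub>0 int) set" where
  "exact_relations G = generate (add_monoid (rep_prering G))
     {frag_of B - frag_of A - frag_of C | A B C.
        fd_rmodule G A \<and> fd_rmodule G B \<and> fd_rmodule G C \<and> short_exact G A B C}"

definition rep_ring :: "('g, 'b) monoid_scheme \<Rightarrow> (('g, nat) rmodule \<Rightarrow>\<^sub>0 int) set ring" where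
  "rep_ring G = rep_prering G Quot exact_relations G"

definition rep_class ::
  "('g, 'b) monoid_scheme \<Rightarrow> ('g, 'i) rmodule \<Rightarrow> (('g, nat) rmodule \<Rightarrow>\<^sub>0 int) set" where
  "rep_class G M = exact_relations G +>\<^bsub>rep_prering G\<^esub> frag_of (nat_copy G M)"

definition power_series_ring :: "('a, 'b) ring_scheme \<Rightarrow> (nat \<Rightarrow> 'a) ring" where
  "power_series_ring R =
     \<lparr>carrier = UNIV \<rightarrow> carrier R,
      mult = (\<lambda>p q k. \<Oplus>\<^bsub>R\<^esub>i\<in>{..k}. p i \<otimes>\<^bsub>R\<^esub> q (k - i)),
      one = (\<lambda>k. if k = 0 then \<one>\<^bsub>R\<^esub> else \<zero>\<^bsub>R\<^esub>),
      ring.zero = (\<lambda>k. \<zero>\<^bsub>R\<^esub>),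
      add = (\<lambda>p q k. p k \<oplus>\<^bsub>R\<^esub> q k)\<rparr>"

definition ps_monom :: "('a, 'b) ring_scheme \<Rightarrow> 'a \<Rightarrow> nat \<Rightarrow> nat \<Rightarrow> 'a" where
  "ps_monom R a k = (\<lambda>i. if i = k then a else \<zero>\<^bsub>R\<^esub>)"

section \<open>Group algebras and their right ideals\<close>

definition delta :: "'g \<Rightarrow> 'g \<Rightarrow> rat" where
  "delta g = (\<lambda>h. if h = g then 1 else 0)"

definition group_algebra :: "('g, 'b) monoid_scheme \<Rightarrow> ('g \<Rightarrow> rat) ring" where
  "group_algebra G =
     \<lparr>carrier = {x. \<forall>g. g \<notin> carrier G \<longrightarrow> x g = 0},
      mult = (\<lambda>x y g. if g \<in> carrier G
                then \<Sum>h\<in>carrier G. x h * y (inv\<^bsub>G\<^esub> h \<otimes>\<^bsub>G\<^esub> g) else 0),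
      one = delta \<one>\<^bsub>G\<^esub>,
      ring.zero = 0,
      add = (+)\<rparr>"

definition right_ideal_rmodule ::
  "('g, 'b) monoid_scheme \<Rightarrow> ('g \<Rightarrow> rat) \<Rightarrow> ('g, 'g) rmodule" where
  "right_ideal_rmodule G a =
     \<lparr>vecs = {a \<otimes>\<^bsub>group_algebra G\<^esub> x | x. x \<in> carrier (group_algebra G)},
      act = (\<lambda>x g. x \<otimes>\<^bsub>group_algebra G\<^esub> delta g)\<rparr>"

section \<open>Representations of the symmetric group\<close>

text \<open>
  A permutation in \<open>sym_group n\<close> fixes everything outside \<open>{1..n}\<close>. Hence the carrier of
  \<open>sym_group (n - 1)\<close> is, literally, the subgroup of \<open>sym_group n\<close> that fixes \<open>n\<close>, and elements of
  the group algebra of the former are elements of the group algebra of the latter.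
\<close>

abbreviation QS :: "nat \<Rightarrow> ((nat \<Rightarrow> nat) \<Rightarrow> rat) ring" where
  "QS n \<equiv> group_algebra (sym_group n)"

text \<open>
  The reflection representation, that is, the irreducible module indexed by \<open>(n - 1, 1)\<close>: vectors of
  length \<open>n\<close> with coordinate sum zero, on which permutations act by permuting the coordinates.
\<close>

definition reflection_rmodule :: "nat \<Rightarrow> (nat \<Rightarrow> nat, nat) rmodule" where
  "reflection_rmodule n =
     \<lparr>vecs = {x. (\<forall>i. i \<notin> {1..n} \<longrightarrow> x i = 0) \<and> (\<Sum>i\<in>{1..n}. x i) = 0},
      act = (\<lambda>x \<sigma>. x \<circ> \<sigma>)\<rparr>"

definition signed_shuffle :: "nat \<Rightarrow> nat \<Rightarrow> (nat \<Rightarrow> nat) \<Rightarrow> rat" where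
  "signed_shuffle n i =
     (\<Sum>w | w permutes {1..n} \<and> strict_mono_on {1..i} w \<and> strict_mono_on {i+1..n} w.
        qscale (of_int (sign w)) (delta w))"

definition shuffle_element :: "nat \<Rightarrow> (nat \<Rightarrow> nat) \<Rightarrow> rat" where
  "shuffle_element n = (\<Sum>i\<in>{1..n-1}. signed_shuffle n i)"

definition shuffle_eigenspace :: "nat \<Rightarrow> nat \<Rightarrow> ((nat \<Rightarrow> nat) \<Rightarrow> rat) set" where
  "shuffle_eigenspace n j =
     {x \<in> carrier (QS n). shuffle_element n \<otimes>\<^bsub>QS n\<^esub> x = qscale (2 ^ j - 2) x}"

text \<open>
  There is at most one such element: two commuting idempotents with the same image agree.
\<close>

definition eulerian_idempotent :: "nat \<Rightarrow> nat \<Rightarrow> (nat \<Rightarrow> nat) \<Rightarrow> rat" where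
  "eulerian_idempotent n j =
     (THE e. (\<exists>m a. e = (\<Sum>k<m. qscale (a k) (shuffle_element n [^]\<^bsub>QS n\<^esub> (k::nat)))) \<and>
             (\<forall>x\<in>carrier (QS n). e \<otimes>\<^bsub>QS n\<^esub> x \<in> shuffle_eigenspace n j) \<and>
             (\<forall>x\<in>shuffle_eigenspace n j. e \<otimes>\<^bsub>QS n\<^esub> x = x))"

definition eulerian_rmodule :: "nat \<Rightarrow> nat \<Rightarrow> (nat \<Rightarrow> nat, nat \<Rightarrow> nat) rmodule" where
  "eulerian_rmodule n j = right_ideal_rmodule (sym_group n) (eulerian_idempotent n j)"

definition n_cycle :: "nat \<Rightarrow> nat \<Rightarrow> nat" where
  "n_cycle n = cycle_of_list [1..<n + 1]"

definition Lambda :: "nat \<Rightarrow> (nat \<Rightarrow> nat) \<Rightarrow> rat" where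
  "Lambda n = (\<Sum>i<n. qscale (of_int (sign (n_cycle n) ^ i)) (delta (n_cycle n ^^ i)))"

definition whitehouse_rmodule :: "nat \<Rightarrow> nat \<Rightarrow> (nat \<Rightarrow> nat, nat \<Rightarrow> nat) rmodule" where
  "whitehouse_rmodule n j =
     right_ideal_rmodule (sym_group n) (Lambda n \<otimes>\<^bsub>QS n\<^esub> eulerian_idempotent (n - 1) j)"

abbreviation RS :: "nat \<Rightarrow> ((nat \<Rightarrow> nat, nat) rmodule \<Rightarrow>\<^sub>0 int) set ring" where
  "RS n \<equiv> rep_ring (sym_group n)"

abbreviation E_class :: "nat \<Rightarrow> nat \<Rightarrow> ((nat \<Rightarrow> nat, nat) rmodule \<Rightarrow>\<^sub>0 int) set" where
  "E_class n j \<equiv> rep_class (sym_group n) (eulerian_rmodule n j)"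

abbreviation E_ind_class :: "nat \<Rightarrow> nat \<Rightarrow> ((nat \<Rightarrow> nat, nat) rmodule \<Rightarrow>\<^sub>0 int) set" where
  "E_ind_class n j \<equiv> rep_class (sym_group n)
     (induced_rmodule (sym_group n) (carrier (sym_group (n - 1))) (eulerian_rmodule (n - 1) j))"

abbreviation F_class :: "nat \<Rightarrow> nat \<Rightarrow> ((nat \<Rightarrow> nat, nat) rmodule \<Rightarrow>\<^sub>0 int) set" where
  "F_class n j \<equiv> rep_class (sym_group n) (whitehouse_rmodule n j)"

abbreviation V_class :: "nat \<Rightarrow> ((nat \<Rightarrow> nat, nat) rmodule \<Rightarrow>\<^sub>0 int) set" where
  "V_class n \<equiv> rep_class (sym_group n) (reflection_rmodule n)"

end

theory Submission
  imports Defs "HOL-Computational_Algebra.Polynomial"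
begin

text \<open>
  Comparing coefficients of \<open>t\<close>, the relation says \<open>E\<^sub>n\<^sup>j = F\<^sub>n\<^sup>j\<^sup>-\<^sup>1 + V F\<^sub>n\<^sup>j\<close> for \<open>1 \<le> j \<le> n\<close>,
  where \<open>F\<^sub>n\<^sup>0\<close> and \<open>F\<^sub>n\<^sup>n\<close> are zero. As \<open>F\<^sub>n\<^sup>j\<close> restricts to \<open>E\<^sub>n\<^sub>-\<^sub>1\<^sup>j\<close> and \<open>1 + V\<close> is the
  permutation module, \<open>V F\<^sub>n\<^sup>j + F\<^sub>n\<^sup>j\<close> is induced from \<open>E\<^sub>n\<^sub>-\<^sub>1\<^sup>j\<close>. Hence for \<open>j < n\<close> the relation
  is the difference of two consecutive identities of the system. The one for \<open>j = n\<close> follows from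
  them by summing, because the \<open>E\<^sub>n\<^sup>j\<close> and the induced modules both add up to the regular
  representation.

  Two facts on the shuffle element enter. It is diagonalizable with eigenvalues \<open>2\<^sup>j - 2\<close>: the
  signed \<open>a\<close>-riffle shuffles \<open>P\<^sub>a\<close> multiply as \<open>P\<^sub>a P\<^sub>b = P\<^sub>a\<^sub>b\<close> (radix sort), \<open>P\<^sub>2 = s\<^sub>n + 2\<close>, and the
  coefficients of \<open>P\<^sub>a\<close> are polynomials in \<open>a\<close> of degree at most \<open>n\<close> without constant term. And
  \<open>s\<^sub>n\<^sub>-\<^sub>1\<close> commutes with \<open>\<Lambda>\<^sub>n\<close>: its coefficients depend, up to the sign, only on the number of
  descents, and the number of cyclic descents does not change when values or positions are rotated.
\<close>

section \<open>Linear maps and tensor products\<close>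

text \<open>The decomposition of the induced module is obtained without a restriction functor. With
  \<open>e\<close> an Eulerian idempotent for \<open>n - 1\<close>, induction gives the right ideal
  of \<open>QS n\<close> generated by \<open>e\<close>. Left multiplication by
  \<open>Lambda n\<close> maps this ideal onto Whitehouse's module, and an explicit gluing describes
  the kernel as the tensor product of that module with the reflection representation. Since the
  Grothendieck group is defined by short exact sequences, this sequence already is the equation of
  classes. The idempotents are given by a definite description. It denotes something only once every
  polynomial that vanishes at the numbers \<open>2 ^ j - 2\<close> is known to annihilate the
  shuffle element, so nothing can be said about the Eulerian modules before the spectrum is settled.
  Modules live on many index types while the generators of the ring live on \<open>nat\<close>;
  hence the care for isomorphic copies in everything that concerns classes.\<close>

lemma linear_onD:
  assumes "linear_on V f"
  shows "x \<in> V \<Longrightarrow> y \<in> V \<Longrightarrow> f (x + y) = f x + f y"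
    and "x \<in> V \<Longrightarrow> f (qscale c x) = qscale c (f x)"
  using assms by (auto simp: linear_on_def)

lemma qscale_simps [simp]: "qscale 0 x = 0" "qscale 1 x = x" "qscale c 0 = 0"
  by (simp_all add: qscale_def fun_eq_iff)

lemma linear_on_0:
  assumes "linear_on V f" "qvs.subspace V"
  shows "f 0 = 0"
  using linear_onD(2)[OF assms(1) qvs.subspace_0[OF assms(2)], of 0] by simp

lemma linear_on_uminus:
  assumes "linear_on V f" "x \<in> V"
  shows "f (- x) = - f x"
proof -
  have "- y = qscale (-1) y" for y :: "'i \<Rightarrow> rat"
    by (simp add: qscale_def fun_eq_iff)
  moreover have "- y = qscale (-1) y" for y :: "'j \<Rightarrow> rat"
    by (simp add: qscale_def fun_eq_iff)
  ultimately show ?thesis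
    using linear_onD(2)[OF assms, of "-1"] by metis
qed

lemma linear_on_diff:
  assumes "linear_on V f" "qvs.subspace V" "x \<in> V" "y \<in> V"
  shows "f (x - y) = f x - f y"
proof -
  have "- y \<in> V"
    using assms by (simp add: qvs.subspace_neg)
  then have "f (x + - y) = f x + f (- y)"
    by (rule linear_onD(1)[OF assms(1) assms(3)])
  then show ?thesis
    by (simp add: linear_on_uminus[OF assms(1,4)])
qed

lemma linear_on_sum:
  assumes "linear_on V f" "qvs.subspace V" "\<And>i. i \<in> A \<Longrightarrow> x i \<in> V"
  shows "f (\<Sum>i\<in>A. x i) = (\<Sum>i\<in>A. f (x i))"
  using assms(3)
proof (induction A rule: infinite_finite_induct)
  case (insert a A)
  then have "(\<Sum>i\<in>A. x i) \<in> V" "x a \<in> V"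
    by (auto intro!: qvs.subspace_sum assms(2))
  then have "f (x a + (\<Sum>i\<in>A. x i)) = f (x a) + f (\<Sum>i\<in>A. x i)"
    by (intro linear_onD(1)[OF assms(1)])
  with insert.IH insert.prems show ?case
    unfolding sum.insert[OF insert.hyps] by (metis insertCI)
qed (metis linear_on_0[OF assms(1,2)] sum.infinite, metis linear_on_0[OF assms(1,2)] sum.empty)

lemma linear_on_compose:
  assumes "linear_on V f" "linear_on W g" "f ` V \<subseteq> W"
  shows "linear_on V (\<lambda>x. g (f x))"
  using assms unfolding linear_on_def by (simp add: image_subset_iff)

lemma linear_on_cong:
  assumes "linear_on V f" "qvs.subspace V" "\<And>x. x \<in> V \<Longrightarrow> f x = f' x"
  shows "linear_on V f'"
  unfolding linear_on_def
proof (intro conjI ballI allI)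
  fix x y assume "x \<in> V" "y \<in> V"
  then show "f' (x + y) = f' x + f' y"
    using linear_onD(1)[OF assms(1)] qvs.subspace_add[OF assms(2)] assms(3) by metis
next
  fix c x assume "x \<in> V"
  then show "f' (qscale c x) = qscale c (f' x)"
    using linear_onD(2)[OF assms(1)] qvs.subspace_scale[OF assms(2)] assms(3) by metis
qed

lemma linear_on_inj_iff:
  assumes "linear_on V f" "qvs.subspace V"
  shows "inj_on f V \<longleftrightarrow> (\<forall>x\<in>V. f x = 0 \<longrightarrow> x = 0)"
proof
  assume "inj_on f V"
  then show "\<forall>x\<in>V. f x = 0 \<longrightarrow> x = 0"
    using linear_on_0[OF assms] qvs.subspace_0[OF assms(2)] by (metis inj_onD)
next
  assume *: "\<forall>x\<in>V. f x = 0 \<longrightarrow> x = 0"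
  show "inj_on f V"
  proof (rule inj_onI)
    fix x y assume xy: "x \<in> V" "y \<in> V" "f x = f y"
    then have "x - y \<in> V" "f (x - y) = 0"
      using linear_on_diff[OF assms] qvs.subspace_diff[OF assms(2)] by auto
    with * have "x - y = 0" by blast
    then show "x = y" by simp
  qed
qed

lemma linear_on_the_inv_into:
  assumes "linear_on V f" "qvs.subspace V" "inj_on f V"
  shows "linear_on (f ` V) (the_inv_into V f)"
  unfolding linear_on_def
proof (intro conjI ballI allI)
  fix x y assume "x \<in> f ` V" "y \<in> f ` V"
  then obtain a b where ab: "a \<in> V" "b \<in> V" "x = f a" "y = f b" by auto
  then have "x + y = f (a + b)" "a + b \<in> V"
    using assms by (auto simp: linear_onD qvs.subspace_add)
  then show "the_inv_into V f (x + y) = the_inv_into V f x + the_inv_into V f y"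
    using ab assms(3) by (simp add: the_inv_into_f_f)
next
  fix c x assume "x \<in> f ` V"
  then obtain a where a: "a \<in> V" "x = f a" by auto
  then have "qscale c x = f (qscale c a)" "qscale c a \<in> V"
    using assms by (auto simp: linear_onD qvs.subspace_scale)
  then show "the_inv_into V f (qscale c x) = qscale c (the_inv_into V f x)"
    using a assms(3) by (simp add: the_inv_into_f_f)
qed

lemma subspace_linear_image:
  assumes "linear_on V f" "qvs.subspace V"
  shows "qvs.subspace (f ` V)"
proof (rule qvs.subspaceI)
  show "0 \<in> f ` V"
    using linear_on_0[OF assms] qvs.subspace_0[OF assms(2)] by (metis imageI)
next
  fix x y assume "x \<in> f ` V" "y \<in> f ` V"
  then show "x + y \<in> f ` V"
    using linear_onD(1)[OF assms(1)] qvs.subspace_add[OF assms(2)]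
    by (metis (no_types, opaque_lifting) imageE imageI)
next
  fix c x assume "x \<in> f ` V"
  then show "qscale c x \<in> f ` V"
    using linear_onD(2)[OF assms(1)] qvs.subspace_scale[OF assms(2)]
    by (metis (no_types, opaque_lifting) imageE imageI)
qed

lemma linear_on_span_image:
  assumes "linear_on (qvs.span B) f"
  shows "f ` qvs.span B = qvs.span (f ` B)"
proof
  \<comment> \<open>Additivity of \<open>f\<close> is available on the span only, so membership is
    carried through the induction together with the claim.\<close>
  have "x \<in> qvs.span B \<and> f x \<in> qvs.span (f ` B)" if "x \<in> qvs.span B" for x
    using that
  proof (induction x rule: qvs.span_induct_alt)
    case base
    show ?case
      unfolding linear_on_0[OF assms qvs.subspace_span] by (intro conjI qvs.span_zero)
  next
    case (step c x y)
    then have xy: "x \<in> qvs.span B" "qscale c x \<in> qvs.span B" "y \<in> qvs.span B"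
      by (auto intro: qvs.span_base qvs.span_scale)
    show ?case
      unfolding linear_onD(1)[OF assms xy(2,3)] linear_onD(2)[OF assms xy(1)]
      using step xy by (intro conjI qvs.span_add qvs.span_scale) (auto intro: qvs.span_base)
  qed
  then show "f ` qvs.span B \<subseteq> qvs.span (f ` B)" by blast
  show "qvs.span (f ` B) \<subseteq> f ` qvs.span B"
    by (intro qvs.span_minimal subspace_linear_image assms qvs.subspace_span image_mono
        qvs.span_superset)
qed

lemma linear_on_span_eq:
  assumes "linear_on (qvs.span B) f" "linear_on (qvs.span B) g" "\<And>x. x \<in> B \<Longrightarrow> f x = g x"
    and "x \<in> qvs.span B"
  shows "f x = g x"
proof -
  have "x \<in> qvs.span B \<and> f x = g x"
    using assms(4)
  proof (induction x rule: qvs.span_induct_alt)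
    case base
    show ?case
      using linear_on_0[OF assms(1) qvs.subspace_span] linear_on_0[OF assms(2) qvs.subspace_span]
        qvs.span_zero by metis
  next
    case (step c x y)
    then have xy: "x \<in> qvs.span B" "qscale c x \<in> qvs.span B" "y \<in> qvs.span B"
      by (auto intro: qvs.span_base qvs.span_scale)
    show ?case
      unfolding linear_onD(1)[OF assms(1) xy(2,3)] linear_onD(1)[OF assms(2) xy(2,3)]
        linear_onD(2)[OF assms(1) xy(1)] linear_onD(2)[OF assms(2) xy(1)]
      using step xy assms(3) by (metis qvs.span_add)
  qed
  then show ?thesis ..
qed

lemma finite_independent_spanning:
  assumes "finite B"
  obtains C where "finite C" "qvs.independent C" "qvs.span C = qvs.span (B :: ('i \<Rightarrow> rat) set)"
proof -
  obtain C where C: "C \<subseteq> B" "qvs.independent C" "B \<subseteq> qvs.span C"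
    using qvs.maximal_independent_subset[of B] by blast
  then have "qvs.span C = qvs.span B"
    by (meson qvs.span_minimal qvs.span_mono qvs.subspace_span subset_antisym)
  with C that show ?thesis
    using assms finite_subset by blast
qed

section \<open>Tensor products of subspaces of function spaces\<close>

definition tensor_span :: "('i \<Rightarrow> rat) set \<Rightarrow> ('j \<Rightarrow> rat) set \<Rightarrow> ('i \<times> 'j \<Rightarrow> rat) set" where
  "tensor_span U W = qvs.span {pure_tensor x y | x y. x \<in> U \<and> y \<in> W}"

text \<open>This is \<open>f \<otimes> id\<close> in coordinates. Tensors are arrays, so the map is
  given by a formula instead of a universal property.\<close>

definition colmap :: "(('i \<Rightarrow> rat) \<Rightarrow> 'k \<Rightarrow> rat) \<Rightarrow> ('i \<times> 'j \<Rightarrow> rat) \<Rightarrow> 'k \<times> 'j \<Rightarrow> rat" where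
  "colmap f z = (\<lambda>(i, j). f (\<lambda>i'. z (i', j)) i)"

definition transpose_tensor :: "('i \<times> 'j \<Rightarrow> rat) \<Rightarrow> 'j \<times> 'i \<Rightarrow> rat" where
  "transpose_tensor z = (\<lambda>(j, i). z (i, j))"

text \<open>This is \<open>id \<otimes> f\<close>, defined by transposition so that its properties
  follow from those of \<open>colmap\<close>.\<close>

definition rowmap :: "(('j \<Rightarrow> rat) \<Rightarrow> 'k \<Rightarrow> rat) \<Rightarrow> ('i \<times> 'j \<Rightarrow> rat) \<Rightarrow> 'i \<times> 'k \<Rightarrow> rat" where
  "rowmap f z = transpose_tensor (colmap f (transpose_tensor z))"

lemma subspace_tensor_span [simp]: "qvs.subspace (tensor_span U W)"
  by (simp add: tensor_span_def)

lemma pure_tensor_in_tensor_span [intro]: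
  "x \<in> U \<Longrightarrow> y \<in> W \<Longrightarrow> pure_tensor x y \<in> tensor_span U W"
  unfolding tensor_span_def by (intro qvs.span_base) blast

lemma pure_tensor_linear:
  "pure_tensor (x + x') y = pure_tensor x y + pure_tensor x' y"
  "pure_tensor x (y + y') = pure_tensor x y + pure_tensor x y'"
  "pure_tensor (qscale c x) y = qscale c (pure_tensor x y)"
  "pure_tensor x (qscale c y) = qscale c (pure_tensor x y)"
  "pure_tensor 0 y = 0" "pure_tensor x 0 = 0"
  by (auto simp: pure_tensor_def qscale_def fun_eq_iff algebra_simps)

text \<open>Column \<open>j\<close> of \<open>pure_tensor u w\<close> is \<open>w j\<close> times
  \<open>u\<close>. This is what allows a map that is linear only on \<open>U\<close> to act on the
  columns of a tensor.\<close>

lemma column_in_subspace: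
  assumes "qvs.subspace U" "z \<in> tensor_span U W"
  shows "(\<lambda>i. z (i, j)) \<in> U"
  using assms(2) unfolding tensor_span_def
proof (induction z rule: qvs.span_induct_alt)
  case base
  then show ?case
    using qvs.subspace_0[OF assms(1)] by (simp add: zero_fun_def)
next
  case (step c x z)
  then obtain u w where uw: "u \<in> U" "x = pure_tensor u w" by auto
  have "(\<lambda>i. (qscale c x + z) (i, j)) = qscale (c * w j) u + (\<lambda>i. z (i, j))"
    by (auto simp: uw pure_tensor_def qscale_def fun_eq_iff)
  with uw step show ?case
    by (simp add: assms(1) qvs.subspace_add qvs.subspace_scale)
qed

lemma transpose_tensor_transpose [simp]: "transpose_tensor (transpose_tensor z) = z"
  by (simp add: transpose_tensor_def)

lemma linear_on_transpose: "linear_on V transpose_tensor"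
  by (auto simp: linear_on_def transpose_tensor_def qscale_def fun_eq_iff)

lemma transpose_pure_tensor [simp]: "transpose_tensor (pure_tensor x y) = pure_tensor y x"
  by (auto simp: transpose_tensor_def pure_tensor_def)

lemma transpose_image: "transpose_tensor ` tensor_span U W = tensor_span W U"
proof -
  have "transpose_tensor ` {pure_tensor x y | x y. x \<in> U \<and> y \<in> W} =
        {pure_tensor x y | x y. x \<in> W \<and> y \<in> U}"
    by (force simp: image_iff)
  then show ?thesis
    by (simp add: tensor_span_def linear_on_span_image[OF linear_on_transpose])
qed

lemma row_in_subspace:
  assumes "qvs.subspace W" "z \<in> tensor_span U W"
  shows "(\<lambda>j. z (i, j)) \<in> W"
proof -
  have "transpose_tensor z \<in> tensor_span W U"
    using assms(2) transpose_image by blast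
  from column_in_subspace[OF assms(1) this, of i] show ?thesis
    by (simp add: transpose_tensor_def)
qed

lemma linear_on_colmap:
  assumes "qvs.subspace U" "linear_on U f"
  shows "linear_on (tensor_span U W) (colmap f)"
  unfolding linear_on_def
proof (intro conjI ballI allI)
  fix z z' assume z: "z \<in> tensor_span U W" "z' \<in> tensor_span U W"
  show "colmap f (z + z') = colmap f z + colmap f z'"
  proof (clarsimp simp: fun_eq_iff colmap_def)
    fix i j
    have "(\<lambda>i'. z (i', j) + z' (i', j)) = (\<lambda>i'. z (i', j)) + (\<lambda>i'. z' (i', j))"
      by (simp add: fun_eq_iff)
    then show "f (\<lambda>i'. z (i', j) + z' (i', j)) i = f (\<lambda>i'. z (i', j)) i + f (\<lambda>i'. z' (i', j)) i"
      using linear_onD(1)[OF assms(2) column_in_subspace[OF assms(1) z(1)]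
          column_in_subspace[OF assms(1) z(2)], of j j]
      by simp
  qed
next
  fix c z assume z: "z \<in> tensor_span U W"
  show "colmap f (qscale c z) = qscale c (colmap f z)"
  proof (clarsimp simp: fun_eq_iff colmap_def)
    fix i j
    have "(\<lambda>i'. qscale c z (i', j)) = qscale c (\<lambda>i'. z (i', j))"
      by (simp add: fun_eq_iff qscale_def)
    then show "f (\<lambda>i'. qscale c z (i', j)) i = qscale c (\<lambda>(i, j). f (\<lambda>i'. z (i', j)) i) (i, j)"
      using column_in_subspace[OF assms(1) z]
      by (simp add: linear_onD[OF assms(2)]) (simp add: qscale_def)
  qed
qed

lemma colmap_pure_tensor:
  assumes "linear_on U f" "x \<in> U"
  shows "colmap f (pure_tensor x y) = pure_tensor (f x) y"
proof -
  have "(\<lambda>i'. x i' * y j) = qscale (y j) x" for j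
    by (simp add: qscale_def mult.commute)
  then show ?thesis
    using assms
    by (simp add: colmap_def pure_tensor_def linear_onD fun_eq_iff) (simp add: qscale_def)
qed

lemma colmap_image:
  assumes "qvs.subspace U" "linear_on U f"
  shows "colmap f ` tensor_span U W = tensor_span (f ` U) W"
proof -
  have "colmap f ` {pure_tensor x y | x y. x \<in> U \<and> y \<in> W} =
        {pure_tensor x y | x y. x \<in> f ` U \<and> y \<in> W}"
    by (force simp: image_iff colmap_pure_tensor[OF assms(2)])
  then show ?thesis
    using linear_on_colmap[OF assms, of W]
    by (simp add: tensor_span_def linear_on_span_image)
qed

lemma tensor_span_mono: "U \<subseteq> U' \<Longrightarrow> W \<subseteq> W' \<Longrightarrow> tensor_span U W \<subseteq> tensor_span U' W'"
  unfolding tensor_span_def by (intro qvs.span_mono) blast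

lemma colmap_closed:
  assumes "qvs.subspace U" "linear_on U f" "f ` U \<subseteq> U'" "z \<in> tensor_span U W"
  shows "colmap f z \<in> tensor_span U' W"
proof -
  have "colmap f z \<in> tensor_span (f ` U) W"
    using assms(4) colmap_image[OF assms(1,2), of W] by blast
  then show ?thesis
    using tensor_span_mono[OF assms(3) order_refl, of W] by (rule rev_subsetD)
qed

text \<open>\<open>colmap f\<close> treats every column by itself, and all columns lie in
  \<open>U\<close>.\<close>

lemma colmap_inj:
  assumes "qvs.subspace U" "inj_on f U"
  shows "inj_on (colmap f) (tensor_span U W)"
proof (rule inj_onI)
  fix z z' assume z: "z \<in> tensor_span U W" "z' \<in> tensor_span U W" "colmap f z = colmap f z'"
  have "(\<lambda>i'. z (i', j)) = (\<lambda>i'. z' (i', j))" for j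
  proof (rule inj_onD[OF assms(2)])
    show "f (\<lambda>i'. z (i', j)) = f (\<lambda>i'. z' (i', j))"
    proof
      fix i show "f (\<lambda>i'. z (i', j)) i = f (\<lambda>i'. z' (i', j)) i"
        using fun_cong[OF z(3), of "(i, j)"] by (simp add: colmap_def)
    qed
  qed (rule column_in_subspace[OF assms(1) z(1)] column_in_subspace[OF assms(1) z(2)])+
  then show "z = z'"
    by (auto simp: fun_eq_iff)
qed

lemma linear_on_rowmap:
  assumes "qvs.subspace W" "linear_on W f"
  shows "linear_on (tensor_span U W) (rowmap f)"
  unfolding rowmap_def
  by (rule linear_on_compose[OF linear_on_compose[OF linear_on_transpose
          linear_on_colmap[OF assms]] linear_on_transpose[of UNIV]])
     (auto simp: transpose_image)

lemma rowmap_closed: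
  assumes "qvs.subspace W" "linear_on W f" "f ` W \<subseteq> W'" "z \<in> tensor_span U W"
  shows "rowmap f z \<in> tensor_span U W'"
  unfolding rowmap_def
  by (metis assms colmap_closed imageI transpose_image)

text \<open>Supplies coordinates along the second factor. Together with their uniqueness in
  \<open>tensor_independent\<close> it reduces questions about tensors to questions about vectors of
  \<open>U\<close>.\<close>

lemma tensor_expansion:
  assumes "qvs.subspace U" "finite B" "z \<in> tensor_span U (qvs.span B)"
  shows "\<exists>x. (\<forall>y\<in>B. x y \<in> U) \<and> z = (\<Sum>y\<in>B. pure_tensor (x y) y)"
  using assms(3) unfolding tensor_span_def
proof (induction z rule: qvs.span_induct_alt)
  case base
  show ?case
  proof (intro exI conjI ballI)
    show "(0 :: 'a \<Rightarrow> rat) \<in> U"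
      by (rule qvs.subspace_0[OF assms(1)])
    show "0 = (\<Sum>y\<in>B. pure_tensor (0 :: 'a \<Rightarrow> rat) y)"
      unfolding pure_tensor_linear by (rule sum.neutral_const[symmetric])
  qed
next
  case (step c t z)
  obtain u w where uw: "u \<in> U" "w \<in> qvs.span B" "t = pure_tensor u w"
    using step.hyps by auto
  obtain a where a: "w = (\<Sum>y\<in>B. qscale (a y) y)"
    using uw(2) unfolding qvs.span_finite[OF assms(2)] by blast
  have pure_sum: "pure_tensor u (\<Sum>y\<in>C. qscale (a y) y) = (\<Sum>y\<in>C. pure_tensor (qscale (a y) u) y)"
    for C
  proof (induction C rule: infinite_finite_induct)
    case (insert y C)
    show ?case
      unfolding sum.insert[OF insert.hyps] pure_tensor_linear insert.IH ..
  next
    case (infinite C)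
    show ?case
      unfolding sum.infinite[OF infinite] pure_tensor_linear ..
  next
    case empty
    show ?case
      unfolding sum.empty pure_tensor_linear ..
  qed
  have scale_sum: "qscale c (\<Sum>y\<in>B. pure_tensor (qscale (a y) u) y) =
      (\<Sum>y\<in>B. pure_tensor (qscale c (qscale (a y) u)) y)"
    unfolding qvs.scale_sum_right pure_tensor_linear ..
  obtain x where x: "\<forall>y\<in>B. x y \<in> U" "z = (\<Sum>y\<in>B. pure_tensor (x y) y)"
    using step.IH by blast
  show ?case
  proof (intro exI conjI ballI)
    show "qscale c (qscale (a y) u) + x y \<in> U" if "y \<in> B" for y
      using that x uw by (intro qvs.subspace_add[OF assms(1)] qvs.subspace_scale[OF assms(1)]) blast+
    show "qscale c t + z = (\<Sum>y\<in>B. pure_tensor (qscale c (qscale (a y) u) + x y) y)"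
      unfolding uw(3) a pure_sum scale_sum x(2) pure_tensor_linear(1) sum.distrib ..
  qed
qed

lemma sum_fun_apply: "(\<Sum>a\<in>A. f a) x = (\<Sum>a\<in>A. (f a x :: 'b :: comm_monoid_add))"
  by (induction A rule: infinite_finite_induct) simp_all

text \<open>With the first index fixed at \<open>i\<close>, the numbers \<open>x y i\<close> are the
  coefficients of a linear relation among the elements of \<open>B\<close>.\<close>

lemma tensor_independent:
  assumes "finite B" "qvs.independent B" "(\<Sum>y\<in>B. pure_tensor (x y) y) = 0" "y \<in> B"
  shows "x y = 0"
proof
  fix i
  have "(\<Sum>y\<in>B. qscale (x y i) y) = 0"
  proof
    fix j
    show "(\<Sum>y\<in>B. qscale (x y i) y) j = 0 j"
      using fun_cong[OF assms(3), of "(i, j)"]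
      by (simp add: sum_fun_apply pure_tensor_def qscale_def)
  qed
  then show "x y i = 0 i"
    using assms qvs.independentD[of B B "\<lambda>y. x y i" y] by simp
qed

text \<open>The coordinates of \<open>z\<close> along a basis of the second factor are killed by
  \<open>p\<close> one by one; each lifts along \<open>f\<close>, and the lifts are put together
  again.\<close>

lemma colmap_exact:
  assumes "qvs.subspace U" "finite B" "linear_on U p" "linear_on V f" "qvs.subspace V"
    and kernel: "\<And>x. x \<in> U \<Longrightarrow> p x = 0 \<Longrightarrow> x \<in> f ` V"
    and z: "z \<in> tensor_span U (qvs.span B)" "colmap p z = 0"
  shows "z \<in> colmap f ` tensor_span V (qvs.span B)"
proof -
  obtain C where C: "finite C" "qvs.independent C" "qvs.span C = qvs.span B"
    using finite_independent_spanning[OF assms(2)] .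
  obtain x where x: "\<forall>y\<in>C. x y \<in> U" "z = (\<Sum>y\<in>C. pure_tensor (x y) y)"
    using tensor_expansion[OF assms(1) C(1), of z] z(1) C(3) by auto
  have pure: "pure_tensor u y \<in> tensor_span U (qvs.span B)" if "u \<in> U" "y \<in> C" for u y
    unfolding C(3)[symmetric] using that by (intro pure_tensor_in_tensor_span qvs.span_base)
  have pure': "pure_tensor u y \<in> tensor_span V (qvs.span B)" if "u \<in> V" "y \<in> C" for u y
    unfolding C(3)[symmetric] using that by (intro pure_tensor_in_tensor_span qvs.span_base)
  have "colmap p z = (\<Sum>y\<in>C. colmap p (pure_tensor (x y) y))"
    unfolding x(2) using x(1) pure
    by (intro linear_on_sum[OF linear_on_colmap[OF assms(1,3), of "qvs.span B"]]) auto
  also have "\<dots> = (\<Sum>y\<in>C. pure_tensor (p (x y)) y)"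
    using x(1) by (intro sum.cong) (auto simp: colmap_pure_tensor[OF assms(3)])
  finally have "\<forall>y\<in>C. p (x y) = 0"
    using tensor_independent[OF C(1,2), of "\<lambda>y. p (x y)"] z(2) by auto
  then have "\<forall>y\<in>C. \<exists>a\<in>V. x y = f a"
    using kernel x(1) by blast
  then obtain a where a: "\<And>y. y \<in> C \<Longrightarrow> a y \<in> V" "\<And>y. y \<in> C \<Longrightarrow> x y = f (a y)"
    by metis
  have "colmap f (\<Sum>y\<in>C. pure_tensor (a y) y) = (\<Sum>y\<in>C. colmap f (pure_tensor (a y) y))"
    using a pure' by (intro linear_on_sum[OF linear_on_colmap[OF assms(5,4), of "qvs.span B"]]) auto
  also have "\<dots> = z"
    unfolding x(2) using a by (intro sum.cong) (auto simp: colmap_pure_tensor[OF assms(4)])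
  finally have "z = colmap f (\<Sum>y\<in>C. pure_tensor (a y) y)" ..
  moreover have "(\<Sum>y\<in>C. pure_tensor (a y) y) \<in> tensor_span V (qvs.span B)"
    using a pure' by (intro qvs.subspace_sum) auto
  ultimately show ?thesis by blast
qed

lemma tensor_span_span:
  "tensor_span (qvs.span B) (qvs.span C) = qvs.span ((\<lambda>(x, y). pure_tensor x y) ` (B \<times> C))"
  (is "_ = qvs.span ?P")
proof
  have aux: "pure_tensor x y \<in> qvs.span ?P" if "x \<in> qvs.span B" "y \<in> C" for x y
    using that(1)
  proof (induction x rule: qvs.span_induct_alt)
    case (step c x' y')
    then have "pure_tensor x' y \<in> qvs.span ?P"
      using that(2) by (intro qvs.span_base) auto
    with step.IH show ?case
      unfolding pure_tensor_linear by (intro qvs.span_add qvs.span_scale)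
  qed (unfold pure_tensor_linear, rule qvs.span_zero)
  have "pure_tensor x y \<in> qvs.span ?P" if "x \<in> qvs.span B" "y \<in> qvs.span C" for x y
    using that(2)
  proof (induction y rule: qvs.span_induct_alt)
    case (step c x' y')
    show ?case
      unfolding pure_tensor_linear
      by (intro qvs.span_add qvs.span_scale step aux[OF that(1)])
  qed (unfold pure_tensor_linear, rule qvs.span_zero)
  then show "tensor_span (qvs.span B) (qvs.span C) \<subseteq> qvs.span ?P"
    unfolding tensor_span_def by (intro qvs.span_minimal) auto
  show "qvs.span ?P \<subseteq> tensor_span (qvs.span B) (qvs.span C)"
    unfolding tensor_span_def by (intro qvs.span_mono) (auto intro: qvs.span_base)
qed

section \<open>Modules\<close>

lemma fd_rmoduleD:
  assumes "fd_rmodule G M"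
  shows "\<exists>B. finite B \<and> vecs M = qvs.span B"
    and "qvs.subspace (vecs M)"
    and "g \<in> carrier G \<Longrightarrow> linear_on (vecs M) (\<lambda>x. act M x g)"
    and "g \<in> carrier G \<Longrightarrow> x \<in> vecs M \<Longrightarrow> act M x g \<in> vecs M"
    and "x \<in> vecs M \<Longrightarrow> act M x \<one>\<^bsub>G\<^esub> = x"
    and "x \<in> vecs M \<Longrightarrow> g \<in> carrier G \<Longrightarrow> h \<in> carrier G \<Longrightarrow>
      act M (act M x g) h = act M x (g \<otimes>\<^bsub>G\<^esub> h)"
  using assms by (auto simp: fd_rmodule_def)

lemma fd_rmoduleI:
  assumes "finite B" "vecs M = qvs.span B"
    and "\<And>g. g \<in> carrier G \<Longrightarrow> linear_on (vecs M) (\<lambda>x. act M x g)"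
    and "\<And>g x. g \<in> carrier G \<Longrightarrow> x \<in> vecs M \<Longrightarrow> act M x g \<in> vecs M"
    and "\<And>x. x \<in> vecs M \<Longrightarrow> act M x \<one>\<^bsub>G\<^esub> = x"
    and "\<And>x g h. x \<in> vecs M \<Longrightarrow> g \<in> carrier G \<Longrightarrow> h \<in> carrier G \<Longrightarrow>
      act M (act M x g) h = act M x (g \<otimes>\<^bsub>G\<^esub> h)"
  shows "fd_rmodule G M"
  using assms unfolding fd_rmodule_def by blast

lemma rmodule_homD:
  assumes "rmodule_hom G M N f"
  shows "x \<in> vecs M \<Longrightarrow> f x \<in> vecs N"
    and "f ` vecs M \<subseteq> vecs N"
    and "linear_on (vecs M) f"
    and "x \<in> vecs M \<Longrightarrow> g \<in> carrier G \<Longrightarrow> f (act M x g) = act N (f x) g"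
  using assms by (auto simp: rmodule_hom_def)

lemma rmodule_homI:
  assumes "\<And>x. x \<in> vecs M \<Longrightarrow> f x \<in> vecs N" "linear_on (vecs M) f"
    and "\<And>x g. x \<in> vecs M \<Longrightarrow> g \<in> carrier G \<Longrightarrow> f (act M x g) = act N (f x) g"
  shows "rmodule_hom G M N f"
  using assms by (auto simp: rmodule_hom_def)

lemma rmodule_hom_compose:
  assumes "rmodule_hom G L M f" "rmodule_hom G M N f'"
  shows "rmodule_hom G L N (\<lambda>x. f' (f x))"
proof (rule rmodule_homI)
  show "linear_on (vecs L) (\<lambda>x. f' (f x))"
    by (rule linear_on_compose[OF rmodule_homD(3)[OF assms(1)] rmodule_homD(3)[OF assms(2)]
          rmodule_homD(2)[OF assms(1)]])
qed (use rmodule_homD[OF assms(1)] rmodule_homD[OF assms(2)] in auto)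

lemma rmodule_iso_trans:
  assumes "rmodule_iso G L M" "rmodule_iso G M N"
  shows "rmodule_iso G L N"
proof -
  obtain f f' where f: "rmodule_hom G L M f" "bij_betw f (vecs L) (vecs M)"
    and f': "rmodule_hom G M N f'" "bij_betw f' (vecs M) (vecs N)"
    using assms by (auto simp: rmodule_iso_def)
  have "bij_betw (\<lambda>x. f' (f x)) (vecs L) (vecs N)"
    using bij_betw_trans[OF f(2) f'(2)] by (simp add: comp_def)
  with rmodule_hom_compose[OF f(1) f'(1)] show ?thesis
    unfolding rmodule_iso_def by blast
qed

lemma rmodule_iso_inverse:
  assumes M: "fd_rmodule G M" and f: "rmodule_hom G M N f" "bij_betw f (vecs M) (vecs N)"
  shows "rmodule_hom G N M (the_inv_into (vecs M) f)"
    and "bij_betw (the_inv_into (vecs M) f) (vecs N) (vecs M)"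
proof -
  let ?f' = "the_inv_into (vecs M) f"
  show bij: "bij_betw ?f' (vecs N) (vecs M)"
    by (rule bij_betw_the_inv_into[OF f(2)])
  have inj: "inj_on f (vecs M)" and im: "f ` vecs M = vecs N"
    using f(2) by (auto simp: bij_betw_def)
  show "rmodule_hom G N M ?f'"
  proof (rule rmodule_homI)
    fix x assume "x \<in> vecs N"
    then show "?f' x \<in> vecs M"
      using bij by (rule bij_betwE[rule_format, rotated])
  next
    show "linear_on (vecs N) ?f'"
      unfolding im[symmetric]
      by (rule linear_on_the_inv_into[OF rmodule_homD(3)[OF f(1)] fd_rmoduleD(2)[OF M] inj])
  next
    fix x g assume x: "x \<in> vecs N" and g: "g \<in> carrier G"
    then obtain a where a: "a \<in> vecs M" "x = f a" using im by blast
    have "f (act M a g) = act N x g"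
      unfolding a(2) by (rule rmodule_homD(4)[OF f(1) a(1) g])
    then have "?f' (act N x g) = act M a g"
      using the_inv_into_f_f[OF inj fd_rmoduleD(4)[OF M g a(1)]] by metis
    then show "?f' (act N x g) = act M (?f' x) g"
      unfolding a(2) the_inv_into_f_f[OF inj a(1)] .
  qed
qed

lemma rmodule_iso_sym:
  assumes "fd_rmodule G M" "rmodule_iso G M N"
  shows "rmodule_iso G N M"
  using assms rmodule_iso_inverse[OF assms(1)] unfolding rmodule_iso_def by blast

text \<open>Transport of structure. With \<open>f\<close> a coordinate map it yields copies of a
  module, with \<open>f\<close> an isomorphism it yields the module axioms for the target.\<close>

lemma transported_rmodule:
  assumes M: "fd_rmodule G M" and f: "linear_on (vecs M) f" "inj_on f (vecs M)"
  defines "N \<equiv> \<lparr>vecs = f ` vecs M, act = (\<lambda>x g. f (act M (the_inv_into (vecs M) f x) g))\<rparr>"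
  shows "fd_rmodule G N" "rmodule_iso G M N"
proof -
  let ?f' = "the_inv_into (vecs M) f"
  note D = fd_rmoduleD[OF M]
  have vecs: "vecs N = f ` vecs M" and act: "act N (f x) g = f (act M x g)" if "x \<in> vecs M" for x g
    using that by (simp_all add: N_def the_inv_into_f_f[OF f(2)])
  have vecs: "vecs N = f ` vecs M" by (simp add: N_def)
  obtain B where B: "finite B" "vecs M = qvs.span B" using D(1) by blast
  show "fd_rmodule G N"
  proof (rule fd_rmoduleI[of "f ` B"])
    show "vecs N = qvs.span (f ` B)"
      unfolding vecs B(2) by (rule linear_on_span_image) (use f(1) B(2) in simp)
  next
    fix g assume g: "g \<in> carrier G"
    have "linear_on (f ` vecs M) (\<lambda>x. f (act M (?f' x) g))"
    proof (rule linear_on_compose[OF linear_on_compose[OF linear_on_the_inv_into[OF f(1) D(2) f(2)]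
            D(3)[OF g]] f(1)])
      show "?f' ` f ` vecs M \<subseteq> vecs M"
        using the_inv_into_f_f[OF f(2)] by auto
      show "(\<lambda>x. act M (?f' x) g) ` f ` vecs M \<subseteq> vecs M"
        using the_inv_into_f_f[OF f(2)] D(4)[OF g] by auto
    qed
    then show "linear_on (vecs N) (\<lambda>x. act N x g)"
      by (simp add: N_def)
  next
    fix x g assume "g \<in> carrier G" "x \<in> vecs N"
    then show "act N x g \<in> vecs N"
      using D(4) by (auto simp: vecs act)
  next
    fix x assume "x \<in> vecs N"
    then show "act N x \<one>\<^bsub>G\<^esub> = x"
      using D(5) by (auto simp: vecs act)
  next
    fix x g h assume "x \<in> vecs N" "g \<in> carrier G" "h \<in> carrier G"
    then show "act N (act N x g) h = act N x (g \<otimes>\<^bsub>G\<^esub> h)"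
      using D(4,6) by (auto simp: vecs act)
  qed (simp add: B)
  have "rmodule_hom G M N f"
    by (rule rmodule_homI) (simp_all add: vecs act f(1))
  then show "rmodule_iso G M N"
    unfolding rmodule_iso_def using f(2) vecs by (auto simp: bij_betw_def)
qed

text \<open>The module transported along the isomorphism has the vectors of \<open>N\<close> and the
  same action wherever the axioms look at it, so \<open>N\<close> inherits them. Induced modules are
  shown to be finite-dimensional in this way.\<close>

lemma fd_rmodule_iso:
  fixes G (structure)
  assumes "group G" and M: "fd_rmodule G M" and "rmodule_iso G M N"
  shows "fd_rmodule G N"
proof -
  interpret group G by fact
  obtain f where f: "rmodule_hom G M N f" "bij_betw f (vecs M) (vecs N)"
    using assms(3) by (auto simp: rmodule_iso_def)
  note f' = rmodule_homD[OF f(1)]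
  have inj: "inj_on f (vecs M)" and vecs: "f ` vecs M = vecs N"
    using f(2) by (auto simp: bij_betw_def)
  define N' where "N' = \<lparr>vecs = f ` vecs M, act = (\<lambda>x g. f (act M (the_inv_into (vecs M) f x) g))\<rparr>"
  have N': "fd_rmodule G N'"
    unfolding N'_def by (rule transported_rmodule(1)[OF M f'(3) inj])
  have vecs': "vecs N' = vecs N" by (simp add: N'_def vecs)
  have act: "act N' x g = act N x g" if "x \<in> vecs N" "g \<in> carrier G" for x g
    using that f'(4) unfolding vecs[symmetric] by (auto simp: N'_def the_inv_into_f_f[OF inj])
  note D = fd_rmoduleD[OF N', unfolded vecs']
  obtain B where B: "finite B" "vecs N = qvs.span B" using D(1) by blast
  show ?thesis
  proof (rule fd_rmoduleI[OF B])
    show "linear_on (vecs N) (\<lambda>x. act N x g)" if "g \<in> carrier G" for g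
      by (rule linear_on_cong[OF D(3)[OF that] D(2) act[OF _ that]])
    show *: "act N x g \<in> vecs N" if "g \<in> carrier G" "x \<in> vecs N" for x g
      using D(4)[OF that] act[OF that(2,1)] by simp
    show "act N x \<one> = x" if "x \<in> vecs N" for x
      using D(5)[OF that] act[OF that one_closed] by simp
    show "act N (act N x g) h = act N x (g \<otimes> h)"
      if "x \<in> vecs N" "g \<in> carrier G" "h \<in> carrier G" for x g h
      using D(6)[OF that] act[OF that(1,2)] act[OF *[OF that(2,1)] that(3)]
        act[OF that(1) m_closed[OF that(2,3)]] by simp
  qed
qed

text \<open>Coordinates in a finite basis whose elements are numbered by naturals. This guarantees
  that the choice in \<open>nat_copy\<close> has something to choose from.\<close>

lemma linear_injection_into_nat_functions:
  assumes "finite B"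
  obtains f :: "('i \<Rightarrow> rat) \<Rightarrow> nat \<Rightarrow> rat"
  where "linear_on (qvs.span B) f" "inj_on f (qvs.span B)"
proof -
  obtain C where C: "finite C" "qvs.independent C" "qvs.span C = qvs.span B"
    using finite_independent_spanning[OF assms] .
  obtain idx :: "('i \<Rightarrow> rat) \<Rightarrow> nat" where idx: "inj_on idx C"
    using finite_imp_inj_to_nat_seg[OF C(1)] by blast
  define f where
    "f x = (\<lambda>k. if k \<in> idx ` C then qvs.representation C x (the_inv_into C idx k) else 0)" for x
  have "linear_on (qvs.span C) f"
    unfolding linear_on_def
  proof (intro conjI ballI allI ext)
    fix x y k assume "x \<in> qvs.span C" "y \<in> qvs.span C"
    from qvs.representation_add[OF C(2) this(2,1)]
    show "f (x + y) k = (f x + f y) k" by (simp add: f_def)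
  next
    fix c x k assume "x \<in> qvs.span C"
    from qvs.representation_scale[OF C(2) this, of c]
    show "f (qscale c x) k = qscale c (f x) k" by (simp add: f_def qscale_def)
  qed
  moreover have "inj_on f (qvs.span C)"
  proof (rule inj_onI)
    fix x y assume xy: "x \<in> qvs.span C" "y \<in> qvs.span C" "f x = f y"
    have "qvs.representation C x b = qvs.representation C y b" if "b \<in> C" for b
      using fun_cong[OF xy(3), of "idx b"] that by (simp add: f_def the_inv_into_f_f[OF idx])
    then have "(\<Sum>b\<in>C. qscale (qvs.representation C x b) b) =
        (\<Sum>b\<in>C. qscale (qvs.representation C y b) b)"
      by (intro sum.cong) auto
    then show "x = y"
      unfolding qvs.sum_representation_eq[OF C(2) xy(1) C(1) order_refl]
        qvs.sum_representation_eq[OF C(2) xy(2) C(1) order_refl] .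
  qed
  ultimately show ?thesis using that C(3) by simp
qed

lemma nat_copy:
  fixes M :: "('g, 'i) rmodule"
  assumes "fd_rmodule G M"
  shows "fd_rmodule G (nat_copy G M)" "rmodule_iso G M (nat_copy G M)"
proof -
  obtain B where B: "finite B" "vecs M = qvs.span B"
    using fd_rmoduleD(1)[OF assms] by blast
  obtain f :: "('i \<Rightarrow> rat) \<Rightarrow> nat \<Rightarrow> rat" where f: "linear_on (vecs M) f" "inj_on f (vecs M)"
    using linear_injection_into_nat_functions[OF B(1)] B(2) by metis
  have "\<exists>N :: ('g, nat) rmodule. fd_rmodule G N \<and> rmodule_iso G M N"
    using transported_rmodule[OF assms f] by blast
  then have "fd_rmodule G (nat_copy G M) \<and> rmodule_iso G M (nat_copy G M)"
    unfolding nat_copy_def by (rule someI_ex)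
  then show "fd_rmodule G (nat_copy G M)" "rmodule_iso G M (nat_copy G M)" by auto
qed

text \<open>The relations of the Grothendieck group speak only of modules on \<open>nat\<close>;
  exact sequences of other modules reach them by conjugation with the isomorphisms onto the
  copies.\<close>

lemma short_exact_iso:
  assumes fd: "fd_rmodule G A" "fd_rmodule G B" "fd_rmodule G C"
    and iso: "rmodule_iso G A A'" "rmodule_iso G B B'" "rmodule_iso G C C'"
    and "short_exact G A B C"
  shows "short_exact G A' B' C'"
proof -
  obtain a where a: "rmodule_hom G A A' a" "bij_betw a (vecs A) (vecs A')"
    using iso(1) by (auto simp: rmodule_iso_def)
  obtain b where b: "rmodule_hom G B B' b" "bij_betw b (vecs B) (vecs B')"
    using iso(2) by (auto simp: rmodule_iso_def)
  obtain c where c: "rmodule_hom G C C' c" "bij_betw c (vecs C) (vecs C')"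
    using iso(3) by (auto simp: rmodule_iso_def)
  obtain f p where f: "rmodule_hom G A B f" and p: "rmodule_hom G B C p"
    and inj: "inj_on f (vecs A)" and surj: "p ` vecs B = vecs C"
    and ker: "f ` vecs A = {y \<in> vecs B. p y = 0}"
    using assms(7) unfolding short_exact_def by blast
  define a' where "a' = the_inv_into (vecs A) a"
  define b' where "b' = the_inv_into (vecs B) b"
  note a' = rmodule_iso_inverse[OF fd(1) a, folded a'_def]
  note b' = rmodule_iso_inverse[OF fd(2) b, folded b'_def]
  have im: "a' ` vecs A' = vecs A" "b ` vecs B = vecs B'" "b' ` vecs B' = vecs B" "c ` vecs C = vecs C'"
    using a'(2) b(2) b'(2) c(2) by (auto simp: bij_betw_def)
  have b'b: "b' (b x) = x" if "x \<in> vecs B" for x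
    using that b(2) by (simp add: b'_def the_inv_into_f_f bij_betw_def)
  have c0: "c x = 0 \<longleftrightarrow> x = 0" if "x \<in> vecs C" for x
    using that c(2) linear_on_inj_iff[OF rmodule_homD(3)[OF c(1)] fd_rmoduleD(2)[OF fd(3)]]
      linear_on_0[OF rmodule_homD(3)[OF c(1)] fd_rmoduleD(2)[OF fd(3)]]
    by (auto simp: bij_betw_def)
  have "rmodule_hom G A' B' (\<lambda>x. b (f (a' x)))"
    by (intro rmodule_hom_compose[OF rmodule_hom_compose[OF a'(1) f] b(1)])
  moreover have "rmodule_hom G B' C' (\<lambda>x. c (p (b' x)))"
    by (intro rmodule_hom_compose[OF rmodule_hom_compose[OF b'(1) p] c(1)])
  moreover have "inj_on (\<lambda>x. b (f (a' x))) (vecs A')"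
  proof (rule inj_onI)
    fix x y assume xy: "x \<in> vecs A'" "y \<in> vecs A'" "b (f (a' x)) = b (f (a' y))"
    have "a' x \<in> vecs A" "a' y \<in> vecs A" using xy im by auto
    moreover have "f (a' x) = f (a' y)"
      using inj_onD[OF bij_betw_imp_inj_on[OF b(2)], of "f (a' x)" "f (a' y)"] xy(3)
        rmodule_homD(1)[OF f] calculation by blast
    ultimately have "a' x = a' y" using inj_onD[OF inj] by blast
    then show "x = y" using inj_onD[OF bij_betw_imp_inj_on[OF a'(2)]] xy by blast
  qed
  moreover have "(\<lambda>x. c (p (b' x))) ` vecs B' = vecs C'"
    using im surj by (metis (no_types, lifting) image_image image_cong)
  moreover have "(\<lambda>x. b (f (a' x))) ` vecs A' = {y \<in> vecs B'. c (p (b' y)) = 0}"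
  proof -
    have "(\<lambda>x. b (f (a' x))) ` vecs A' = b ` f ` a' ` vecs A'"
      by (simp add: image_image)
    also have "\<dots> = b ` {y \<in> vecs B. p y = 0}"
      using im ker by simp
    also have "\<dots> = {y \<in> b ` vecs B. c (p (b' y)) = 0}"
    proof -
      have "c (p (b' (b x))) = 0 \<longleftrightarrow> p x = 0" if "x \<in> vecs B" for x
        using c0[of "p x"] rmodule_homD(1)[OF p that] b'b[OF that] by metis
      then show ?thesis by blast
    qed
    finally show ?thesis using im by simp
  qed
  ultimately show ?thesis
    unfolding short_exact_def by (intro exI conjI)
qed

section \<open>Tensor products of modules\<close>

lemma vecs_tensor: "vecs (tensor_rmodule M N) = tensor_span (vecs M) (vecs N)"
  by (simp add: tensor_rmodule_def tensor_span_def)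

lemma act_tensor: "act (tensor_rmodule M N) z g = colmap (\<lambda>x. act M x g) (rowmap (\<lambda>y. act N y g) z)"
  by (simp add: tensor_rmodule_def colmap_def rowmap_def transpose_tensor_def)

lemma tensor_span_eqI:
  assumes "linear_on (tensor_span U W) f" "linear_on (tensor_span U W) f'"
    and "\<And>x y. x \<in> U \<Longrightarrow> y \<in> W \<Longrightarrow> f (pure_tensor x y) = f' (pure_tensor x y)"
    and "z \<in> tensor_span U W"
  shows "f z = f' z"
  by (rule linear_on_span_eq[of "{pure_tensor x y | x y. x \<in> U \<and> y \<in> W}"])
     (use assms in \<open>auto simp: tensor_span_def\<close>)

lemma tensor_action:
  assumes "fd_rmodule G M" "fd_rmodule G N" "g \<in> carrier G"
  shows "linear_on (tensor_span (vecs M) (vecs N)) (\<lambda>z. act (tensor_rmodule M N) z g)"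
    and "z \<in> tensor_span (vecs M) (vecs N) \<Longrightarrow>
      act (tensor_rmodule M N) z g \<in> tensor_span (vecs M) (vecs N)"
proof -
  note M = fd_rmoduleD[OF assms(1)] and N = fd_rmoduleD[OF assms(2)]
  have row: "rowmap (\<lambda>y. act N y g) z \<in> tensor_span (vecs M) (vecs N)"
    if "z \<in> tensor_span (vecs M) (vecs N)" for z
    by (rule rowmap_closed[OF N(2) N(3)[OF assms(3)] _ that]) (use N(4)[OF assms(3)] in auto)
  show "linear_on (tensor_span (vecs M) (vecs N)) (\<lambda>z. act (tensor_rmodule M N) z g)"
    unfolding act_tensor using row
    by (intro linear_on_compose[OF linear_on_rowmap[OF N(2) N(3)[OF assms(3)]]
          linear_on_colmap[OF M(2) M(3)[OF assms(3)]]]) auto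
  show "act (tensor_rmodule M N) z g \<in> tensor_span (vecs M) (vecs N)"
    if "z \<in> tensor_span (vecs M) (vecs N)"
    unfolding act_tensor
    by (rule colmap_closed[OF M(2) M(3)[OF assms(3)] _ row[OF that]]) (use M(4)[OF assms(3)] in auto)
qed

lemma fd_tensor:
  fixes G (structure)
  assumes "group G" "fd_rmodule G M" "fd_rmodule G N"
  shows "fd_rmodule G (tensor_rmodule M N)"
proof -
  note M = fd_rmoduleD[OF assms(2)] and N = fd_rmoduleD[OF assms(3)]
  note act = tensor_action[OF assms(2,3)]
  interpret group G by fact
  obtain B C where BC: "finite B" "vecs M = qvs.span B" "finite C" "vecs N = qvs.span C"
    using M(1) N(1) by blast
  show ?thesis
  proof (rule fd_rmoduleI[of "(\<lambda>(x, y). pure_tensor x y) ` (B \<times> C)"])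
    show "vecs (tensor_rmodule M N) = qvs.span ((\<lambda>(x, y). pure_tensor x y) ` (B \<times> C))"
      unfolding vecs_tensor BC(2,4) by (rule tensor_span_span)
  next
    fix x assume "x \<in> vecs (tensor_rmodule M N)"
    then have x: "x \<in> tensor_span (vecs M) (vecs N)" unfolding vecs_tensor .
    show "act (tensor_rmodule M N) x \<one> = x"
    proof (rule tensor_span_eqI[OF act(1)[OF one_closed] _ _ x])
      show "linear_on (tensor_span (vecs M) (vecs N)) (\<lambda>x. x)"
        by (simp add: linear_on_def)
      fix u w assume "u \<in> vecs M" "w \<in> vecs N"
      then show "act (tensor_rmodule M N) (pure_tensor u w) \<one> = pure_tensor u w"
        by (simp add: act_pure_tensor[OF assms(2,3)] M(5) N(5))
    qed
  next
    fix x g h assume "x \<in> vecs (tensor_rmodule M N)" and gh: "g \<in> carrier G" "h \<in> carrier G"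
    then have x: "x \<in> tensor_span (vecs M) (vecs N)" unfolding vecs_tensor by simp
    show "act (tensor_rmodule M N) (act (tensor_rmodule M N) x g) h =
          act (tensor_rmodule M N) x (g \<otimes> h)"
    proof (rule tensor_span_eqI[OF linear_on_compose[OF act(1)[OF gh(1)] act(1)[OF gh(2)]]
            act(1)[OF m_closed[OF gh]] _ x])
      show "(\<lambda>z. act (tensor_rmodule M N) z g) ` tensor_span (vecs M) (vecs N)
            \<subseteq> tensor_span (vecs M) (vecs N)"
        using act(2)[OF gh(1)] by auto
      fix u w assume uw: "u \<in> vecs M" "w \<in> vecs N"
      show "act (tensor_rmodule M N) (act (tensor_rmodule M N) (pure_tensor u w) g) h =
          act (tensor_rmodule M N) (pure_tensor u w) (g \<otimes> h)"
        unfolding act_pure_tensor[OF assms(2,3) uw gh(1)]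
          act_pure_tensor[OF assms(2,3) M(4)[OF gh(1) uw(1)] N(4)[OF gh(1) uw(2)] gh(2)]
          act_pure_tensor[OF assms(2,3) uw m_closed[OF gh]] M(6)[OF uw(1) gh] N(6)[OF uw(2) gh] ..
    qed
  qed (use BC act in \<open>auto simp: vecs_tensor\<close>)
qed

lemma colmap_hom:
  assumes fd: "fd_rmodule G M" "fd_rmodule G M'" "fd_rmodule G N" and f: "rmodule_hom G M M' f"
  shows "rmodule_hom G (tensor_rmodule M N) (tensor_rmodule M' N) (colmap f)"
proof (rule rmodule_homI)
  note M = fd_rmoduleD[OF fd(1)] and f' = rmodule_homD[OF f]
  have lin: "linear_on (tensor_span (vecs M) (vecs N)) (colmap f)"
    by (rule linear_on_colmap[OF M(2) f'(3)])
  have closed: "colmap f x \<in> tensor_span (vecs M') (vecs N)"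
    if "x \<in> tensor_span (vecs M) (vecs N)" for x
    by (rule colmap_closed[OF M(2) f'(3,2) that])
  then show "colmap f x \<in> vecs (tensor_rmodule M' N)" if "x \<in> vecs (tensor_rmodule M N)" for x
    using that unfolding vecs_tensor by blast
  show "linear_on (vecs (tensor_rmodule M N)) (colmap f)"
    unfolding vecs_tensor by (rule lin)
  fix z g assume "z \<in> vecs (tensor_rmodule M N)" and g: "g \<in> carrier G"
  then have z: "z \<in> tensor_span (vecs M) (vecs N)" unfolding vecs_tensor by simp
  note act = tensor_action[OF fd(1,3) g] and act' = tensor_action[OF fd(2,3) g]
  show "colmap f (act (tensor_rmodule M N) z g) = act (tensor_rmodule M' N) (colmap f z) g"
  proof (rule tensor_span_eqI[OF linear_on_compose[OF act(1) lin] linear_on_compose[OF lin act'(1)]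
          _ z])
    show "(\<lambda>z. act (tensor_rmodule M N) z g) ` tensor_span (vecs M) (vecs N)
          \<subseteq> tensor_span (vecs M) (vecs N)"
      using act(2) by auto
    show "colmap f ` tensor_span (vecs M) (vecs N) \<subseteq> tensor_span (vecs M') (vecs N)"
      using closed by auto
    fix x y assume xy: "x \<in> vecs M" "y \<in> vecs N"
    show "colmap f (act (tensor_rmodule M N) (pure_tensor x y) g) =
          act (tensor_rmodule M' N) (colmap f (pure_tensor x y)) g"
      unfolding act_pure_tensor[OF fd(1,3) xy g] colmap_pure_tensor[OF f'(3) xy(1)]
        colmap_pure_tensor[OF f'(3) M(4)[OF g xy(1)]] f'(4)[OF xy(1) g]
        act_pure_tensor[OF fd(2,3) f'(1)[OF xy(1)] xy(2) g] ..
  qed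
qed

lemma tensor_iso_left:
  assumes fd: "fd_rmodule G M" "fd_rmodule G M'" "fd_rmodule G N" and "rmodule_iso G M M'"
  shows "rmodule_iso G (tensor_rmodule M N) (tensor_rmodule M' N)"
proof -
  obtain f where f: "rmodule_hom G M M' f" "bij_betw f (vecs M) (vecs M')"
    using assms(4) by (auto simp: rmodule_iso_def)
  note M = fd_rmoduleD[OF fd(1)]
  have "inj_on (colmap f) (tensor_span (vecs M) (vecs N))"
    by (rule colmap_inj[OF M(2) bij_betw_imp_inj_on[OF f(2)]])
  moreover have "colmap f ` tensor_span (vecs M) (vecs N) = tensor_span (vecs M') (vecs N)"
    using colmap_image[OF M(2) rmodule_homD(3)[OF f(1)]] f(2) by (simp add: bij_betw_def)
  ultimately show ?thesis
    unfolding rmodule_iso_def bij_betw_def vecs_tensor using colmap_hom[OF fd f(1)] by blast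
qed

text \<open>The swap of the factors carries statements about the left factor over to the right one,
  for modules and later for classes.\<close>

lemma tensor_commute:
  assumes fd: "fd_rmodule G M" "fd_rmodule G N"
  shows "rmodule_iso G (tensor_rmodule M N) (tensor_rmodule N M)"
proof -
  have "rmodule_hom G (tensor_rmodule M N) (tensor_rmodule N M) transpose_tensor"
  proof (rule rmodule_homI)
    show "transpose_tensor x \<in> vecs (tensor_rmodule N M)" if "x \<in> vecs (tensor_rmodule M N)" for x
      using that transpose_image unfolding vecs_tensor by blast
    show "linear_on (vecs (tensor_rmodule M N)) transpose_tensor"
      by (rule linear_on_transpose)
    fix z g assume "z \<in> vecs (tensor_rmodule M N)" and g: "g \<in> carrier G"
    then have z: "z \<in> tensor_span (vecs M) (vecs N)" unfolding vecs_tensor by simp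
    note act = tensor_action[OF fd g] and act' = tensor_action[OF fd(2,1) g]
    show "transpose_tensor (act (tensor_rmodule M N) z g) =
          act (tensor_rmodule N M) (transpose_tensor z) g"
    proof (rule tensor_span_eqI[OF linear_on_compose[OF act(1) linear_on_transpose]
            linear_on_compose[OF linear_on_transpose act'(1)] _ z])
      show "(\<lambda>z. act (tensor_rmodule M N) z g) ` tensor_span (vecs M) (vecs N) \<subseteq> UNIV" by simp
      show "transpose_tensor ` tensor_span (vecs M) (vecs N) \<subseteq> tensor_span (vecs N) (vecs M)"
        by (simp add: transpose_image)
      fix x y assume "x \<in> vecs M" "y \<in> vecs N"
      then show "transpose_tensor (act (tensor_rmodule M N) (pure_tensor x y) g) =
          act (tensor_rmodule N M) (transpose_tensor (pure_tensor x y)) g"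
        by (simp add: act_pure_tensor[OF fd _ _ g] act_pure_tensor[OF fd(2,1) _ _ g])
    qed
  qed
  moreover have "inj_on transpose_tensor (vecs (tensor_rmodule M N))"
    by (rule inj_on_inverseI[of _ transpose_tensor]) simp
  ultimately show ?thesis
    unfolding rmodule_iso_def bij_betw_def by (metis transpose_image vecs_tensor)
qed

lemma tensor_iso_right:
  assumes G: "group G"
    and fd: "fd_rmodule G M" "fd_rmodule G N" "fd_rmodule G N'" and iso: "rmodule_iso G N N'"
  shows "rmodule_iso G (tensor_rmodule M N) (tensor_rmodule M N')"
  by (rule rmodule_iso_trans[OF tensor_commute[OF fd(1,2)]
        rmodule_iso_trans[OF tensor_iso_left[OF fd(2,3,1) iso] tensor_commute[OF fd(3,1)]]])

text \<open>\<open>T\<close> is a line spanned by an invariant vector \<open>t\<close>, and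
  \<open>y\<close> is sent to \<open>t \<otimes> y\<close>. It is stated for any \<open>T\<close>
  isomorphic to the trivial module because the unit of the ring is the class of such a copy.\<close>

lemma tensor_trivial:
  fixes T :: "('g, 'i) rmodule"
  assumes fd: "fd_rmodule G T" "fd_rmodule G N" and T: "rmodule_iso G trivial_rmodule T"
  shows "rmodule_iso G N (tensor_rmodule T N)"
proof -
  obtain f :: "(unit \<Rightarrow> rat) \<Rightarrow> 'i \<Rightarrow> rat"
    where f: "rmodule_hom G trivial_rmodule T f" "bij_betw f UNIV (vecs T)"
    using T by (auto simp: rmodule_iso_def trivial_rmodule_def)
  have lin: "linear_on UNIV f"
    using rmodule_homD(3)[OF f(1)] by (simp add: trivial_rmodule_def)
  define t where "t = f (\<lambda>_. 1)"
  have t: "t \<in> vecs T" using f(2) by (auto simp: t_def bij_betw_def)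
  have T_eq: "\<exists>c. x = qscale c t" if x: "x \<in> vecs T" for x
  proof -
    obtain u where u: "x = f u" using x f(2) by (auto simp: bij_betw_def)
    have "u = qscale (u ()) (\<lambda>_. 1)" by (simp add: qscale_def fun_eq_iff)
    then have "f u = qscale (u ()) t"
      using linear_onD(2)[OF lin] unfolding t_def by (metis UNIV_I)
    with u show ?thesis by blast
  qed
  have t_act: "act T t g = t" if "g \<in> carrier G" for g
    using rmodule_homD(4)[OF f(1) _ that, of "\<lambda>_. 1"] by (simp add: t_def trivial_rmodule_def)
  have "t \<noteq> 0"
  proof
    assume "t = 0"
    moreover have "f 0 = 0" by (rule linear_on_0[OF lin]) (simp add: qvs.subspace_UNIV)
    ultimately have "(\<lambda>_. 1) = (0 :: unit \<Rightarrow> rat)"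
      using f(2) by (auto simp: t_def bij_betw_def inj_on_def)
    then show False using fun_cong[of "\<lambda>_. 1" "0 :: unit \<Rightarrow> rat" "()"] by simp
  qed
  \<comment> \<open>An index at which \<open>t\<close> does not vanish: row \<open>i\<close> of
    \<open>t \<otimes> x\<close> is a nonzero multiple of \<open>x\<close>, which gives
    injectivity.\<close>
  then obtain i where i: "t i \<noteq> 0" by (auto simp: fun_eq_iff)
  have lin': "linear_on (vecs N) (pure_tensor t)"
    unfolding linear_on_def by (simp only: pure_tensor_linear) simp
  have "rmodule_hom G N (tensor_rmodule T N) (pure_tensor t)"
  proof (rule rmodule_homI[OF _ lin'])
    show "pure_tensor t x \<in> vecs (tensor_rmodule T N)" if "x \<in> vecs N" for x
      unfolding vecs_tensor by (rule pure_tensor_in_tensor_span[OF t that])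
    show "pure_tensor t (act N x g) = act (tensor_rmodule T N) (pure_tensor t x) g"
      if "x \<in> vecs N" "g \<in> carrier G" for x g
      using act_pure_tensor[OF fd t that] t_act[OF that(2)] by simp
  qed
  moreover have "inj_on (pure_tensor t) (vecs N)"
  proof (rule inj_onI, rule ext)
    fix x y j assume "pure_tensor t x = pure_tensor t y"
    from fun_cong[OF this, of "(i, j)"] show "x j = y j"
      using i by (simp add: pure_tensor_def)
  qed
  moreover have "pure_tensor t ` vecs N = vecs (tensor_rmodule T N)"
  proof
    show "pure_tensor t ` vecs N \<subseteq> vecs (tensor_rmodule T N)"
      unfolding vecs_tensor using t by auto
    have "pure_tensor x y \<in> pure_tensor t ` vecs N" if xy: "x \<in> vecs T" "y \<in> vecs N" for x y
    proof -
      obtain c where c: "x = qscale c t" using T_eq[OF xy(1)] by blast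
      have "pure_tensor x y = pure_tensor t (qscale c y)"
        unfolding c pure_tensor_linear ..
      moreover have "qscale c y \<in> vecs N"
        using xy(2) by (rule qvs.subspace_scale[OF fd_rmoduleD(2)[OF fd(2)]])
      ultimately show ?thesis by blast
    qed
    then show "vecs (tensor_rmodule T N) \<subseteq> pure_tensor t ` vecs N"
      unfolding vecs_tensor tensor_span_def
      by (intro qvs.span_minimal subspace_linear_image[OF lin' fd_rmoduleD(2)[OF fd(2)]]) auto
  qed
  ultimately show ?thesis
    unfolding rmodule_iso_def bij_betw_def by blast
qed

text \<open>Injectivity and surjectivity hold for \<open>colmap\<close> directly; that the kernel is
  no larger than the image is \<open>colmap_exact\<close>.\<close>

lemma short_exact_tensor:
  assumes fd: "fd_rmodule G A" "fd_rmodule G B" "fd_rmodule G C" "fd_rmodule G N"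
    and "short_exact G A B C"
  shows "short_exact G (tensor_rmodule A N) (tensor_rmodule B N) (tensor_rmodule C N)"
proof -
  obtain f p where f: "rmodule_hom G A B f" and p: "rmodule_hom G B C p"
    and inj: "inj_on f (vecs A)" and surj: "p ` vecs B = vecs C"
    and ker: "f ` vecs A = {y \<in> vecs B. p y = 0}"
    using assms(5) unfolding short_exact_def by blast
  note A = fd_rmoduleD[OF fd(1)] and B = fd_rmoduleD[OF fd(2)]
  note f' = rmodule_homD[OF f] and p' = rmodule_homD[OF p]
  obtain D where D: "finite D" "vecs N = qvs.span D" using fd_rmoduleD(1)[OF fd(4)] by blast
  let ?V = "\<lambda>M. tensor_span (vecs M) (vecs N)"
  have "inj_on (colmap f) (?V A)"
    by (rule colmap_inj[OF A(2) inj])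
  moreover have "colmap p ` ?V B = ?V C"
    using colmap_image[OF B(2) p'(3)] surj by simp
  moreover have "colmap f ` ?V A = {z \<in> ?V B. colmap p z = 0}"
  proof (intro equalityI subsetI CollectI conjI)
    fix z assume "z \<in> {z \<in> ?V B. colmap p z = 0}"
    then have z: "z \<in> tensor_span (vecs B) (qvs.span D)" "colmap p z = 0"
      using D(2) by auto
    have "z \<in> colmap f ` tensor_span (vecs A) (qvs.span D)"
      by (rule colmap_exact[OF B(2) D(1) p'(3) f'(3) A(2) _ z]) (use ker in blast)
    then show "z \<in> colmap f ` ?V A" using D(2) by simp
  next
    fix z assume "z \<in> colmap f ` ?V A"
    then obtain y where y: "y \<in> ?V A" "z = colmap f y" by blast
    show "z \<in> ?V B"
      unfolding y(2) by (rule colmap_closed[OF A(2) f'(3,2) y(1)])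
    have lin0: "linear_on (vecs A) (\<lambda>x. p (f x))"
      by (rule linear_on_compose[OF f'(3) p'(3) f'(2)])
    have "colmap p z = colmap (\<lambda>x. p (f x)) y"
      unfolding y(2) by (simp add: colmap_def)
    also have "\<dots> = 0"
    proof (rule tensor_span_eqI[OF linear_on_colmap[OF A(2) lin0] _ _ y(1)])
      show "linear_on (?V A) (\<lambda>z. 0)" unfolding linear_on_def by (simp only: qscale_simps) simp
      fix x w assume x: "x \<in> vecs A"
      then have "p (f x) = 0" using ker by blast
      then show "colmap (\<lambda>x. p (f x)) (pure_tensor x w) = 0"
        unfolding colmap_pure_tensor[OF lin0 x] by (simp only: pure_tensor_linear)
    qed
    finally show "colmap p z = 0" .
  qed
  ultimately show ?thesis
    unfolding short_exact_def vecs_tensor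
    using colmap_hom[OF fd(1,2,4) f] colmap_hom[OF fd(2,3,4) p] by blast
qed

section \<open>The representation ring\<close>

lemma add_monoid_rep_prering:
  "add_monoid (rep_prering G) = free_Abelian_group {M. fd_rmodule G M}"
  by (simp add: rep_prering_def free_Abelian_group_def)

lemma rep_prering_simps [simp]:
  "carrier (rep_prering G) = {c. Poly_Mapping.keys c \<subseteq> {M. fd_rmodule G M}}"
  "x \<oplus>\<^bsub>rep_prering G\<^esub> y = x + y"
  "\<zero>\<^bsub>rep_prering G\<^esub> = 0"
  by (simp_all add: rep_prering_def)

lemma abelian_group_rep_prering: "abelian_group (rep_prering G)"
proof -
  have "comm_group (add_monoid (rep_prering G))"
    unfolding add_monoid_rep_prering by (rule abelian_free_Abelian_group)
  then show ?thesis
    by (simp add: abelian_group_def abelian_monoid_def abelian_group_axioms_def comm_group_def)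
qed

lemma subgroup_exact_relations:
  "subgroup (exact_relations G) (add_monoid (rep_prering G))"
  unfolding exact_relations_def
proof (rule group.generate_is_subgroup)
  show "group (add_monoid (rep_prering G))"
    unfolding add_monoid_rep_prering by (rule group_free_Abelian_group)
  show "{frag_of B - frag_of A - frag_of C |A B C. fd_rmodule G A \<and> fd_rmodule G B \<and> fd_rmodule G C \<and>
      short_exact G A B C} \<subseteq> carrier (add_monoid (rep_prering G))"
    by (auto dest!: subsetD[OF keys_diff])
qed

lemma exact_relations:
  "0 \<in> exact_relations G"
  "x \<in> exact_relations G \<Longrightarrow> y \<in> exact_relations G \<Longrightarrow> x + y \<in> exact_relations G"
  "x \<in> exact_relations G \<Longrightarrow> - x \<in> exact_relations G"
  "x \<in> exact_relations G \<Longrightarrow> y \<in> exact_relations G \<Longrightarrow> x - y \<in> exact_relations G"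
  "x \<in> exact_relations G \<Longrightarrow> Poly_Mapping.keys x \<subseteq> {M. fd_rmodule G M}"
proof -
  note I = subgroup_exact_relations[of G, unfolded add_monoid_rep_prering]
  show "0 \<in> exact_relations G"
    using subgroup.one_closed[OF I] by simp
  show add: "x + y \<in> exact_relations G" if "x \<in> exact_relations G" "y \<in> exact_relations G" for x y
    using subgroup.m_closed[OF I that] by simp
  show keys: "Poly_Mapping.keys x \<subseteq> {M. fd_rmodule G M}" if "x \<in> exact_relations G" for x
    using subgroup.mem_carrier[OF I that] by simp
  show minus: "- x \<in> exact_relations G" if "x \<in> exact_relations G" for x
    using subgroup.m_inv_closed[OF I that] keys[OF that] by simp
  show "x - y \<in> exact_relations G" if "x \<in> exact_relations G" "y \<in> exact_relations G" for x y
    using add[OF that(1) minus[OF that(2)]] by simp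
qed

lemma exact_relationsI:
  assumes "fd_rmodule G A" "fd_rmodule G B" "fd_rmodule G C" "short_exact G A B C"
  shows "frag_of B - frag_of A - frag_of C \<in> exact_relations G"
  unfolding exact_relations_def using assms by (intro generate.incl) blast

text \<open>An isomorphism is a short exact sequence that starts with the zero module
  \<open>Z\<close>. Its relation contains the generator \<open>Z\<close> once, and the sequence of
  three zero modules supplies the relation that cancels it.\<close>

lemma rmodule_iso_relation:
  fixes M N :: "('g, nat) rmodule"
  assumes fd: "fd_rmodule G M" "fd_rmodule G N" and "rmodule_iso G M N"
  shows "frag_of M - frag_of N \<in> exact_relations G"
proof -
  obtain f where f: "rmodule_hom G M N f" "bij_betw f (vecs M) (vecs N)"
    using assms(3) by (auto simp: rmodule_iso_def)
  define Z :: "('g, nat) rmodule" where "Z = \<lparr>vecs = {0}, act = (\<lambda>x g. x)\<rparr>"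
  have Z: "fd_rmodule G Z"
    by (rule fd_rmoduleI[of "{}"]) (auto simp: Z_def linear_on_def)
  have hom0: "rmodule_hom G Z L (\<lambda>x. x)" if "fd_rmodule G L" for L :: "('g, nat) rmodule"
  proof (rule rmodule_homI)
    show "linear_on (vecs Z) (\<lambda>x. x)" by (simp add: linear_on_def)
    show "x \<in> vecs L" if "x \<in> vecs Z" for x
      using that qvs.subspace_0[OF fd_rmoduleD(2)[OF \<open>fd_rmodule G L\<close>]] by (simp add: Z_def)
    show "act Z x g = act L x g" if "x \<in> vecs Z" "g \<in> carrier G" for x g
      using linear_on_0[OF fd_rmoduleD(3)[OF \<open>fd_rmodule G L\<close> that(2)]
          fd_rmoduleD(2)[OF \<open>fd_rmodule G L\<close>]] that(1) by (simp add: Z_def)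
  qed
  have "short_exact G Z M N"
    unfolding short_exact_def
  proof (intro exI conjI)
    show "f ` vecs M = vecs N" using f(2) by (simp add: bij_betw_def)
    have "{y \<in> vecs M. f y = 0} = {0}"
      using f(2) linear_on_inj_iff[OF rmodule_homD(3)[OF f(1)] fd_rmoduleD(2)[OF fd(1)]]
        linear_on_0[OF rmodule_homD(3)[OF f(1)] fd_rmoduleD(2)[OF fd(1)]]
        qvs.subspace_0[OF fd_rmoduleD(2)[OF fd(1)]]
      by (auto simp: bij_betw_def)
    then show "(\<lambda>x. x) ` vecs Z = {y \<in> vecs M. f y = 0}" by (simp add: Z_def)
  qed (use f hom0[OF fd(1)] in auto)
  then have 1: "frag_of M - frag_of Z - frag_of N \<in> exact_relations G"
    by (rule exact_relationsI[OF Z fd])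
  have "short_exact G Z Z Z"
    unfolding short_exact_def
    by (rule exI[of _ "\<lambda>x. x"], rule exI[of _ "\<lambda>x. x"]) (use hom0[OF Z] in \<open>auto simp: Z_def\<close>)
  then have "frag_of Z - frag_of Z - frag_of Z \<in> exact_relations G"
    by (rule exact_relationsI[OF Z Z Z])
  from exact_relations(4)[OF 1 this] show ?thesis by simp
qed

lemma rep_coset_eqI:
  assumes "x - y \<in> exact_relations G"
  shows "exact_relations G +>\<^bsub>rep_prering G\<^esub> x = exact_relations G +>\<^bsub>rep_prering G\<^esub> y"
proof -
  have *: "exact_relations G +>\<^bsub>rep_prering G\<^esub> x \<subseteq> exact_relations G +>\<^bsub>rep_prering G\<^esub> y"
    if "x - y \<in> exact_relations G" for x y
  proof
    fix z assume "z \<in> exact_relations G +>\<^bsub>rep_prering G\<^esub> x"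
    then obtain h where h: "h \<in> exact_relations G" "z = h + x"
      by (auto simp: a_r_coset_def')
    then have "z = (h + (x - y)) + y" "h + (x - y) \<in> exact_relations G"
      using that by (auto intro: exact_relations)
    then show "z \<in> exact_relations G +>\<^bsub>rep_prering G\<^esub> y"
      by (simp only: a_r_coset_def' rep_prering_simps) blast
  qed
  have "y - x \<in> exact_relations G"
    using exact_relations(3)[OF assms] by simp
  with *[OF assms] * show ?thesis by blast
qed

lemma abelian_subgroup_exact_relations: "abelian_subgroup (exact_relations G) (rep_prering G)"
  by (rule abelian_subgroupI3[OF additive_subgroup.intro[OF subgroup_exact_relations]
        abelian_group_rep_prering])

lemma abelian_group_rep_ring: "abelian_group (rep_ring G)"
proof -
  interpret abelian_subgroup "exact_relations G" "rep_prering G"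
    by (rule abelian_subgroup_exact_relations)
  have "comm_group (add_monoid (rep_ring G))"
    by (simp add: rep_ring_def FactRing_def a_factorgroup_is_comm_group[unfolded A_FactGroup_def'])
  then show ?thesis
    by (simp add: abelian_group_def abelian_monoid_def abelian_group_axioms_def comm_group_def)
qed

lemma rep_ring_simps:
  "carrier (rep_ring G) = (\<lambda>x. exact_relations G +>\<^bsub>rep_prering G\<^esub> x) ` carrier (rep_prering G)"
  "\<zero>\<^bsub>rep_ring G\<^esub> = exact_relations G +>\<^bsub>rep_prering G\<^esub> 0"
  "\<one>\<^bsub>rep_ring G\<^esub> = exact_relations G +>\<^bsub>rep_prering G\<^esub> frag_of (nat_copy G trivial_rmodule)"
  "A \<otimes>\<^bsub>rep_ring G\<^esub> B = rcoset_mult (rep_prering G) (exact_relations G) A B"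
proof -
  have "\<one>\<^bsub>rep_prering G\<^esub> = frag_of (nat_copy G trivial_rmodule)"
    by (simp add: rep_prering_def)
  then show "\<one>\<^bsub>rep_ring G\<^esub> = exact_relations G +>\<^bsub>rep_prering G\<^esub> frag_of (nat_copy G trivial_rmodule)"
    by (simp add: rep_ring_def FactRing_def)
qed (auto simp: rep_ring_def FactRing_def A_RCOSETS_def' a_r_coset_def')

lemma rep_coset_add:
  assumes "x \<in> carrier (rep_prering G)" "y \<in> carrier (rep_prering G)"
  shows "(exact_relations G +>\<^bsub>rep_prering G\<^esub> x) \<oplus>\<^bsub>rep_ring G\<^esub> (exact_relations G +>\<^bsub>rep_prering G\<^esub> y) =
    exact_relations G +>\<^bsub>rep_prering G\<^esub> (x + y)"
  using abelian_subgroup.a_rcos_sum[OF abelian_subgroup_exact_relations assms]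
  by (simp add: rep_ring_def FactRing_def)

lemma rep_class_closed:
  assumes "fd_rmodule G M"
  shows "rep_class G M \<in> carrier (rep_ring G)"
  using nat_copy(1)[OF assms] by (auto simp: rep_class_def rep_ring_simps)

text \<open>All additive equations between classes come from here.\<close>

lemma rep_class_exact:
  assumes fd: "fd_rmodule G A" "fd_rmodule G B" "fd_rmodule G C" and "short_exact G A B C"
  shows "rep_class G B = rep_class G A \<oplus>\<^bsub>rep_ring G\<^esub> rep_class G C"
proof -
  note nc = nat_copy[OF fd(1)] nat_copy[OF fd(2)] nat_copy[OF fd(3)]
  have "short_exact G (nat_copy G A) (nat_copy G B) (nat_copy G C)"
    by (rule short_exact_iso[OF fd nc(2,4,6) assms(4)])
  from exact_relationsI[OF nc(1,3,5) this]
  have "frag_of (nat_copy G B) - (frag_of (nat_copy G A) + frag_of (nat_copy G C))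
      \<in> exact_relations G"
    by (simp add: diff_diff_eq)
  from rep_coset_eqI[OF this] show ?thesis
    unfolding rep_class_def using nc by (subst rep_coset_add) auto
qed

lemma rep_class_iso:
  assumes fd: "fd_rmodule G M" "fd_rmodule G N" and "rmodule_iso G M N"
  shows "rep_class G M = rep_class G N"
proof -
  note M = nat_copy[OF fd(1)] and N = nat_copy[OF fd(2)]
  have "rmodule_iso G (nat_copy G M) (nat_copy G N)"
    by (rule rmodule_iso_trans[OF rmodule_iso_sym[OF fd(1) M(2)] rmodule_iso_trans[OF assms(3) N(2)]])
  from rep_coset_eqI[OF rmodule_iso_relation[OF M(1) N(1) this]] show ?thesis
    unfolding rep_class_def .
qed

section \<open>The product of classes\<close>

lemma rep_prering_mult_linear:
  "(a - a') \<otimes>\<^bsub>rep_prering G\<^esub> b = a \<otimes>\<^bsub>rep_prering G\<^esub> b - a' \<otimes>\<^bsub>rep_prering G\<^esub> b"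
  "a \<otimes>\<^bsub>rep_prering G\<^esub> (b - b') = a \<otimes>\<^bsub>rep_prering G\<^esub> b - a \<otimes>\<^bsub>rep_prering G\<^esub> b'"
  "0 \<otimes>\<^bsub>rep_prering G\<^esub> b = 0" "a \<otimes>\<^bsub>rep_prering G\<^esub> 0 = 0"
  "frag_of M \<otimes>\<^bsub>rep_prering G\<^esub> frag_of N = frag_of (nat_copy G (tensor_rmodule M N))"
proof -
  let ?f = "\<lambda>b M. frag_extend (\<lambda>N. frag_of (nat_copy G (tensor_rmodule M N))) b"
  have "frag_extend (?f (b - b')) a = frag_extend (?f b) a - frag_extend (?f b') a"
    using subset_UNIV[of "Poly_Mapping.keys a"]
    by (induction a rule: frag_induction) (simp_all add: frag_extend_diff)
  then show "a \<otimes>\<^bsub>rep_prering G\<^esub> (b - b') = a \<otimes>\<^bsub>rep_prering G\<^esub> b - a \<otimes>\<^bsub>rep_prering G\<^esub> b'"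
    by (simp add: rep_prering_def)
qed (simp_all add: rep_prering_def frag_extend_diff frag_extend_eq_0)

text \<open>Tensoring with a fixed module is exact, so a generating relation times a generator is
  again a generating relation up to copies; bilinearity does the rest.\<close>

lemma exact_relations_mult_right:
  assumes G: "group G" and "a \<in> exact_relations G" and b: "Poly_Mapping.keys b \<subseteq> {M. fd_rmodule G M}"
  shows "a \<otimes>\<^bsub>rep_prering G\<^esub> b \<in> exact_relations G"
proof -
  let ?R = "{frag_of B - frag_of A - frag_of C | A B C.
    fd_rmodule G A \<and> fd_rmodule G B \<and> fd_rmodule G C \<and> short_exact G A B C}"
  have gen: "r \<otimes>\<^bsub>rep_prering G\<^esub> b \<in> exact_relations G" if "r \<in> ?R" for r
  proof -
    obtain A B C where r: "r = frag_of B - frag_of A - frag_of C"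
      and fd: "fd_rmodule G A" "fd_rmodule G B" "fd_rmodule G C" and se: "short_exact G A B C"
      using \<open>r \<in> ?R\<close> by blast
    from b show ?thesis
    proof (induction b rule: frag_induction)
      case zero
      show ?case by (simp add: rep_prering_mult_linear exact_relations)
    next
      case (one N)
      then have N: "fd_rmodule G N" by simp
      note t = fd_tensor[OF G fd(1) N] fd_tensor[OF G fd(2) N] fd_tensor[OF G fd(3) N]
      note nc = nat_copy[OF t(1)] nat_copy[OF t(2)] nat_copy[OF t(3)]
      show ?case
        unfolding r rep_prering_mult_linear
        by (rule exact_relationsI[OF nc(1,3,5)
              short_exact_iso[OF t nc(2,4,6) short_exact_tensor[OF fd N se]]])
    next
      case (diff b b')
      then show ?case by (simp add: rep_prering_mult_linear exact_relations)
    qed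
  qed
  have "a \<in> generate (add_monoid (rep_prering G)) ?R"
    using assms(2) by (simp add: exact_relations_def)
  then show ?thesis
  proof (induction a rule: generate.induct)
    case one
    show ?case by (simp add: rep_prering_mult_linear exact_relations)
  next
    case (incl h)
    then show ?case by (rule gen)
  next
    case (inv h)
    then have "Poly_Mapping.keys h \<subseteq> {M. fd_rmodule G M}"
      by (auto dest!: subsetD[OF keys_diff])
    \<comment> \<open>The inverse is written as a difference because linearity of the product is
      stated for differences.\<close>
    then have "inv\<^bsub>add_monoid (rep_prering G)\<^esub> h = 0 - h"
      unfolding add_monoid_rep_prering by (subst inv_free_Abelian_group) auto
    with gen[OF inv] show ?case
      by (simp only: rep_prering_mult_linear) (simp add: exact_relations)
  next
    case (eng h k)
    have "h \<otimes>\<^bsub>add_monoid (rep_prering G)\<^esub> k = h - (0 - k)" by simp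
    with eng(3,4) show ?case
      by (simp only: rep_prering_mult_linear) (simp add: exact_relations)
  qed
qed

text \<open>The two tensor products are only isomorphic, so commutativity holds modulo the
  relations. Absorption on the left is then deduced from absorption on the right.\<close>

lemma rep_prering_mult_commute:
  assumes G: "group G" and "Poly_Mapping.keys a \<subseteq> {M. fd_rmodule G M}"
    and "Poly_Mapping.keys b \<subseteq> {M. fd_rmodule G M}"
  shows "a \<otimes>\<^bsub>rep_prering G\<^esub> b - b \<otimes>\<^bsub>rep_prering G\<^esub> a \<in> exact_relations G"
  using assms(2)
proof (induction a rule: frag_induction)
  case zero
  show ?case by (simp add: rep_prering_mult_linear exact_relations)
next
  case (one M)
  then have M: "fd_rmodule G M" by simp
  from assms(3) show ?case
  proof (induction b rule: frag_induction)
    case zero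
    show ?case by (simp add: rep_prering_mult_linear exact_relations)
  next
    case (one N)
    then have N: "fd_rmodule G N" by simp
    note t = fd_tensor[OF G M N] fd_tensor[OF G N M]
    note nc = nat_copy[OF t(1)] nat_copy[OF t(2)]
    show ?case
      unfolding rep_prering_mult_linear
      by (rule rmodule_iso_relation[OF nc(1,3) rmodule_iso_trans[OF rmodule_iso_sym[OF t(1) nc(2)]
              rmodule_iso_trans[OF tensor_commute[OF M N] nc(4)]]])
  next
    case (diff b b')
    from exact_relations(4)[OF this] show ?case by (simp add: rep_prering_mult_linear algebra_simps)
  qed
next
  case (diff a a')
  from exact_relations(4)[OF this] show ?case by (simp add: rep_prering_mult_linear algebra_simps)
qed

lemma exact_relations_mult_left:
  assumes "group G" "a \<in> exact_relations G" "Poly_Mapping.keys b \<subseteq> {M. fd_rmodule G M}"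
  shows "b \<otimes>\<^bsub>rep_prering G\<^esub> a \<in> exact_relations G"
  using exact_relations(4)[OF exact_relations_mult_right[OF assms]
      rep_prering_mult_commute[OF assms(1) exact_relations(5)[OF assms(2)] assms(3)]]
  by simp

text \<open>\<open>rcoset_mult\<close> is the union of the cosets of all products of
  representatives. These cosets coincide because the relations absorb products on both
  sides.\<close>

lemma rep_coset_mult:
  assumes G: "group G" and x: "Poly_Mapping.keys x \<subseteq> {M. fd_rmodule G M}"
    and y: "Poly_Mapping.keys y \<subseteq> {M. fd_rmodule G M}"
  shows "(exact_relations G +>\<^bsub>rep_prering G\<^esub> x) \<otimes>\<^bsub>rep_ring G\<^esub> (exact_relations G +>\<^bsub>rep_prering G\<^esub> y) =
    exact_relations G +>\<^bsub>rep_prering G\<^esub> (x \<otimes>\<^bsub>rep_prering G\<^esub> y)"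
proof -
  have "exact_relations G +>\<^bsub>rep_prering G\<^esub> (a \<otimes>\<^bsub>rep_prering G\<^esub> b) =
      exact_relations G +>\<^bsub>rep_prering G\<^esub> (x \<otimes>\<^bsub>rep_prering G\<^esub> y)"
    if ab: "a \<in> exact_relations G +>\<^bsub>rep_prering G\<^esub> x" "b \<in> exact_relations G +>\<^bsub>rep_prering G\<^esub> y" for a b
  proof (rule rep_coset_eqI)
    obtain h k where h: "h \<in> exact_relations G" "a = h + x" and k: "k \<in> exact_relations G" "b = k + y"
      using ab by (auto simp: a_r_coset_def')
    have b: "Poly_Mapping.keys b \<subseteq> {M. fd_rmodule G M}"
      unfolding k(2) using keys_add[of k y] exact_relations(5)[OF k(1)] y by blast
    \<comment> \<open>With \<open>a = h + x\<close> and \<open>b = k + y\<close>, the products of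
      \<open>a\<close>, \<open>b\<close> and of \<open>x\<close>, \<open>y\<close> differ by
      \<open>h b + x k\<close>.\<close>
    have "h \<otimes>\<^bsub>rep_prering G\<^esub> b + x \<otimes>\<^bsub>rep_prering G\<^esub> k \<in> exact_relations G"
      by (intro exact_relations(2) exact_relations_mult_right[OF G h(1) b]
          exact_relations_mult_left[OF G k(1) x])
    moreover have "h = a - x" "k = b - y" using h(2) k(2) by simp_all
    ultimately show "a \<otimes>\<^bsub>rep_prering G\<^esub> b - x \<otimes>\<^bsub>rep_prering G\<^esub> y \<in> exact_relations G"
      by (simp add: rep_prering_mult_linear)
  qed
  moreover have "z \<in> exact_relations G +>\<^bsub>rep_prering G\<^esub> z" for z
    using exact_relations(1) by (force simp: a_r_coset_def')
  ultimately show ?thesis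
    unfolding rep_ring_simps rcoset_mult_def by blast
qed

lemma rep_class_mult:
  assumes G: "group G" and fd: "fd_rmodule G M" "fd_rmodule G N"
  shows "rep_class G M \<otimes>\<^bsub>rep_ring G\<^esub> rep_class G N = rep_class G (tensor_rmodule M N)"
proof -
  let ?M = "nat_copy G M" and ?N = "nat_copy G N"
  note M = nat_copy[OF fd(1)] and N = nat_copy[OF fd(2)]
  have "rep_class G M \<otimes>\<^bsub>rep_ring G\<^esub> rep_class G N = rep_class G (tensor_rmodule ?M ?N)"
    unfolding rep_class_def using M(1) N(1)
    by (subst rep_coset_mult[OF G]) (auto simp: rep_prering_mult_linear)
  also have "\<dots> = rep_class G (tensor_rmodule M N)"
  proof (rule rep_class_iso[symmetric])
    show "rmodule_iso G (tensor_rmodule M N) (tensor_rmodule ?M ?N)"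
      by (rule rmodule_iso_trans[OF tensor_iso_left[OF fd(1) M(1) fd(2) M(2)]
            tensor_iso_right[OF G M(1) fd(2) N(1,2)]])
  qed (intro fd_tensor G fd M(1) N(1))+
  finally show ?thesis .
qed

lemma fd_trivial: "fd_rmodule G trivial_rmodule"
proof (rule fd_rmoduleI[of "{\<lambda>_. 1}"])
  have "x \<in> qvs.span {\<lambda>_. 1}" for x :: "unit \<Rightarrow> rat"
  proof -
    have "x = qscale (x ()) (\<lambda>_. 1)" by (simp add: qscale_def fun_eq_iff)
    then show ?thesis by (metis insertI1 qvs.span_base qvs.span_scale)
  qed
  then show "vecs trivial_rmodule = qvs.span {\<lambda>_. 1}" by (auto simp: trivial_rmodule_def)
qed (auto simp: trivial_rmodule_def linear_on_def)

lemma rep_ring_one_mult: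
  assumes G: "group G" and fd: "fd_rmodule G M"
  shows "\<one>\<^bsub>rep_ring G\<^esub> \<otimes>\<^bsub>rep_ring G\<^esub> rep_class G M = rep_class G M"
proof -
  note T = nat_copy[OF fd_trivial, of G] and M = nat_copy[OF fd]
  have "\<one>\<^bsub>rep_ring G\<^esub> \<otimes>\<^bsub>rep_ring G\<^esub> rep_class G M =
      rep_class G (tensor_rmodule (nat_copy G trivial_rmodule) (nat_copy G M))"
    unfolding rep_class_def rep_ring_simps(3) using T(1) M(1)
    by (subst rep_coset_mult[OF G]) (auto simp: rep_prering_mult_linear)
  also have "\<dots> = rep_class G M"
  proof (rule rep_class_iso[symmetric])
    show "rmodule_iso G M (tensor_rmodule (nat_copy G trivial_rmodule) (nat_copy G M))"
      by (rule rmodule_iso_trans[OF M(2) tensor_trivial[OF T(1) M(1) T(2)]])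
  qed (intro fd_tensor G fd T(1) M(1))+
  finally show ?thesis .
qed

lemma rep_ring_mult_zero:
  assumes G: "group G" and a: "a \<in> carrier (rep_ring G)"
  shows "a \<otimes>\<^bsub>rep_ring G\<^esub> \<zero>\<^bsub>rep_ring G\<^esub> = \<zero>\<^bsub>rep_ring G\<^esub>"
    and "\<zero>\<^bsub>rep_ring G\<^esub> \<otimes>\<^bsub>rep_ring G\<^esub> a = \<zero>\<^bsub>rep_ring G\<^esub>"
proof -
  obtain x where x: "a = exact_relations G +>\<^bsub>rep_prering G\<^esub> x"
      "Poly_Mapping.keys x \<subseteq> {M. fd_rmodule G M}"
    using a unfolding rep_ring_simps by auto
  show "a \<otimes>\<^bsub>rep_ring G\<^esub> \<zero>\<^bsub>rep_ring G\<^esub> = \<zero>\<^bsub>rep_ring G\<^esub>"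
    unfolding x(1) rep_ring_simps(2) by (subst rep_coset_mult[OF G x(2)]) (simp_all add: rep_prering_mult_linear)
  show "\<zero>\<^bsub>rep_ring G\<^esub> \<otimes>\<^bsub>rep_ring G\<^esub> a = \<zero>\<^bsub>rep_ring G\<^esub>"
    unfolding x(1) rep_ring_simps(2) by (subst rep_coset_mult[OF G _ x(2)]) (simp_all add: rep_prering_mult_linear)
qed

lemma rep_ring_one_closed: "\<one>\<^bsub>rep_ring G\<^esub> \<in> carrier (rep_ring G)"
  using nat_copy(1)[OF fd_trivial, of G] by (auto simp: rep_ring_simps)

section \<open>Group algebras of finite groups\<close>

locale fin_group = group +
  assumes finite_carrier [simp]: "finite (carrier G)"
begin

abbreviation "GA \<equiv> carrier (group_algebra G)"
abbreviation conv (infixl \<open>\<star>\<close> 70) where "x \<star> y \<equiv> x \<otimes>\<^bsub>group_algebra G\<^esub> y"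

lemma GA_iff: "x \<in> GA \<longleftrightarrow> (\<forall>g. g \<notin> carrier G \<longrightarrow> x g = 0)"
  by (simp add: group_algebra_def)

lemma subspace_GA: "qvs.subspace GA"
  by (rule qvs.subspaceI) (auto simp: GA_iff qscale_def)

lemma conv_apply:
  "g \<in> carrier G \<Longrightarrow> (x \<star> y) g = (\<Sum>h\<in>carrier G. x h * y (inv h \<otimes> g))"
  "g \<notin> carrier G \<Longrightarrow> (x \<star> y) g = 0"
  by (simp_all add: group_algebra_def)

lemma conv_closed [simp, intro]: "x \<star> y \<in> GA"
  by (simp add: GA_iff conv_apply)

lemma conv_add: "(x + x') \<star> y = x \<star> y + x' \<star> y" "x \<star> (y + y') = x \<star> y + x \<star> y'"
  by (auto simp: fun_eq_iff group_algebra_def algebra_simps sum.distrib)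

lemma conv_scale: "qscale c x \<star> y = qscale c (x \<star> y)" "x \<star> qscale c y = qscale c (x \<star> y)"
  by (auto simp: fun_eq_iff group_algebra_def algebra_simps sum_distrib_left qscale_def)

lemma conv_zero [simp]: "0 \<star> y = 0" "y \<star> 0 = 0"
  by (auto simp: fun_eq_iff group_algebra_def)

lemma conv_sum: "(\<Sum>i\<in>A. x i) \<star> y = (\<Sum>i\<in>A. x i \<star> y)" "y \<star> (\<Sum>i\<in>A. x i) = (\<Sum>i\<in>A. y \<star> x i)"
  by (induction A rule: infinite_finite_induct) (simp_all add: conv_add)

lemma linear_on_conv: "linear_on V (\<lambda>x. y \<star> x)" "linear_on V (\<lambda>x. x \<star> y)"
  by (simp_all add: linear_on_def conv_add conv_scale)

lemma delta_conv:
  assumes "h \<in> carrier G" "g \<in> carrier G"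
  shows "(delta h \<star> x) g = x (inv h \<otimes> g)"
  using assms by (simp add: conv_apply delta_def if_distrib[of "\<lambda>c. c * _"] cong: if_cong)

lemma conv_delta:
  assumes "h \<in> carrier G" "g \<in> carrier G"
  shows "(x \<star> delta h) g = x (g \<otimes> inv h)"
proof -
  have "inv k \<otimes> g = h \<longleftrightarrow> k = g \<otimes> inv h" if "k \<in> carrier G" for k
    using that assms by (metis inv_solve_left' inv_solve_right')
  then have "(x \<star> delta h) g = (\<Sum>k\<in>carrier G. if k = g \<otimes> inv h then x k else 0)"
    unfolding conv_apply(1)[OF assms(2)] by (intro sum.cong) (auto simp: delta_def)
  then show ?thesis using assms by simp
qed

lemma conv_assoc: "(x \<star> y) \<star> z = x \<star> (y \<star> z)"
proof
  fix g
  show "((x \<star> y) \<star> z) g = (x \<star> (y \<star> z)) g"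
  proof (cases "g \<in> carrier G")
    case True
    have "((x \<star> y) \<star> z) g =
        (\<Sum>h\<in>carrier G. \<Sum>k\<in>carrier G. x k * y (inv k \<otimes> h) * z (inv h \<otimes> g))"
      using True by (simp add: conv_apply sum_distrib_right)
    also have "\<dots> = (\<Sum>k\<in>carrier G. \<Sum>h\<in>carrier G. x k * y (inv k \<otimes> h) * z (inv h \<otimes> g))"
      by (rule sum.swap)
    also have "\<dots> = (\<Sum>k\<in>carrier G. \<Sum>h\<in>carrier G. x k * y h * z (inv h \<otimes> (inv k \<otimes> g)))"
    proof (rule sum.cong[OF refl])
      fix k assume k: "k \<in> carrier G"
      show "(\<Sum>h\<in>carrier G. x k * y (inv k \<otimes> h) * z (inv h \<otimes> g)) =
          (\<Sum>h\<in>carrier G. x k * y h * z (inv h \<otimes> (inv k \<otimes> g)))"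
      proof (rule sum.reindex_bij_witness[of _ "\<lambda>h. k \<otimes> h" "\<lambda>h. inv k \<otimes> h"])
        fix h assume h: "h \<in> carrier G"
        then have "inv (inv k \<otimes> h) \<otimes> (inv k \<otimes> g) = inv h \<otimes> g"
          using k True by (metis inv_closed inv_inv inv_mult_group inv_solve_left m_assoc m_closed)
        then show "x k * y (inv k \<otimes> h) * z (inv (inv k \<otimes> h) \<otimes> (inv k \<otimes> g)) =
            x k * y (inv k \<otimes> h) * z (inv h \<otimes> g)" by simp
      qed (use k in \<open>simp_all add: m_assoc[symmetric]\<close>)
    qed
    also have "\<dots> = (x \<star> (y \<star> z)) g"
      using True by (simp add: conv_apply sum_distrib_left mult.assoc)
    finally show ?thesis .
  qed (simp add: conv_apply)
qed

lemma delta_closed [simp]: "g \<in> carrier G \<Longrightarrow> delta g \<in> GA"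
  by (auto simp: GA_iff delta_def)

lemma delta_conv_delta:
  assumes "g \<in> carrier G" "h \<in> carrier G"
  shows "delta g \<star> delta h = delta (g \<otimes> h)"
proof
  fix k
  show "(delta g \<star> delta h) k = delta (g \<otimes> h) k"
  proof (cases "k \<in> carrier G")
    case True
    then have "inv g \<otimes> k = h \<longleftrightarrow> k = g \<otimes> h"
      using assms by (metis inv_solve_left')
    then show ?thesis using assms True by (simp add: delta_conv) (simp add: delta_def)
  qed (use assms in \<open>auto simp: conv_apply delta_def\<close>)
qed

lemma one_conv [simp]: "x \<in> GA \<Longrightarrow> delta \<one> \<star> x = x" "x \<in> GA \<Longrightarrow> x \<star> delta \<one> = x"
proof -
  assume x: "x \<in> GA"
  show "delta \<one> \<star> x = x"
  proof
    fix g show "(delta \<one> \<star> x) g = x g"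
      using x by (cases "g \<in> carrier G") (simp_all add: delta_conv conv_apply(2) GA_iff)
  qed
  show "x \<star> delta \<one> = x"
  proof
    fix g show "(x \<star> delta \<one>) g = x g"
      using x by (cases "g \<in> carrier G") (simp_all add: conv_delta conv_apply(2) GA_iff)
  qed
qed

lemma GA_expansion:
  assumes "x \<in> GA"
  shows "x = (\<Sum>g\<in>carrier G. qscale (x g) (delta g))"
proof
  fix h show "x h = (\<Sum>g\<in>carrier G. qscale (x g) (delta g)) h"
    using assms
    by (cases "h \<in> carrier G") (simp_all add: sum_fun_apply qscale_def delta_def GA_iff if_distrib cong: if_cong)
qed

lemma GA_span: "GA = qvs.span (delta ` carrier G)"
proof
  show "GA \<subseteq> qvs.span (delta ` carrier G)"
  proof
    fix x assume x: "x \<in> GA"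
    have "(\<Sum>g\<in>carrier G. qscale (x g) (delta g)) \<in> qvs.span (delta ` carrier G)"
      by (intro qvs.span_sum qvs.span_scale qvs.span_base) auto
    then show "x \<in> qvs.span (delta ` carrier G)"
      using GA_expansion[OF x] by metis
  qed
  show "qvs.span (delta ` carrier G) \<subseteq> GA"
    by (intro qvs.span_minimal subspace_GA) auto
qed

section \<open>Right ideals as modules\<close>

lemma vecs_right_ideal: "vecs (right_ideal_rmodule G a) = (\<lambda>x. a \<star> x) ` GA"
  by (auto simp: right_ideal_rmodule_def)

lemma act_right_ideal: "act (right_ideal_rmodule G a) x g = x \<star> delta g"
  by (simp add: right_ideal_rmodule_def)

lemma right_ideal_subset: "vecs (right_ideal_rmodule G a) \<subseteq> GA"
  by (auto simp: vecs_right_ideal)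

lemma fd_right_ideal: "fd_rmodule G (right_ideal_rmodule G a)"
proof (rule fd_rmoduleI[of "(\<lambda>x. a \<star> x) ` delta ` carrier G"])
  show "vecs (right_ideal_rmodule G a) = qvs.span ((\<lambda>x. a \<star> x) ` delta ` carrier G)"
    unfolding vecs_right_ideal GA_span by (rule linear_on_span_image[OF linear_on_conv(1)])
  show "act (right_ideal_rmodule G a) (act (right_ideal_rmodule G a) x g) h =
      act (right_ideal_rmodule G a) x (g \<otimes> h)"
    if "x \<in> vecs (right_ideal_rmodule G a)" "g \<in> carrier G" "h \<in> carrier G" for x g h
    using that by (simp add: act_right_ideal conv_assoc delta_conv_delta)
  show "act (right_ideal_rmodule G a) x \<one> = x" if "x \<in> vecs (right_ideal_rmodule G a)" for x
    using that right_ideal_subset[of a] by (auto simp: act_right_ideal)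
qed (auto simp: act_right_ideal linear_on_conv vecs_right_ideal conv_assoc)

lemma right_ideal_idempotent:
  assumes "e \<star> e = e"
  shows "vecs (right_ideal_rmodule G e) = {x \<in> GA. e \<star> x = x}"
  unfolding vecs_right_ideal using assms conv_assoc[of e e] by (auto simp: image_iff) metis

text \<open>The inclusion of the ideal of \<open>e\<close>, followed by left multiplication with
  \<open>f\<close>, is a short exact sequence.\<close>

lemma rep_class_orthogonal_sum:
  assumes "e \<star> e = e" "f \<star> f = f" "e \<star> f = 0" "f \<star> e = 0"
  shows "rep_class G (right_ideal_rmodule G (e + f)) =
    rep_class G (right_ideal_rmodule G e) \<oplus>\<^bsub>rep_ring G\<^esub> rep_class G (right_ideal_rmodule G f)"
proof (rule rep_class_exact[OF fd_right_ideal fd_right_ideal fd_right_ideal])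
  let ?M = "right_ideal_rmodule G"
  have idem: "(e + f) \<star> (e + f) = e + f"
    by (simp add: conv_add assms)
  note vecs = right_ideal_idempotent[OF assms(1)] right_ideal_idempotent[OF assms(2)]
    right_ideal_idempotent[OF idem]
  have e: "(e + f) \<star> x = x" if "e \<star> x = x" for x
    using conv_assoc[of f e x] that assms by (simp add: conv_add)
  have f: "(e + f) \<star> x = x" if "f \<star> x = x" for x
    using conv_assoc[of e f x] that assms by (simp add: conv_add)
  have ef: "f \<star> (f \<star> x) = f \<star> x" for x
    using conv_assoc[of f f x] assms by simp
  have fe: "f \<star> x = 0" if "e \<star> x = x" for x
    using conv_assoc[of f e x] that assms by simp
  have "rmodule_hom G (?M e) (?M (e + f)) (\<lambda>x. x)"
    by (rule rmodule_homI) (use e in \<open>auto simp: vecs act_right_ideal linear_on_def\<close>)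
  moreover have "rmodule_hom G (?M (e + f)) (?M f) (\<lambda>x. f \<star> x)"
    by (rule rmodule_homI) (use ef in \<open>auto simp: vecs act_right_ideal linear_on_conv conv_assoc\<close>)
  moreover have "(\<lambda>x. f \<star> x) ` vecs (?M (e + f)) = vecs (?M f)"
    unfolding vecs using f ef by (auto simp: image_iff) metis
  moreover have "(\<lambda>x. x) ` vecs (?M e) = {x \<in> vecs (?M (e + f)). f \<star> x = 0}"
    unfolding vecs using e fe by (auto simp: conv_add)
  ultimately show "short_exact G (?M e) (?M (e + f)) (?M f)"
    unfolding short_exact_def
    by (intro exI[of _ "\<lambda>x. x"] exI[of _ "\<lambda>x. f \<star> x"] conjI inj_on_id2)
qed

text \<open>With a nonempty index set the induction starts at a single summand, so the class of the
  zero module never has to be computed.\<close>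

lemma rep_class_orthogonal_sums:
  assumes "\<And>i j. i \<in> {1..Suc m} \<Longrightarrow> j \<in> {1..Suc m} \<Longrightarrow>
    e i \<star> e j = (if i = j then e i else 0)"
  shows "rep_class G (right_ideal_rmodule G (\<Sum>i\<in>{1..Suc m}. e i)) =
    (\<Oplus>\<^bsub>rep_ring G\<^esub>i\<in>{1..Suc m}. rep_class G (right_ideal_rmodule G (e i)))"
  using assms
proof (induction m)
  case 0
  interpret R: abelian_group "rep_ring G" by (rule abelian_group_rep_ring)
  show ?case using rep_class_closed[OF fd_right_ideal] by simp
next
  case (Suc m)
  interpret R: abelian_group "rep_ring G" by (rule abelian_group_rep_ring)
  let ?s = "\<Sum>i\<in>{1..Suc m}. e i"
  let ?n = "Suc (Suc m)"
  have "?s \<star> e j = (if j \<in> {1..Suc m} then e j else 0)"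
    "e j \<star> ?s = (if j \<in> {1..Suc m} then e j else 0)" if "j \<in> {1..?n}" for j
  proof -
    have "?s \<star> e j = (\<Sum>i\<in>{1..Suc m}. if i = j then e i else 0)"
      unfolding conv_sum using Suc.prems that by (intro sum.cong) auto
    then show "?s \<star> e j = (if j \<in> {1..Suc m} then e j else 0)" by simp
    have "e j \<star> ?s = (\<Sum>i\<in>{1..Suc m}. if i = j then e i else 0)"
      unfolding conv_sum using Suc.prems that by (intro sum.cong) auto
    then show "e j \<star> ?s = (if j \<in> {1..Suc m} then e j else 0)" by simp
  qed
  note s = this
  have "?s \<star> ?s = (\<Sum>i\<in>{1..Suc m}. e i)"
    unfolding conv_sum(2)[of ?s] using s(1) by (intro sum.cong) auto
  then have "rep_class G (right_ideal_rmodule G (?s + e ?n)) = rep_class G (right_ideal_rmodule G ?s)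
      \<oplus>\<^bsub>rep_ring G\<^esub> rep_class G (right_ideal_rmodule G (e ?n))"
    by (intro rep_class_orthogonal_sum) (use Suc.prems s in auto)
  also have "rep_class G (right_ideal_rmodule G ?s) =
      (\<Oplus>\<^bsub>rep_ring G\<^esub>i\<in>{1..Suc m}. rep_class G (right_ideal_rmodule G (e i)))"
    by (rule Suc.IH) (rule Suc.prems; force)
  also have "\<dots> \<oplus>\<^bsub>rep_ring G\<^esub> rep_class G (right_ideal_rmodule G (e ?n)) =
      (\<Oplus>\<^bsub>rep_ring G\<^esub>i\<in>insert ?n {1..Suc m}. rep_class G (right_ideal_rmodule G (e i)))"
    using rep_class_closed[OF fd_right_ideal] by (subst R.finsum_insert) (auto simp: R.a_comm)
  also have "insert ?n {1..Suc m} = {1..?n}" by auto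
  also have "?s + e ?n = (\<Sum>i\<in>{1..?n}. e i)"
    by (rule sum.cl_ivl_Suc[THEN trans, symmetric]) simp
  finally show ?case .
qed

end

text \<open>As \<open>x\<close> vanishes outside \<open>K\<close>, the sum runs over
  \<open>h\<close> in \<open>K\<close>, and then \<open>inv h \<otimes> g\<close> lies in
  \<open>K\<close> exactly if \<open>g\<close> does. So the group algebra of \<open>K\<close> sits
  inside that of \<open>G\<close> with the same product.\<close>

lemma (in fin_group) conv_subgroup:
  assumes K: "subgroup K G" and x: "x \<in> carrier (group_algebra (G\<lparr>carrier := K\<rparr>))"
    and y: "y \<in> carrier (group_algebra (G\<lparr>carrier := K\<rparr>))"
  shows "x \<otimes>\<^bsub>group_algebra (G\<lparr>carrier := K\<rparr>)\<^esub> y = x \<star> y"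
proof
  fix g
  have x0: "x h = 0" and y0: "y h = 0" if "h \<notin> K" for h
    using x y that by (auto simp: group_algebra_def)
  have sub: "K \<subseteq> carrier G" using K by (rule subgroup.subset)
  have eq: "(\<Sum>h\<in>carrier G. x h * y (inv h \<otimes> g)) = (\<Sum>h\<in>K. x h * y (inv h \<otimes> g))"
    by (rule sum.mono_neutral_right) (use sub x0 in auto)
  show "(x \<otimes>\<^bsub>group_algebra (G\<lparr>carrier := K\<rparr>)\<^esub> y) g = (x \<star> y) g"
  proof (cases "g \<in> K")
    case True
    have "(x \<otimes>\<^bsub>group_algebra (G\<lparr>carrier := K\<rparr>)\<^esub> y) g =
        (\<Sum>h\<in>K. x h * y (inv\<^bsub>G\<lparr>carrier := K\<rparr>\<^esub> h \<otimes> g))"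
      using True by (simp add: group_algebra_def)
    also have "\<dots> = (\<Sum>h\<in>K. x h * y (inv h \<otimes> g))"
      by (intro sum.cong refl) (simp add: m_inv_consistent[OF K])
    finally show ?thesis using True sub eq by (simp add: conv_apply subsetD)
  next
    case False
    have "inv h \<otimes> g \<notin> K" if "h \<in> K" "g \<in> carrier G" for h
    proof
      assume "inv h \<otimes> g \<in> K"
      then have "h \<otimes> (inv h \<otimes> g) \<in> K" using that K by (simp add: subgroup.m_closed)
      moreover have "h \<otimes> (inv h \<otimes> g) = g" using that sub by (simp add: m_assoc[symmetric] subsetD)
      ultimately show False using False by simp
    qed
    then have "(x \<star> y) g = 0"
      using eq y0 by (cases "g \<in> carrier G") (simp_all add: conv_apply)
    then show ?thesis using False by (simp add: group_algebra_def)
  qed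
qed

text \<open>A function on \<open>G\<close> is cut along the right cosets of \<open>K\<close>. Left
  multiplication by \<open>e\<close> acts inside each coset, so being fixed by \<open>e\<close> can
  be tested on the pieces, and a covariant family of pieces is a vector of the induced
  module.\<close>

lemma (in fin_group) induced_right_ideal:
  assumes K: "subgroup K G" and e: "e \<in> carrier (group_algebra (G\<lparr>carrier := K\<rparr>))" "e \<star> e = e"
  shows "rmodule_iso G (right_ideal_rmodule G e)
    (induced_rmodule G K (right_ideal_rmodule (G\<lparr>carrier := K\<rparr>) e))"
proof -
  let ?H = "G\<lparr>carrier := K\<rparr>"
  let ?E = "right_ideal_rmodule ?H e"
  let ?I = "induced_rmodule G K ?E"
  have sub: "K \<subseteq> carrier G" using K by (rule subgroup.subset)
  interpret H: fin_group ?H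
    by (intro fin_group.intro fin_group_axioms.intro subgroup_imp_group[OF K])
       (use finite_subset[OF sub finite_carrier] in simp)
  have conv: "x \<otimes>\<^bsub>group_algebra ?H\<^esub> y = x \<star> y" if "x \<in> H.GA" "y \<in> H.GA" for x y
    by (rule conv_subgroup[OF K that])
  have HGA: "x \<in> H.GA \<longleftrightarrow> (\<forall>g. g \<notin> K \<longrightarrow> x g = 0)" for x
    by (simp add: H.GA_iff)
  have ee: "H.conv e e = e"
    using conv[OF e(1) e(1)] e(2) by (rule trans)
  have E: "vecs ?E = {y \<in> H.GA. e \<star> y = y}"
    unfolding H.right_ideal_idempotent[OF ee] by (intro Collect_cong conj_cong refl) (simp only: conv[OF e(1)])
  have actE: "act ?E y h k = y (k \<otimes> inv h)" if "y \<in> H.GA" "h \<in> K" "k \<in> K" for y h k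
    using H.conv_delta[of h k y] that by (simp add: H.act_right_ideal m_inv_consistent[OF K])
  have actE': "act ?E y h k = 0" if "k \<notin> K" for y h k
    using that H.conv_apply(2)[of k y "delta h"] by (simp add: H.act_right_ideal)
  \<comment> \<open>\<open>curry (F x) g\<close> is the restriction of
    \<open>x \<star> delta g\<close> to \<open>K\<close>, that is, the piece of \<open>x\<close> on
    the coset of \<open>inv g\<close>, moved to \<open>K\<close>.\<close>
  define F where "F x = (\<lambda>(g, k). if g \<in> carrier G \<and> k \<in> K then x (k \<otimes> inv g) else (0 :: rat))" for x
  have conve: "(e \<star> x) g = (\<Sum>h\<in>K. e h * x (inv h \<otimes> g))" if "g \<in> carrier G" for x g
    unfolding conv_apply(1)[OF that] by (rule sum.mono_neutral_right) (use sub e HGA in auto)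
  have closed: "F x \<in> vecs ?I" if x: "x \<in> GA" "e \<star> x = x" for x
  proof -
    have "curry (F x) g \<in> vecs ?E" if g: "g \<in> carrier G" for g
    proof -
      have F: "curry (F x) g = (\<lambda>k. if k \<in> K then x (k \<otimes> inv g) else 0)"
        using g by (simp add: F_def curry_def)
      have "(e \<star> curry (F x) g) k = curry (F x) g k" for k
      proof (cases "k \<in> K")
        case True
        then have k: "k \<in> carrier G" using sub by auto
        have "(e \<star> curry (F x) g) k = (\<Sum>h\<in>K. e h * x (inv h \<otimes> k \<otimes> inv g))"
          unfolding conve[OF k] F using True K
          by (intro sum.cong refl) (simp add: subgroup.m_closed subgroup.m_inv_closed)
        also have "\<dots> = (e \<star> x) (k \<otimes> inv g)"
          unfolding conve[OF m_closed[OF k inv_closed[OF g]]] using k g sub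
          by (intro sum.cong refl) (simp add: m_assoc subsetD)
        finally show ?thesis using True x(2) by (simp add: F)
      next
        case False
        have c: "curry (F x) g \<in> H.GA" by (simp add: HGA F)
        have "(e \<star> curry (F x) g) k = 0"
          using conv[OF e(1) c] H.conv_apply(2)[of k e "curry (F x) g"] False by simp
        then show ?thesis using False by (simp add: F)
      qed
      then show ?thesis unfolding E by (auto simp: HGA F)
    qed
    moreover have "curry (F x) (g \<otimes> h) = act ?E (curry (F x) g) h" if gh: "g \<in> carrier G" "h \<in> K" for g h
    proof
      fix k
      have h: "h \<in> carrier G" using gh sub by auto
      show "curry (F x) (g \<otimes> h) k = act ?E (curry (F x) g) h k"
      proof (cases "k \<in> K")
        case True
        then have "k \<in> carrier G" using sub by auto
        then have "k \<otimes> inv (g \<otimes> h) = k \<otimes> inv h \<otimes> inv g"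
          using gh h by (simp add: inv_mult_group m_assoc)
        moreover have "k \<otimes> inv h \<in> K"
          using True gh K by (simp add: subgroup.m_closed subgroup.m_inv_closed)
        moreover have "curry (F x) g \<in> H.GA" by (simp add: HGA F_def)
        ultimately show ?thesis
          using True gh h by (simp add: actE) (simp add: F_def)
      qed (use gh in \<open>simp add: actE' F_def\<close>)
    qed
    moreover have "curry (F x) g = 0" if "g \<notin> carrier G" for g
      using that by (simp add: F_def fun_eq_iff)
    ultimately show ?thesis by (simp add: induced_rmodule_def)
  qed
  have "rmodule_hom G (right_ideal_rmodule G e) ?I F"
  proof (rule rmodule_homI)
    show "F x \<in> vecs ?I" if "x \<in> vecs (right_ideal_rmodule G e)" for x
      using that closed unfolding right_ideal_idempotent[OF e(2)] by blast
    show "linear_on (vecs (right_ideal_rmodule G e)) F"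
      unfolding linear_on_def by (auto simp: F_def fun_eq_iff qscale_def)
    fix x s assume s: "s \<in> carrier G"
    show "F (act (right_ideal_rmodule G e) x s) = act ?I (F x) s"
    proof (clarsimp simp: fun_eq_iff)
      fix g k
      show "F (act (right_ideal_rmodule G e) x s) (g, k) = act ?I (F x) s (g, k)"
      proof (cases "g \<in> carrier G \<and> k \<in> K")
        case True
        then have gk: "g \<in> carrier G" "k \<in> carrier G" using sub by auto
        then have "(x \<star> delta s) (k \<otimes> inv g) = x (k \<otimes> inv g \<otimes> inv s)"
          using s by (simp add: conv_delta)
        also have "k \<otimes> inv g \<otimes> inv s = k \<otimes> inv (s \<otimes> g)"
          using gk s by (simp add: inv_mult_group m_assoc)
        finally show ?thesis
          using True gk s by (simp add: F_def act_right_ideal induced_rmodule_def)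
      next
        case False
        then show ?thesis by (auto simp: F_def induced_rmodule_def)
      qed
    qed
  qed
  moreover have "bij_betw F (vecs (right_ideal_rmodule G e)) (vecs ?I)"
    unfolding bij_betw_def
  proof
    have oneK: "\<one> \<in> K" by (rule subgroup.one_closed[OF K])
    show "inj_on F (vecs (right_ideal_rmodule G e))"
    proof (rule inj_onI, rule ext)
      fix x y g assume xy: "x \<in> vecs (right_ideal_rmodule G e)" "y \<in> vecs (right_ideal_rmodule G e)" "F x = F y"
      show "x g = y g"
      proof (cases "g \<in> carrier G")
        case True
        then show ?thesis
          using fun_cong[OF xy(3), of "(inv g, \<one>)"] oneK by (simp add: F_def)
      next
        case False
        moreover have "x \<in> GA" "y \<in> GA"
          using xy(1,2) right_ideal_subset by blast+
        ultimately show ?thesis by (simp add: GA_iff)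
      qed
    qed
    show "F ` vecs (right_ideal_rmodule G e) = vecs ?I"
    proof (intro equalityI subsetI)
      fix f assume "f \<in> F ` vecs (right_ideal_rmodule G e)"
      then show "f \<in> vecs ?I"
        using closed unfolding right_ideal_idempotent[OF e(2)] by blast
    next
      fix f assume "f \<in> vecs ?I"
      then have fE: "curry f g \<in> vecs ?E" and fh: "h \<in> K \<Longrightarrow> curry f (g \<otimes> h) = act ?E (curry f g) h"
        and f0: "g' \<notin> carrier G \<Longrightarrow> curry f g' = 0" if "g \<in> carrier G" for g g' h
        using that by (auto simp: induced_rmodule_def)
      have fGA: "curry f g \<in> H.GA" "e \<star> curry f g = curry f g" if "g \<in> carrier G" for g
        using fE[OF that] by (auto simp: E)
      \<comment> \<open>Covariance in coordinates: both index pairs stand for the same element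
        \<open>k \<otimes> inv h \<otimes> inv g\<close> of \<open>G\<close>.\<close>
      have shift: "f (g \<otimes> h, k) = f (g, k \<otimes> inv h)" if "g \<in> carrier G" "h \<in> K" "k \<in> K" for g h k
        using fun_cong[OF fh[OF that(1,2)], of k] actE[OF fGA(1)[OF that(1)] that(2,3)] by simp
      \<comment> \<open>The only candidate for a preimage, since \<open>F x (inv g, \<one>)\<close>
        is \<open>x g\<close>.\<close>
      define x where "x g = (if g \<in> carrier G then f (inv g, \<one>) else 0)" for g
      have "(e \<star> x) g = x g" for g
      proof (cases "g \<in> carrier G")
        case True
        have "(e \<star> x) g = (\<Sum>h\<in>K. e h * f (inv g, inv h))"
          unfolding conve[OF True]
        proof (rule sum.cong[OF refl])
          fix h assume h: "h \<in> K"
          then have hG: "h \<in> carrier G" using sub by auto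
          have "x (inv h \<otimes> g) = f (inv g \<otimes> h, \<one>)"
            using True hG by (simp add: x_def inv_mult_group)
          also have "\<dots> = f (inv g, inv h)"
            using shift[OF _ h oneK, of "inv g"] True hG by simp
          finally show "e h * x (inv h \<otimes> g) = e h * f (inv g, inv h)" by simp
        qed
        also have "\<dots> = (e \<star> curry f (inv g)) \<one>"
          unfolding conve[OF one_closed] using sub
          by (intro sum.cong refl) (simp add: subsetD)
        also have "\<dots> = x g"
          using fGA(2)[of "inv g"] True by (simp add: x_def)
        finally show ?thesis .
      qed (simp add: conv_apply x_def)
      then have "x \<in> vecs (right_ideal_rmodule G e)"
        unfolding right_ideal_idempotent[OF e(2)] by (auto simp: GA_iff x_def)
      moreover have "F x = f"
      proof (clarsimp simp: fun_eq_iff)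
        fix g k
        show "F x (g, k) = f (g, k)"
        proof (cases "g \<in> carrier G \<and> k \<in> K")
          case True
          then have gk: "g \<in> carrier G" "k \<in> K" "k \<in> carrier G" using sub by auto
          then have "F x (g, k) = f (g \<otimes> inv k, \<one>)"
            by (simp add: F_def x_def inv_mult_group)
          also have "\<dots> = f (g, k)"
            using shift[OF gk(1) subgroup.m_inv_closed[OF K gk(2)] oneK] gk by simp
          finally show ?thesis .
        next
          case False
          show ?thesis
          proof (cases "g \<in> carrier G")
            case True
            then have "curry f g k = 0" using False fGA(1)[OF True] HGA by blast
            then show ?thesis using False by (auto simp: F_def)
          next
            case g: False
            then show ?thesis
              using fun_cong[OF f0[OF one_closed g], of k] by (simp add: F_def)
          qed
        qed
      qed
      ultimately show "f \<in> F ` vecs (right_ideal_rmodule G e)" by blast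
    qed
  qed
  ultimately show ?thesis unfolding rmodule_iso_def by blast
qed

section \<open>Polynomials in an element of a group algebra\<close>

context fin_group
begin

text \<open>Evaluation of \<open>p\<close> at \<open>x\<close> by Horner's scheme, in an algebra
  that is a record and not an instance of a type class.\<close>

definition evp :: "('a \<Rightarrow> rat) \<Rightarrow> rat poly \<Rightarrow> 'a \<Rightarrow> rat" where
  "evp x p = fold_coeffs (\<lambda>c y. qscale c (delta \<one>) + x \<star> y) p 0"

lemma evp_0 [simp]: "evp x 0 = 0"
  by (simp add: evp_def)

lemma evp_pCons: "evp x (pCons c p) = qscale c (delta \<one>) + x \<star> evp x p"
  by (cases "p = 0 \<and> c = 0") (auto simp: evp_def)

lemma evp_closed [simp]: "evp x p \<in> GA"
proof (induction p)
  case 0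
  show ?case unfolding evp_0 by (rule qvs.subspace_0[OF subspace_GA])
next
  case (pCons a p)
  show ?case
    unfolding evp_pCons
    by (intro qvs.subspace_add[OF subspace_GA] qvs.subspace_scale[OF subspace_GA]
        delta_closed one_closed conv_closed)
qed

lemma evp_add: "evp x (p + q) = evp x p + evp x q"
proof (induction p q rule: poly_induct2)
  case (pCons a p b q)
  show ?case
    unfolding add_pCons evp_pCons pCons conv_add qvs.scale_left_distrib by (simp only: add_ac)
qed simp

lemma evp_smult: "evp x (smult c p) = qscale c (evp x p)"
proof (induction p)
  case (pCons a p)
  show ?case
    unfolding smult_pCons evp_pCons pCons.IH conv_scale qvs.scale_right_distrib qvs.scale_scale ..
qed (simp only: smult_0_right evp_0 qvs.scale_zero_right)

lemma evp_diff: "evp x (p - q) = evp x p - evp x q"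
  using evp_add[of x "p - q" q] by (simp only: diff_add_cancel) (simp only: add_diff_cancel_right')

lemma evp_sum: "evp x (\<Sum>i\<in>A. p i) = (\<Sum>i\<in>A. evp x (p i))"
  by (induction A rule: infinite_finite_induct)
     (simp_all only: sum.infinite sum.empty sum.insert evp_0 evp_add not_False_eq_True)

lemma evp_const: "evp x [:c:] = qscale c (delta \<one>)"
  by (simp add: evp_pCons)

lemma evp_1: "evp x 1 = delta \<one>"
  using evp_const[of x 1] by (simp add: one_pCons)

lemma evp_mult: "evp x (p * q) = evp x p \<star> evp x q"
proof (induction p)
  case (pCons a p)
  have "evp x (pCons a p * q) = qscale a (evp x q) + x \<star> (evp x p \<star> evp x q)"
    unfolding mult_pCons_left evp_add evp_smult evp_pCons pCons.IH by simp
  then show ?case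
    unfolding evp_pCons conv_add conv_scale conv_assoc one_conv(1)[OF evp_closed] .
qed (simp only: mult_zero_left evp_0 conv_zero)

text \<open>Transfers annihilating polynomials along the substitution
  \<open>P\<^sub>2 = s\<^sub>n + 2\<close>.\<close>

lemma evp_pcompose: "evp x (pcompose p q) = evp (evp x q) p"
proof (induction p)
  case (pCons a p)
  show ?case
    unfolding pcompose_pCons evp_add evp_mult pCons.IH evp_const by (simp only: evp_pCons)
qed (simp only: pcompose_0 evp_0)

text \<open>This passes the commutation with \<open>Lambda n\<close> from the shuffle element to the
  Eulerian idempotents.\<close>

lemma evp_commute:
  assumes "y \<star> x = x \<star> y" "y \<in> GA"
  shows "y \<star> evp x p = evp x p \<star> y"
proof (induction p)
  case (pCons a p)
  show ?case
    unfolding evp_pCons conv_add conv_scale one_conv[OF assms(2)] conv_assoc pCons.IH[symmetric]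
    unfolding conv_assoc[symmetric] assms(1) ..
qed (simp only: evp_0 conv_zero)

lemma evp_eigenvector:
  assumes "x \<star> z = qscale c z" "z \<in> GA"
  shows "evp x p \<star> z = qscale (poly p c) z"
proof (induction p)
  case (pCons a p)
  show ?case
    unfolding evp_pCons conv_add conv_scale one_conv[OF assms(2)] conv_assoc pCons.IH assms(1) poly_pCons
      qvs.scale_scale qvs.scale_left_distrib by (simp only: mult.commute)
qed (simp only: evp_0 conv_zero poly_0 qvs.scale_zero_left)

lemma nat_pow_group_algebra:
  "x [^]\<^bsub>group_algebra G\<^esub> (0 :: nat) = delta \<one>"
  "x [^]\<^bsub>group_algebra G\<^esub> Suc k = x [^]\<^bsub>group_algebra G\<^esub> k \<star> x"
  by (simp_all add: nat_pow_def) (simp add: group_algebra_def)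

lemma evp_monom:
  assumes "x \<in> GA"
  shows "evp x (monom c k) = qscale c (x [^]\<^bsub>group_algebra G\<^esub> k)"
proof (induction k)
  case 0
  show ?case unfolding monom_0 evp_const nat_pow_group_algebra ..
next
  case (Suc k)
  have "evp x (monom c (Suc k)) = x \<star> evp x (monom c k)"
    by (simp add: monom_Suc evp_pCons)
  also have "\<dots> = evp x (monom c k) \<star> x"
    by (rule evp_commute[OF refl assms])
  finally show ?case
    unfolding Suc.IH nat_pow_group_algebra conv_scale .
qed

lemma evp_eq_sum:
  assumes "x \<in> GA"
  shows "evp x p = (\<Sum>k<Suc (degree p). qscale (coeff p k) (x [^]\<^bsub>group_algebra G\<^esub> k))"
proof -
  have "evp x p = evp x (\<Sum>k\<le>degree p. monom (coeff p k) k)"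
    by (simp add: poly_as_sum_of_monoms)
  then show ?thesis
    unfolding evp_sum evp_monom[OF assms] lessThan_Suc_atMost .
qed

lemma evp_surj_sum:
  assumes "x \<in> GA"
  shows "(\<Sum>k<m. qscale (a k) (x [^]\<^bsub>group_algebra G\<^esub> k)) = evp x (\<Sum>k<m. monom (a k) k)"
  unfolding evp_sum evp_monom[OF assms] ..

text \<open>
  The \<open>L\<^sub>j\<close> are the Lagrange polynomials for the \<open>c\<^sub>j\<close>; they evaluate at \<open>x\<close> to the spectral projections.
\<close>

lemma spectral_decomposition:
  assumes x: "x \<in> GA" and J: "finite J" "inj_on c J"
    and van: "\<And>p. (\<And>j. j \<in> J \<Longrightarrow> poly p (c j) = 0) \<Longrightarrow> evp x p = 0"
  obtains L where
    "\<And>i j. i \<in> J \<Longrightarrow> j \<in> J \<Longrightarrow> evp x (L i) \<star> evp x (L j) = (if i = j then evp x (L i) else 0)"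
    "(\<Sum>j\<in>J. evp x (L j)) = delta \<one>"
    "\<And>j. j \<in> J \<Longrightarrow>
      (THE e. (\<exists>m a. e = (\<Sum>k<m. qscale (a k) (x [^]\<^bsub>group_algebra G\<^esub> (k::nat)))) \<and>
             (\<forall>y\<in>GA. e \<star> y \<in> {y \<in> GA. x \<star> y = qscale (c j) y}) \<and>
             (\<forall>y\<in>{y \<in> GA. x \<star> y = qscale (c j) y}. e \<star> y = y)) = evp x (L j)"
proof
  define L where "L j = (\<Prod>i\<in>J - {j}. smult (1 / (c j - c i)) [:- c i, 1:])" for j
  have L: "poly (L j) (c i) = (if i = j then 1 else 0)" if "i \<in> J" "j \<in> J" for i j
  proof (cases "i = j")
    case True
    have "poly (L j) (c j) = (\<Prod>i\<in>J - {j}. 1)"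
      unfolding L_def poly_prod using J(2) that
      by (intro prod.cong) (auto simp: inj_on_def diff_divide_distrib[symmetric])
    then show ?thesis using True by simp
  next
    case False
    then show ?thesis
      unfolding L_def poly_prod using that J(1) by (auto intro!: prod_zero bexI[of _ i])
  qed
  \<comment> \<open>By \<open>van\<close>, evaluation at \<open>x\<close> sees only the values of a
    polynomial at the points \<open>c j\<close>; the identities below are checked there.\<close>
  have eqI: "evp x p = evp x q" if "\<And>j. j \<in> J \<Longrightarrow> poly p (c j) = poly q (c j)" for p q
  proof -
    have "evp x (p - q) = 0" by (rule van) (simp add: that)
    then show ?thesis by (simp only: evp_diff right_minus_eq)
  qed
  show "evp x (L i) \<star> evp x (L j) = (if i = j then evp x (L i) else 0)" if "i \<in> J" "j \<in> J" for i j
  proof -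
    have "evp x (L i * L j) = evp x (if i = j then L i else 0)"
      by (rule eqI) (use L that in auto)
    then show ?thesis by (cases "i = j") (simp_all add: evp_mult)
  qed
  have "evp x (\<Sum>j\<in>J. L j) = evp x 1"
    by (rule eqI) (use L J(1) in \<open>simp add: poly_sum\<close>)
  then show "(\<Sum>j\<in>J. evp x (L j)) = delta \<one>"
    by (simp only: evp_sum evp_1)
  show "(THE e. (\<exists>m a. e = (\<Sum>k<m. qscale (a k) (x [^]\<^bsub>group_algebra G\<^esub> (k::nat)))) \<and>
             (\<forall>y\<in>GA. e \<star> y \<in> {y \<in> GA. x \<star> y = qscale (c j) y}) \<and>
             (\<forall>y\<in>{y \<in> GA. x \<star> y = qscale (c j) y}. e \<star> y = y)) = evp x (L j)"
    if j: "j \<in> J" for j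
  proof (rule the_equality)
    \<comment> \<open>\<open>[:- c j, 1:] * L j\<close> vanishes at every \<open>c i\<close>, so
      \<open>L j\<close> evaluates to a projection into the eigenspace of
      \<open>c j\<close>.\<close>
    have "evp x ([:0, 1:] * L j) = evp x (smult (c j) (L j))"
      by (rule eqI) (use L j in auto)
    moreover have "evp x [:0, 1:] = x" using x by (simp add: evp_pCons)
    ultimately have xL: "x \<star> evp x (L j) = qscale (c j) (evp x (L j))"
      by (simp only: evp_mult evp_smult)
    have mem: "evp x (L j) \<star> y \<in> {y \<in> GA. x \<star> y = qscale (c j) y}" for y
      by (simp add: conv_assoc[symmetric] xL conv_scale)
    have fixes_eigen: "evp x (L j) \<star> y = y" if "y \<in> {y \<in> GA. x \<star> y = qscale (c j) y}" for y
      using evp_eigenvector[of x y "c j" "L j"] that L[OF j j] by simp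
    show "(\<exists>m a. evp x (L j) = (\<Sum>k<m. qscale (a k) (x [^]\<^bsub>group_algebra G\<^esub> (k::nat)))) \<and>
       (\<forall>y\<in>GA. evp x (L j) \<star> y \<in> {y \<in> GA. x \<star> y = qscale (c j) y}) \<and>
       (\<forall>y\<in>{y \<in> GA. x \<star> y = qscale (c j) y}. evp x (L j) \<star> y = y)"
      using evp_eq_sum[OF x] mem fixes_eigen by blast
    fix e
    assume e: "(\<exists>m a. e = (\<Sum>k<m. qscale (a k) (x [^]\<^bsub>group_algebra G\<^esub> (k::nat)))) \<and>
       (\<forall>y\<in>GA. e \<star> y \<in> {y \<in> GA. x \<star> y = qscale (c j) y}) \<and>
       (\<forall>y\<in>{y \<in> GA. x \<star> y = qscale (c j) y}. e \<star> y = y)"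
    then obtain p where p: "e = evp x p" using evp_surj_sum[OF x] by metis
    \<comment> \<open>Applied to the unit, the description of \<open>e\<close> says that
      \<open>e\<close> is itself an eigenvector.\<close>
    have "e \<star> delta \<one> \<in> {y \<in> GA. x \<star> y = qscale (c j) y}" using e by simp
    then have "evp x (L j) \<star> e = e"
      unfolding p one_conv(2)[OF evp_closed] by (rule fixes_eigen)
    moreover have "e \<star> evp x (L j) = evp x (L j)"
      using e mem[of "delta \<one>"] unfolding one_conv(2)[OF evp_closed] by blast
    moreover have "evp x (L j) \<star> e = e \<star> evp x (L j)"
      unfolding p evp_mult[symmetric] by (simp only: mult.commute)
    ultimately show "e = evp x (L j)" by simp
  qed
qed

end

text \<open>Polynomials in the shuffle element of \<open>n - 1\<close> can thus be evaluated in
  \<open>QS n\<close>, where \<open>Lambda n\<close> lives.\<close>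

lemma (in fin_group) evp_subgroup:
  assumes K: "subgroup K G" and x: "x \<in> carrier (group_algebra (G\<lparr>carrier := K\<rparr>))"
  shows "fin_group.evp (G\<lparr>carrier := K\<rparr>) x p = evp x p"
proof -
  interpret H: fin_group "G\<lparr>carrier := K\<rparr>"
    by (intro fin_group.intro fin_group_axioms.intro subgroup_imp_group[OF K])
       (use finite_subset[OF subgroup.subset[OF K] finite_carrier] in simp)
  show ?thesis
  proof (induction p)
    case (pCons a p)
    have "H.evp x (pCons a p) = qscale a (delta \<one>) + H.conv x (H.evp x p)"
      by (simp add: H.evp_pCons)
    also have "H.conv x (H.evp x p) = x \<star> H.evp x p"
      by (rule conv_subgroup[OF K x H.evp_closed])
    finally show ?case unfolding pCons.IH evp_pCons .
  qed simp
qed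

section \<open>Stable sorting and riffle shuffles\<close>

text \<open>\<open>w\<close> lists the positions in the order in which a stable sort of the word
  \<open>f\<close> puts them; it is the inverse of the standardization of \<open>f\<close>.\<close>

definition stable_sort :: "nat \<Rightarrow> (nat \<Rightarrow> nat) \<Rightarrow> (nat \<Rightarrow> nat) \<Rightarrow> bool" where
  "stable_sort n f w \<longleftrightarrow> w permutes {1..n} \<and>
     (\<forall>i\<in>{1..n}. \<forall>j\<in>{1..n}. i < j \<longrightarrow> f (w i) < f (w j) \<or> f (w i) = f (w j) \<and> w i < w j)"

lemma permutes_strict_mono_id:
  assumes "p permutes {1..n :: nat}" "strict_mono_on {1..n} p"
  shows "p = id"
proof (rule permutes_natset_ge[OF assms(1)])
  have "i \<in> {1..n} \<Longrightarrow> i \<le> p i" for i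
  proof (induction i)
    case (Suc i)
    show ?case
    proof (cases "i = 0")
      case True
      then show ?thesis using permutes_in_image[OF assms(1), of "Suc i"] Suc.prems by auto
    next
      case False
      then have "i \<le> p i" using Suc by auto
      also have "p i < p (Suc i)"
        using assms(2) Suc.prems False by (auto simp: strict_mono_on_def)
      finally show ?thesis by simp
    qed
  qed simp
  then show "\<forall>i\<in>{1..n}. i \<le> p i" by blast
qed

lemma stable_sort_less:
  assumes "stable_sort n f w" "a \<in> {1..n}" "b \<in> {1..n}"
    and "f (w a) < f (w b) \<or> f (w a) = f (w b) \<and> w a < w b"
  shows "a < b"
proof (rule ccontr)
  assume "\<not> a < b"
  then consider "a = b" | "b < a" by linarith
  then show False
    using assms unfolding stable_sort_def by cases (auto, fastforce+)
qed

text \<open>Two sorting permutations differ by an increasing permutation of \<open>{1..n}\<close>,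
  which is the identity.\<close>

lemma stable_sort_unique:
  assumes "stable_sort n f v" "stable_sort n f w"
  shows "v = w"
proof -
  have v: "v permutes {1..n}" and w: "w permutes {1..n}"
    using assms by (auto simp: stable_sort_def)
  have p: "(inv' w \<circ> v) permutes {1..n}"
    by (rule permutes_compose[OF v permutes_inv[OF w]])
  have "strict_mono_on {1..n} (inv' w \<circ> v)"
  proof (rule strict_mono_onI)
    fix i j assume ij: "i \<in> {1..n}" "j \<in> {1..n}" "i < j"
    then have "f (v i) < f (v j) \<or> f (v i) = f (v j) \<and> v i < v j"
      using assms(1) by (auto simp: stable_sort_def)
    then show "(inv' w \<circ> v) i < (inv' w \<circ> v) j"
      using permutes_in_image[OF p] ij
      by (intro stable_sort_less[OF assms(2)]) (auto simp: permutes_inverses[OF w])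
  qed
  then have "inv' w \<circ> v = id" by (rule permutes_strict_mono_id[OF p])
  then have "w \<circ> (inv' w \<circ> v) = w" by simp
  then show ?thesis by (simp add: o_assoc permutes_inv_o[OF w])
qed

lemma stable_sort_exists: "\<exists>w. stable_sort n f w"
proof -
  \<comment> \<open>The factor \<open>Suc n\<close> exceeds every position, so keys are ordered like
    the pairs \<open>(f i, i)\<close> lexicographically.\<close>
  define key where "key i = f i * Suc n + i" for i
  have key_less: "key a < key b \<longleftrightarrow> f a < f b \<or> f a = f b \<and> a < b"
    if "a \<in> {1..n}" "b \<in> {1..n}" for a b
  proof -
    have *: "key a < key b" if "f a < f b" "a \<in> {1..n}" "b \<in> {1..n}" for a b
    proof -
      have "Suc (f a) * Suc n \<le> f b * Suc n" using that(1) by (intro mult_le_mono1) simp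
      then show ?thesis using that(2,3) by (simp add: key_def)
    qed
    show ?thesis
      using *[of a b] *[of b a] that by (cases "f a" "f b" rule: linorder_cases) (auto simp: key_def)
  qed
  have inj: "inj_on key {1..n}"
    using key_less by (intro inj_onI) (metis less_irrefl linorder_neqE_nat)
  have card: "card (key ` {1..n}) = n" using card_image[OF inj] by simp
  obtain h where h: "bij_betw h {..<n} (key ` {1..n})" "strict_mono_on {..<n} h"
    using ex_bij_betw_strict_mono_card[of "key ` {1..n}"] card by auto
  \<comment> \<open>\<open>h\<close> enumerates the keys from 0 on, hence the shift by one; outside
    \<open>{1..n}\<close> a permutation of this set is the identity.\<close>
  define w where "w i = (if i \<in> {1..n} then the_inv_into {1..n} key (h (i - 1)) else i)" for i
  have shift: "bij_betw (\<lambda>i. i - 1) {1..n} {..<n}"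
    by (rule bij_betwI[of _ _ _ Suc]) auto
  have "bij_betw (\<lambda>i. the_inv_into {1..n} key (h (i - 1))) {1..n} {1..n}"
    using bij_betw_trans[OF bij_betw_trans[OF shift h(1)]
        bij_betw_the_inv_into[OF inj_on_imp_bij_betw[OF inj]]] by (simp add: comp_def)
  then have "bij_betw w {1..n} {1..n}"
    by (rule bij_betw_cong[THEN iffD1, rotated]) (simp add: w_def)
  then have w: "w permutes {1..n}"
    by (rule bij_imp_permutes) (simp only: w_def if_False)
  have "f (w i) < f (w j) \<or> f (w i) = f (w j) \<and> w i < w j"
    if ij: "i \<in> {1..n}" "j \<in> {1..n}" "i < j" for i j
  proof -
    have "key (w k) = h (k - 1)" if "k \<in> {1..n}" for k
    proof -
      have "h (k - 1) \<in> key ` {1..n}" using h(1) that by (auto simp: bij_betw_def)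
      then show ?thesis using that f_the_inv_into_f[OF inj] by (simp add: w_def)
    qed
    moreover have "h (i - 1) < h (j - 1)"
      by (rule strict_mono_onD[OF h(2)]) (use ij in auto)
    ultimately have "key (w i) < key (w j)" using ij by simp
    then show ?thesis using key_less permutes_in_image[OF w] ij by blast
  qed
  with w show ?thesis unfolding stable_sort_def by blast
qed

definition sorting_perm :: "nat \<Rightarrow> (nat \<Rightarrow> nat) \<Rightarrow> nat \<Rightarrow> nat" where
  "sorting_perm n f = (THE w. stable_sort n f w)"

lemma stable_sort_sorting_perm: "stable_sort n f (sorting_perm n f)"
proof -
  have "\<exists>!w. stable_sort n f w"
    using stable_sort_exists stable_sort_unique by blast
  then show ?thesis unfolding sorting_perm_def by (rule theI')
qed

lemma sorting_perm_eq_iff: "sorting_perm n f = w \<longleftrightarrow> stable_sort n f w"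
  using stable_sort_sorting_perm stable_sort_unique by blast

lemma sorting_perm_permutes: "sorting_perm n f permutes {1..n}"
  using stable_sort_sorting_perm by (auto simp: stable_sort_def)

lemma sorting_perm_cong:
  assumes "\<And>i. i \<in> {1..n} \<Longrightarrow> f i = g i"
  shows "sorting_perm n f = sorting_perm n g"
  unfolding sorting_perm_eq_iff stable_sort_def
  using stable_sort_sorting_perm[of n g] permutes_in_image[OF sorting_perm_permutes[of n g]] assms
  unfolding stable_sort_def by metis

section \<open>Riffle shuffles and radix sort\<close>

abbreviation words :: "nat \<Rightarrow> nat \<Rightarrow> (nat \<Rightarrow> nat) set" where
  "words n a \<equiv> {1..n} \<rightarrow>\<^sub>E {..<a}"

text \<open>The element \<open>P\<^sub>a\<close> of the overview. A word deals the numbers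
  \<open>1, ..., n\<close> onto \<open>a\<close> piles, and its sorting permutation lists the piles
  one after the other, each in increasing order. Summing over words takes care of the
  multiplicities.\<close>

definition riffle :: "nat \<Rightarrow> nat \<Rightarrow> (nat \<Rightarrow> nat) \<Rightarrow> rat" where
  "riffle n a = (\<Sum>f\<in>words n a. qscale (of_int (sign (sorting_perm n f))) (delta (sorting_perm n f)))"

interpretation S: fin_group "sym_group n" for n
  by (intro fin_group.intro fin_group_axioms.intro sym_group_is_group)
     (simp add: sym_group_def finite_permutations)

text \<open>\<open>f\<close> is the low digit in base \<open>a\<close>, and \<open>g\<close> is the
  high digit, read along the list already sorted by \<open>f\<close>. The second sort is stable, so
  it keeps the order of the first one among equal high digits.\<close>

lemma radix_sort:
  assumes "f \<in> words n a"
  shows "sorting_perm n (\<lambda>x. g (inv' (sorting_perm n f) x) * a + f x) =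
    sorting_perm n f \<circ> sorting_perm n g"
  unfolding sorting_perm_eq_iff stable_sort_def
proof (intro conjI ballI impI)
  let ?w = "sorting_perm n f" and ?v = "sorting_perm n g"
  note w = sorting_perm_permutes[of n f] and v = sorting_perm_permutes[of n g]
  show "(?w \<circ> ?v) permutes {1..n}" by (rule permutes_compose[OF v w])
  fix i j assume ij: "i \<in> {1..n}" "j \<in> {1..n}" "i < j"
  have v_in: "?v i \<in> {1..n}" "?v j \<in> {1..n}"
    using ij permutes_in_image[OF v] by auto
  then have w_in: "?w (?v i) \<in> {1..n}" "?w (?v j) \<in> {1..n}"
    using permutes_in_image[OF w] by auto
  have f_less: "f (?w (?v i)) < a"
    using assms w_in by (auto simp: PiE_iff)
  have "g (?v i) < g (?v j) \<or> g (?v i) = g (?v j) \<and> ?v i < ?v j"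
    using stable_sort_sorting_perm[of n g] ij by (auto simp: stable_sort_def)
  then show "g (inv' ?w ((?w \<circ> ?v) i)) * a + f ((?w \<circ> ?v) i) < g (inv' ?w ((?w \<circ> ?v) j)) * a + f ((?w \<circ> ?v) j)
    \<or> g (inv' ?w ((?w \<circ> ?v) i)) * a + f ((?w \<circ> ?v) i) = g (inv' ?w ((?w \<circ> ?v) j)) * a + f ((?w \<circ> ?v) j)
      \<and> (?w \<circ> ?v) i < (?w \<circ> ?v) j"
  proof
    assume "g (?v i) < g (?v j)"
    then have "Suc (g (?v i)) * a \<le> g (?v j) * a" by (intro mult_le_mono1) simp
    then show ?thesis using f_less by (simp add: permutes_inverses[OF w])
  next
    assume "g (?v i) = g (?v j) \<and> ?v i < ?v j"
    then show ?thesis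
      using stable_sort_sorting_perm[of n f] v_in by (auto simp: stable_sort_def permutes_inverses[OF w])
  qed
qed

lemma sign_sorting_perm_comp:
  "sign (sorting_perm n f \<circ> sorting_perm n g) = sign (sorting_perm n f) * sign (sorting_perm n g)"
  by (rule sign_compose;
      rule permutes_imp_permutation[OF finite_atLeastAtMost sorting_perm_permutes])

text \<open>Splitting letters below \<open>a * b\<close> into two digits in base \<open>a\<close> is
  a bijection between words and pairs of words; by \<open>radix_sort\<close> the combined word sorts
  to the composite of the two sorting permutations.\<close>

lemma riffle_mult:
  assumes "a > 0"
  shows "riffle n a \<otimes>\<^bsub>QS n\<^esub> riffle n b = riffle n (a * b)"
proof -
  let ?W = "words n"
  let ?F = "\<lambda>w. qscale (of_int (sign w)) (delta w) :: (nat \<Rightarrow> nat) \<Rightarrow> rat"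
  let ?s = "sorting_perm n"
  \<comment> \<open>The high digit at position \<open>x\<close> is taken from \<open>g\<close> at
    the rank of \<open>x\<close> in the order sorted by \<open>f\<close>; \<open>hi\<close> reads it
    off in that same order.\<close>
  define comb where
    "comb f g = (\<lambda>x\<in>{1..n}. g (inv' (?s f) x) * a + f x)" for f g :: "nat \<Rightarrow> nat"
  define lo where "lo h = (\<lambda>x\<in>{1..n}. h x mod a)" for h :: "nat \<Rightarrow> nat"
  define hi where "hi h = (\<lambda>x\<in>{1..n}. h (?s (lo h) x) div a)" for h :: "nat \<Rightarrow> nat"
  have "riffle n a \<otimes>\<^bsub>QS n\<^esub> riffle n b = (\<Sum>f\<in>?W a. \<Sum>g\<in>?W b. ?F (?s f \<circ> ?s g))"
    unfolding riffle_def S.conv_sum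
  proof (subst sum.swap, intro sum.cong refl)
    fix f g
    have "?s f \<in> carrier (sym_group n)" "?s g \<in> carrier (sym_group n)"
      unfolding sym_group_carrier by (rule sorting_perm_permutes)+
    from S.delta_conv_delta[OF this]
    show "?F (?s f) \<otimes>\<^bsub>QS n\<^esub> ?F (?s g) = ?F (?s f \<circ> ?s g)"
      unfolding S.conv_scale qvs.scale_scale sign_sorting_perm_comp of_int_mult
      by (simp add: sym_group_def mult.commute)
  qed
  also have "\<dots> = (\<Sum>(f, g)\<in>?W a \<times> ?W b. ?F (?s f \<circ> ?s g))"
    by (rule sum.cartesian_product)
  also have "\<dots> = (\<Sum>h\<in>?W (a * b). ?F (?s h))"
  proof (rule sum.reindex_bij_witness[of _ "\<lambda>h. (lo h, hi h)" "\<lambda>(f, g). comb f g"], goal_cases)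
    case (1 p)
    then obtain f g where p: "p = (f, g)" "f \<in> ?W a" "g \<in> ?W b" by auto
    note w = sorting_perm_permutes[of n f]
    have lo: "lo (comb f g) = f"
      using p(2) by (auto simp: lo_def comb_def fun_eq_iff PiE_iff extensional_def)
    have "hi (comb f g) x = g x" for x
    proof (cases "x \<in> {1..n}")
      case True
      then have "?s f x \<in> {1..n}" using permutes_in_image[OF w] by blast
      moreover have "f (?s f x) < a" using p(2) calculation by (auto simp: PiE_iff)
      ultimately show ?thesis
        using True unfolding hi_def lo by (simp add: comb_def permutes_inverses[OF w])
    next
      case False
      then show ?thesis using p(3) by (auto simp: hi_def PiE_iff extensional_def)
    qed
    then show ?case using p(1) lo by (auto simp: fun_eq_iff)
  next
    case (2 p)
    then obtain f g where p: "p = (f, g)" "f \<in> ?W a" "g \<in> ?W b" by auto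
    note w = permutes_inv[OF sorting_perm_permutes[of n f]]
    have "g (inv' (?s f) x) * a + f x < a * b" if "x \<in> {1..n}" for x
    proof -
      have "inv' (?s f) x \<in> {1..n}" using permutes_in_image[OF w] that by blast
      then have "Suc (g (inv' (?s f) x)) * a \<le> b * a"
        using p(3) by (intro mult_le_mono1) (auto simp: PiE_iff Suc_le_eq)
      moreover have "f x < a" using p(2) that by (auto simp: PiE_iff)
      ultimately show ?thesis by (simp add: mult.commute)
    qed
    then show ?case using p(1) by (auto simp: comb_def)
  next
    case (3 h)
    note w = sorting_perm_permutes[of n "lo h"]
    have "comb (lo h) (hi h) x = h x" for x
    proof (cases "x \<in> {1..n}")
      case True
      then have "inv' (?s (lo h)) x \<in> {1..n}" using permutes_in_image[OF permutes_inv[OF w]] by blast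
      then show ?thesis
        using True by (simp add: comb_def hi_def permutes_inverses[OF w]) (simp add: lo_def)
    next
      case False
      then show ?thesis using 3 by (auto simp: comb_def PiE_iff extensional_def)
    qed
    then show ?case by (simp add: fun_eq_iff)
  next
    case (4 h)
    note w = sorting_perm_permutes[of n "lo h"]
    have "h (?s (lo h) x) div a < b" if "x \<in> {1..n}" for x
    proof -
      have "?s (lo h) x \<in> {1..n}" using permutes_in_image[OF w] that by blast
      then have "h (?s (lo h) x) < a * b" using 4 by (auto simp: PiE_iff)
      then show ?thesis by (simp add: less_mult_imp_div_less mult.commute)
    qed
    then show ?case using assms by (auto simp: lo_def hi_def)
  next
    case (5 p)
    then obtain f g where p: "p = (f, g)" "f \<in> ?W a" "g \<in> ?W b" by auto
    have "?s (comb f g) = ?s f \<circ> ?s g"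
      using radix_sort[OF p(2), of g] by (subst sorting_perm_cong) (auto simp: comb_def)
    then show ?case using p(1) by simp
  qed
  finally show ?thesis unfolding riffle_def .
qed

lemma riffle_one: "riffle n 1 = delta id"
proof -
  have "words n 1 = {\<lambda>x\<in>{1..n}. 0}"
    by (auto simp: PiE_iff fun_eq_iff extensional_def lessThan_Suc)
  moreover have "sorting_perm n (\<lambda>x\<in>{1..n}. 0) = id"
    by (auto simp: sorting_perm_eq_iff stable_sort_def)
  ultimately show ?thesis by (simp add: riffle_def)
qed

section \<open>Coefficients of riffle shuffles as polynomials in the number of letters\<close>

lemma binomial_polynomial:
  "\<exists>q :: rat poly. degree q \<le> k \<and> (k > 0 \<longrightarrow> coeff q 0 = 0) \<and>
     (\<forall>a. of_nat (a choose k) = poly q (of_nat a))"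
proof -
  define p :: "rat poly" where "p = (\<Prod>i<k. [:- of_nat i, 1:])"
  define q :: "rat poly" where "q = smult (1 / fact k) p"
  have "degree p \<le> sum (degree \<circ> (\<lambda>i. [:- of_nat i, 1 :: rat:])) {..<k}"
    unfolding p_def by (rule degree_prod_sum_le) simp
  then have "degree q \<le> k" by (simp add: q_def comp_def)
  \<comment> \<open>The factor of \<open>p\<close> for \<open>i = 0\<close> is the variable
    itself.\<close>
  moreover have "coeff q 0 = 0" if "k > 0"
    using that by (auto simp: q_def p_def poly_0_coeff_0[symmetric] poly_prod)
  moreover have "of_nat (a choose k) = poly q (of_nat a)" for a
    by (simp add: q_def p_def poly_prod binomial_gbinomial gbinomial_prod_rev lessThan_atLeast0)
  ultimately show ?thesis by blast
qed

lemma stable_sort_strict_mono: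
  assumes "stable_sort n f w" "f ` {1..n} \<subseteq> A" "strict_mono_on A e"
  shows "stable_sort n (\<lambda>x\<in>{1..n}. e (f x)) w"
  unfolding stable_sort_def
proof (intro conjI ballI impI)
  show w: "w permutes {1..n}" using assms(1) by (simp add: stable_sort_def)
  fix i j assume ij: "i \<in> {1..n}" "j \<in> {1..n}" "i < j"
  then have in_n: "w i \<in> {1..n}" "w j \<in> {1..n}" using permutes_in_image[OF w] by auto
  then have "f (w i) \<in> A" "f (w j) \<in> A" using assms(2) by auto
  moreover have "f (w i) < f (w j) \<or> f (w i) = f (w j) \<and> w i < w j"
    using assms(1) ij by (auto simp: stable_sort_def)
  ultimately show "(\<lambda>x\<in>{1..n}. e (f x)) (w i) < (\<lambda>x\<in>{1..n}. e (f x)) (w j) \<or>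
    (\<lambda>x\<in>{1..n}. e (f x)) (w i) = (\<lambda>x\<in>{1..n}. e (f x)) (w j) \<and> w i < w j"
    using in_n strict_mono_onD[OF assms(3)] by auto
qed

text \<open>Relabelling the letters by the increasing enumeration of \<open>A\<close> does not
  change the sorting permutation, so the count depends on the size of \<open>A\<close>
  alone.\<close>

lemma card_sorted_words_image:
  assumes "finite (A :: nat set)"
  shows "card {f \<in> {1..n} \<rightarrow>\<^sub>E A. f ` {1..n} = A \<and> sorting_perm n f = w} =
    card {f \<in> words n (card A). f ` {1..n} = {..<card A} \<and> sorting_perm n f = w}"
    (is "card ?T = card ?T'")
proof -
  obtain e where e: "bij_betw e {..<card A} A" "strict_mono_on {..<card A} e"
    using ex_bij_betw_strict_mono_card[OF assms] by blast
  define d where "d = the_inv_into {..<card A} e"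
  have inj: "inj_on e {..<card A}" and im: "e ` {..<card A} = A"
    using e(1) by (auto simp: bij_betw_def)
  have de: "d (e x) = x" if "x < card A" for x
    using that by (simp add: d_def the_inv_into_f_f[OF inj])
  have ed: "e (d y) = y" and d_in: "d y < card A" if "y \<in> A" for y
    using that im f_the_inv_into_f[OF inj, of y] the_inv_into_into[OF inj, of y "{..<card A}"]
    by (auto simp: d_def)
  have d_mono: "strict_mono_on A d"
  proof (rule strict_mono_onI)
    fix x y assume xy: "x \<in> A" "y \<in> A" "x < y"
    show "d x < d y"
    proof (rule ccontr)
      assume "\<not> d x < d y"
      then have "d y = d x \<or> d y < d x" by linarith
      then have "e (d y) \<le> e (d x)"
        using strict_mono_onD[OF e(2), of "d y" "d x"] d_in xy by auto
      then show False using ed xy by simp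
    qed
  qed
  have "bij_betw (\<lambda>f. \<lambda>x\<in>{1..n}. e (f x)) ?T' ?T"
  proof (rule bij_betw_byWitness[where f' = "\<lambda>f. \<lambda>x\<in>{1..n}. d (f x)"])
    show "\<forall>f\<in>?T'. (\<lambda>x\<in>{1..n}. d ((\<lambda>x\<in>{1..n}. e (f x)) x)) = f"
      using de by (auto simp: fun_eq_iff PiE_iff extensional_def)
    show "\<forall>f\<in>?T. (\<lambda>x\<in>{1..n}. e ((\<lambda>x\<in>{1..n}. d (f x)) x)) = f"
      using ed by (auto simp: fun_eq_iff PiE_iff extensional_def)
    show "(\<lambda>f. \<lambda>x\<in>{1..n}. e (f x)) ` ?T' \<subseteq> ?T"
    proof (intro image_subsetI CollectI conjI)
      fix f assume f: "f \<in> ?T'"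
      have "(\<lambda>x\<in>{1..n}. e (f x)) ` {1..n} = e ` f ` {1..n}"
        unfolding image_restrict_eq image_image ..
      also have "f ` {1..n} = {..<card A}" using f by blast
      finally show "(\<lambda>x\<in>{1..n}. e (f x)) ` {1..n} = A" unfolding im .
      then show "(\<lambda>x\<in>{1..n}. e (f x)) \<in> {1..n} \<rightarrow>\<^sub>E A"
        unfolding restrict_PiE_iff image_restrict_eq by blast
      show "sorting_perm n (\<lambda>x\<in>{1..n}. e (f x)) = w"
        using f e(2) stable_sort_strict_mono[of n f w "{..<card A}" e] by (simp add: sorting_perm_eq_iff)
    qed
    show "(\<lambda>f. \<lambda>x\<in>{1..n}. d (f x)) ` ?T \<subseteq> ?T'"
    proof (intro image_subsetI CollectI conjI)
      fix f assume f: "f \<in> ?T"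
      have "d ` A = {..<card A}"
        using the_inv_into_onto[OF inj] unfolding d_def im .
      moreover have "(\<lambda>x\<in>{1..n}. d (f x)) ` {1..n} = d ` f ` {1..n}"
        unfolding image_restrict_eq image_image ..
      moreover have "f ` {1..n} = A" using f by blast
      ultimately show *: "(\<lambda>x\<in>{1..n}. d (f x)) ` {1..n} = {..<card A}" by simp
      show "(\<lambda>x\<in>{1..n}. d (f x)) \<in> words n (card A)"
        using * unfolding restrict_PiE_iff image_restrict_eq by blast
      show "sorting_perm n (\<lambda>x\<in>{1..n}. d (f x)) = w"
        using f d_mono stable_sort_strict_mono[of n f w A d] by (simp add: sorting_perm_eq_iff)
    qed
  qed
  from bij_betw_same_card[OF this] show ?thesis by (rule sym)
qed

text \<open>
  Grouping the words by their set of letters expresses the count as a combination of the binomial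
  coefficients of \<open>a\<close> over \<open>1, \<dots>, n\<close>.
\<close>

lemma card_sorted_words_polynomial:
  assumes "n > 0"
  shows "\<exists>q :: rat poly. degree q \<le> n \<and> coeff q 0 = 0 \<and>
    (\<forall>a. of_nat (card {f \<in> words n a. sorting_perm n f = w}) = poly q (of_nat a))"
proof -
  define T where "T A = {f \<in> {1..n} \<rightarrow>\<^sub>E A. f ` {1..n} = A \<and> sorting_perm n f = w}" for A
  define t where "t k = card (T {..<k})" for k
  have t: "card (T A) = t (card A)" if "finite A" for A
    using card_sorted_words_image[OF that] by (simp add: T_def t_def)
  \<comment> \<open>A word of positive length uses at least one and at most \<open>n\<close>
    letters. The first bound removes the constant term of the polynomial, the second limits its
    degree.\<close>
  have t0: "t k = 0" if "k = 0 \<or> k > n" for k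
  proof -
    have "T {..<k} = {}"
    proof (rule ccontr)
      assume "T {..<k} \<noteq> {}"
      then obtain f where f: "f ` {1..n} = {..<k}" by (auto simp: T_def)
      have "card (f ` {1..n}) \<le> card {1..n}" by (rule card_image_le) simp
      then have "k \<le> n" using f by simp
      moreover have "{1..n} \<noteq> {}" using assms by simp
      then have "{..<k} \<noteq> {}" using f by auto
      ultimately show False using that by auto
    qed
    then show ?thesis by (simp add: t_def)
  qed
  have count: "card {f \<in> words n a. sorting_perm n f = w} = (\<Sum>k\<in>{1..n}. (a choose k) * t k)" for a
  proof -
    have "{f \<in> words n a. sorting_perm n f = w} = (\<Union>A\<in>Pow {..<a}. T A)"
    proof (intro equalityI subsetI)
      fix f assume f: "f \<in> {f \<in> words n a. sorting_perm n f = w}"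
      then have "f ` {1..n} \<in> Pow {..<a}" "f \<in> T (f ` {1..n})"
        by (auto simp: T_def PiE_iff)
      then show "f \<in> (\<Union>A\<in>Pow {..<a}. T A)" by (rule UN_I)
    next
      fix f assume "f \<in> (\<Union>A\<in>Pow {..<a}. T A)"
      then obtain A where "A \<subseteq> {..<a}" "f \<in> T A" by blast
      then show "f \<in> {f \<in> words n a. sorting_perm n f = w}"
        by (auto simp: T_def PiE_iff)
    qed
    moreover have "card (\<Union>A\<in>Pow {..<a}. T A) = (\<Sum>A\<in>Pow {..<a}. card (T A))"
    proof (rule card_UN_disjoint)
      show "\<forall>A\<in>Pow {..<a}. finite (T A)"
      proof
        fix A assume "A \<in> Pow {..<a}"
        then have "finite A" using finite_subset[OF _ finite_lessThan] by blast
        then have "finite ({1..n} \<rightarrow>\<^sub>E A)" by (intro finite_PiE) auto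
        then show "finite (T A)" by (simp add: T_def)
      qed
    qed (auto simp: T_def)
    moreover have "(\<Sum>A\<in>Pow {..<a}. card (T A)) = (\<Sum>A\<in>Pow {..<a}. t (card A))"
      by (intro sum.cong refl t) (use finite_subset[OF _ finite_lessThan] in blast)
    ultimately have "card {f \<in> words n a. sorting_perm n f = w} = (\<Sum>A\<in>Pow {..<a}. t (card A))"
      by simp
    also have "\<dots> = (\<Sum>k\<in>{..a}. \<Sum>A\<in>{A \<in> Pow {..<a}. card A = k}. t (card A))"
    proof (rule sum.group[symmetric])
      show "card ` Pow {..<a} \<subseteq> {..a}"
        using card_mono[OF finite_lessThan[of a]] by auto
    qed auto
    also have "\<dots> = (\<Sum>k\<in>{..a}. (a choose k) * t k)"
    proof (intro sum.cong refl)
      fix k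
      have "(\<Sum>A\<in>{A \<in> Pow {..<a}. card A = k}. t (card A)) = card {A. A \<subseteq> {..<a} \<and> card A = k} * t k"
        by (simp add: Pow_def)
      then show "(\<Sum>A\<in>{A \<in> Pow {..<a}. card A = k}. t (card A)) = (a choose k) * t k"
        by (simp add: n_subsets)
    qed
    \<comment> \<open>The range is enlarged so that it contains \<open>{1..n}\<close> whatever
      \<open>a\<close> is; the added terms vanish because \<open>a choose k\<close> is zero for
      \<open>k > a\<close>.\<close>
    also have "\<dots> = (\<Sum>k\<in>{..a + n}. (a choose k) * t k)"
      by (rule sum.mono_neutral_left) auto
    also have "\<dots> = (\<Sum>k\<in>{1..n}. (a choose k) * t k)"
    proof (rule sum.mono_neutral_right)
      show "\<forall>k\<in>{..a + n} - {1..n}. (a choose k) * t k = 0"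
      proof
        fix k assume "k \<in> {..a + n} - {1..n}"
        then have "k = 0 \<or> k > n" by auto
        then show "(a choose k) * t k = 0" using t0 by simp
      qed
    qed auto
    finally show ?thesis .
  qed
  obtain b :: "nat \<Rightarrow> rat poly" where b: "\<And>k. degree (b k) \<le> k" "\<And>k. k > 0 \<Longrightarrow> coeff (b k) 0 = 0"
    "\<And>k a. of_nat (a choose k) = poly (b k) (of_nat a)"
    using binomial_polynomial by metis
  define q where "q = (\<Sum>k\<in>{1..n}. smult (of_nat (t k)) (b k))"
  have "degree q \<le> n"
    unfolding q_def
  proof (rule degree_sum_le)
    fix k assume "k \<in> {1..n}"
    then show "degree (smult (of_nat (t k)) (b k)) \<le> n"
      using b(1)[of k] degree_smult_le[of "of_nat (t k)" "b k"] by simp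
  qed simp
  moreover have "coeff q 0 = 0"
    by (simp add: q_def coeff_sum b(2))
  moreover have "of_nat (card {f \<in> words n a. sorting_perm n f = w}) = poly q (of_nat a)" for a
    unfolding count by (simp add: q_def poly_sum b(3) mult.commute)
  ultimately show ?thesis by blast
qed

lemma riffle_apply:
  "riffle n a w = of_int (sign w) * of_nat (card {f \<in> words n a. sorting_perm n f = w})"
proof -
  have fin: "finite (words n a)" by (simp add: finite_PiE)
  have "riffle n a w = (\<Sum>f\<in>words n a. if sorting_perm n f = w then of_int (sign w) else 0)"
    unfolding riffle_def sum_fun_apply by (intro sum.cong) (auto simp: qscale_def delta_def)
  also have "\<dots> = (\<Sum>f\<in>{f \<in> words n a. sorting_perm n f = w}. of_int (sign w))"
    by (rule sum.inter_filter[OF fin, symmetric])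
  finally show ?thesis by simp
qed

lemma riffle_closed: "riffle n a \<in> carrier (QS n)"
  unfolding S.GA_iff
proof (intro allI impI)
  fix w assume "w \<notin> carrier (sym_group n)"
  then have "{f \<in> words n a. sorting_perm n f = w} = {}"
    using sorting_perm_permutes[of n] by (auto simp: sym_group_carrier)
  then show "riffle n a w = 0"
    by (simp only: riffle_apply card.empty of_nat_0 mult_zero_right)
qed

lemma riffle_power: "riffle n 2 [^]\<^bsub>QS n\<^esub> k = riffle n (2 ^ k)"
proof (induction k)
  case 0
  show ?case
    unfolding S.nat_pow_group_algebra power_0 riffle_one sym_group_one ..
next
  case (Suc k)
  show ?case
    unfolding S.nat_pow_group_algebra Suc.IH power_Suc2 by (rule riffle_mult) simp
qed

text \<open>The powers of \<open>P\<^sub>2\<close> are the riffles with \<open>2 ^ k\<close>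
  letters, so the coefficient of \<open>w\<close> in \<open>p\<close> at \<open>P\<^sub>2\<close>
  is, up to the sign, the sum over \<open>k\<close> of \<open>coeff p k * poly q (2 ^ k)\<close>.
  Exchanging the sums turns it into the sum over \<open>j\<close> of
  \<open>coeff q j * poly p (2 ^ j)\<close>. Only \<open>j\<close> in \<open>{1..n}\<close> occur,
  since \<open>q\<close> has degree at most \<open>n\<close> and no constant term.\<close>

lemma evp_riffle_eq_0:
  assumes "n > 0" "\<And>j. j \<in> {1..n} \<Longrightarrow> poly p (2 ^ j) = 0"
  shows "S.evp n (riffle n 2) p = 0"
proof
  fix w
  obtain q :: "rat poly" where q: "degree q \<le> n" "coeff q 0 = 0"
    "\<And>a. of_nat (card {f \<in> words n a. sorting_perm n f = w}) = poly q (of_nat a)"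
    using card_sorted_words_polynomial[OF assms(1)] by metis
  have poly_q: "poly q x = (\<Sum>j\<in>{1..n}. coeff q j * x ^ j)" for x
  proof -
    have "poly q x = (\<Sum>j\<le>n. coeff q j * x ^ j)"
      unfolding poly_altdef using q(1) by (intro sum.mono_neutral_left) (auto simp: coeff_eq_0)
    also have "\<dots> = (\<Sum>j\<in>{1..n}. coeff q j * x ^ j)"
    proof (rule sum.mono_neutral_right)
      show "\<forall>j\<in>{..n} - {1..n}. coeff q j * x ^ j = 0"
      proof
        fix j assume "j \<in> {..n} - {1..n}"
        then have "j = 0" by auto
        then show "coeff q j * x ^ j = 0" using q(2) by simp
      qed
    qed auto
    finally show ?thesis .
  qed
  have "S.evp n (riffle n 2) p w = (\<Sum>k\<le>degree p. coeff p k * (of_int (sign w) * poly q (2 ^ k)))"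
    unfolding S.evp_eq_sum[OF riffle_closed] riffle_power sum_fun_apply lessThan_Suc_atMost
    unfolding qscale_def riffle_apply q(3) by simp
  also have "\<dots> = (\<Sum>k\<le>degree p. \<Sum>j\<in>{1..n}. of_int (sign w) * coeff q j * (coeff p k * (2 ^ j) ^ k))"
    unfolding poly_q sum_distrib_left
    by (intro sum.cong refl) (simp add: power_mult[symmetric] mult_ac)
  also have "\<dots> = (\<Sum>j\<in>{1..n}. of_int (sign w) * coeff q j * poly p (2 ^ j))"
    by (subst sum.swap) (simp add: poly_altdef sum_distrib_left)
  also have "\<dots> = 0" using assms(2) by simp
  finally show "S.evp n (riffle n 2) p w = 0 w" by simp
qed

section \<open>The shuffle element as a riffle of two piles\<close>

definition increasing_blocks :: "nat \<Rightarrow> nat \<Rightarrow> (nat \<Rightarrow> nat) \<Rightarrow> bool" where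
  "increasing_blocks n i w \<longleftrightarrow> strict_mono_on {1..i} w \<and> strict_mono_on {i + 1..n} w"

lemma shuffle_element_apply:
  "shuffle_element n w = (if w permutes {1..n}
     then of_int (sign w) * of_nat (card {i \<in> {1..n-1}. increasing_blocks n i w}) else 0)"
proof -
  have fin: "finite {w. w permutes {1..n} \<and> increasing_blocks n i w}" for i
    using finite_permutations[of "{1..n}"] by (simp add: finite_subset[rotated] Collect_mono)
  have "signed_shuffle n i w =
      (if w permutes {1..n} \<and> increasing_blocks n i w then of_int (sign w) else 0)" for i
  proof -
    have "signed_shuffle n i w = (\<Sum>v\<in>{w. w permutes {1..n} \<and> increasing_blocks n i w}.
        if v = w then of_int (sign w) else 0)"
      unfolding signed_shuffle_def sum_fun_apply increasing_blocks_def
      by (intro sum.cong) (auto simp: qscale_def delta_def)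
    then show ?thesis using fin by simp
  qed
  then have "shuffle_element n w = (\<Sum>i\<in>{1..n-1}.
      if w permutes {1..n} \<and> increasing_blocks n i w then of_int (sign w) else 0)"
    by (simp add: shuffle_element_def sum_fun_apply)
  also have "\<dots> = (if w permutes {1..n}
     then (\<Sum>i\<in>{i \<in> {1..n-1}. increasing_blocks n i w}. of_int (sign w)) else 0)"
  proof (cases "w permutes {1..n}")
    case True
    then show ?thesis
      by (simp only: simp_thms if_True) (rule sum.inter_filter[OF finite_atLeastAtMost, symmetric])
  next
    case False
    then show ?thesis by (simp only: simp_thms if_False sum.neutral_const)
  qed
  finally show ?thesis by (simp add: mult.commute)
qed

text \<open>A word in the letters 0 and 1 that sorts to \<open>w\<close> is determined by its number
  \<open>i\<close> of zeros, which sit at the positions \<open>w 1, ..., w i\<close>. That word does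
  sort to \<open>w\<close> exactly if \<open>w\<close> increases on both blocks;
  \<open>i = 0\<close> and \<open>i = n\<close> belong to the constant words.\<close>

lemma card_sorted_binary_words:
  assumes w: "w permutes {1..n}"
  shows "card {f \<in> words n 2. sorting_perm n f = w} = card {i \<in> {0..n}. increasing_blocks n i w}"
proof -
  define F where "F i = (\<lambda>x\<in>{1..n}. if inv' w x \<le> i then 0 else 1 :: nat)" for i
  have F: "F i (w k) = (if k \<le> i then 0 else 1)" if "k \<in> {1..n}" for i k
    using that permutes_in_image[OF w] by (simp add: F_def permutes_inverses[OF w])
  have "bij_betw F {i \<in> {0..n}. increasing_blocks n i w} {f \<in> words n 2. sorting_perm n f = w}"
    unfolding bij_betw_def
  proof (intro conjI equalityI subsetI)
    show "inj_on F {i \<in> {0..n}. increasing_blocks n i w}"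
    proof (rule linorder_inj_onI)
      fix i j assume ij: "i < j" "i \<in> {i \<in> {0..n}. increasing_blocks n i w}"
        "j \<in> {i \<in> {0..n}. increasing_blocks n i w}"
      then have "F i (w j) \<noteq> F j (w j)" by (subst (1 2) F) auto
      then show "F i \<noteq> F j" by auto
    qed auto
  next
    fix f assume "f \<in> F ` {i \<in> {0..n}. increasing_blocks n i w}"
    then obtain i where i: "f = F i" "increasing_blocks n i w" by auto
    have "stable_sort n f w"
      unfolding stable_sort_def
    proof (intro conjI ballI impI w)
      fix a b assume ab: "a \<in> {1..n}" "b \<in> {1..n}" "a < b"
      consider "b \<le> i" | "a \<le> i" "i < b" | "i < a" by linarith
      then show "f (w a) < f (w b) \<or> f (w a) = f (w b) \<and> w a < w b"
      proof cases
        case 1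
        then have "w a < w b"
          using i(2) ab by (intro strict_mono_onD[of "{1..i}" w]) (auto simp: increasing_blocks_def)
        then show ?thesis using 1 ab by (simp add: i(1) F)
      next
        case 2
        then show ?thesis using ab by (simp add: i(1) F)
      next
        case 3
        then have "w a < w b"
          using i(2) ab by (intro strict_mono_onD[of "{i + 1..n}" w]) (auto simp: increasing_blocks_def)
        then show ?thesis using 3 ab by (simp add: i(1) F)
      qed
    qed
    then show "f \<in> {f \<in> words n 2. sorting_perm n f = w}"
      by (auto simp: sorting_perm_eq_iff i(1) F_def)
  next
    fix f assume "f \<in> {f \<in> words n 2. sorting_perm n f = w}"
    then have f: "f \<in> words n 2" and sort: "stable_sort n f w" by (auto simp: sorting_perm_eq_iff)
    define D where "D = {k \<in> {1..n}. f (w k) = 0}"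
    \<comment> \<open>The number of zeros of \<open>f\<close>; the inserted 0 covers words without
      the letter 0.\<close>
    define i where "i = Max (insert 0 D)"
    have fin: "finite (insert 0 D)" by (simp add: D_def)
    have i_in: "i \<in> insert 0 D" unfolding i_def by (rule Max_in[OF fin]) simp
    have le: "f (w a) < f (w b) \<or> f (w a) = f (w b) \<and> w a < w b"
      if "a \<in> {1..n}" "b \<in> {1..n}" "a < b" for a b
      using sort that by (auto simp: stable_sort_def)
    have D: "f (w k) = 0 \<longleftrightarrow> k \<le> i" if k: "k \<in> {1..n}" for k
    proof
      assume "f (w k) = 0"
      then have "k \<in> insert 0 D" using k by (simp add: D_def)
      then show "k \<le> i" unfolding i_def by (rule Max_ge[OF fin])
    next
      assume "k \<le> i"
      then have "i \<in> D" using i_in k by auto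
      then show "f (w k) = 0"
        using le[of k i] k \<open>k \<le> i\<close> by (cases "k = i") (auto simp: D_def)
    qed
    have one: "f (w k) = 1" if "k \<in> {1..n}" "k > i" for k
    proof -
      have "w k \<in> {1..n}" using that permutes_in_image[OF w] by blast
      then have "f (w k) < 2" using f by (auto simp: PiE_iff)
      then show ?thesis using D[OF that(1)] that(2) by linarith
    qed
    have i_le: "i \<le> n" using i_in by (auto simp: D_def)
    have "increasing_blocks n i w"
      unfolding increasing_blocks_def
    proof (intro conjI strict_mono_onI)
      fix a b assume "a \<in> {1..i}" "b \<in> {1..i}" "a < b"
      then show "w a < w b" using le[of a b] D[of a] D[of b] i_le by auto
    next
      fix a b assume "a \<in> {i + 1..n}" "b \<in> {i + 1..n}" "a < b"
      then show "w a < w b" using le[of a b] one[of a] one[of b] by auto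
    qed
    moreover have "f x = F i x" for x
    proof (cases "x \<in> {1..n}")
      case True
      then have k: "inv' w x \<in> {1..n}" using permutes_in_image[OF permutes_inv[OF w]] by blast
      have "f (w (inv' w x)) = F i (w (inv' w x))"
        unfolding F[OF k] using D[OF k] one[OF k] by auto
      then show ?thesis by (simp add: permutes_inverses[OF w])
    next
      case False
      then show ?thesis using f by (auto simp: F_def PiE_iff extensional_def)
    qed
    ultimately show "f \<in> F ` {i \<in> {0..n}. increasing_blocks n i w}"
      using i_le by (intro image_eqI[of _ _ i]) auto
  qed
  from bij_betw_same_card[OF this] show ?thesis by (rule sym)
qed

lemma strict_mono_permutes_iff:
  assumes "w permutes {1..n :: nat}"
  shows "strict_mono_on {1..n} w \<longleftrightarrow> w = id"
  using permutes_strict_mono_id[OF assms] by (auto simp: strict_mono_on_def)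

text \<open>The block sizes \<open>0\<close> and \<open>n\<close>, absent from the shuffle element,
  both force \<open>w = id\<close>. They account for the summand \<open>2 id\<close> and thereby for
  the \<open>- 2\<close> in the eigenvalues.\<close>

lemma shuffle_element_riffle:
  assumes "n > 0"
  shows "riffle n 2 = shuffle_element n + qscale 2 (delta id)"
proof
  fix w
  show "riffle n 2 w = (shuffle_element n + qscale 2 (delta id)) w"
  proof (cases "w permutes {1..n}")
    case True
    let ?I = "\<lambda>i. increasing_blocks n i w"
    have I: "?I 0 \<longleftrightarrow> w = id" "?I n \<longleftrightarrow> w = id"
      using strict_mono_permutes_iff[OF True] by (auto simp: increasing_blocks_def strict_mono_on_def)
    have "{i \<in> {0..n}. ?I i} = {i \<in> {1..n-1}. ?I i} \<union> {i \<in> {0, n}. ?I i}"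
      using assms by auto
    moreover have "card ({i \<in> {1..n-1}. ?I i} \<union> {i \<in> {0, n}. ?I i}) =
        card {i \<in> {1..n-1}. ?I i} + card {i \<in> {0, n}. ?I i}"
      using assms by (intro card_Un_disjoint) auto
    moreover have "{i \<in> {0, n}. ?I i} = (if w = id then {0, n} else {})" using I by auto
    ultimately have card: "card {i \<in> {0..n}. ?I i} =
        card {i \<in> {1..n-1}. ?I i} + (if w = id then 2 else 0)"
      using assms by simp
    have "riffle n 2 w = of_int (sign w) * of_nat (card {i \<in> {1..n-1}. ?I i}) +
        (if w = id then 2 else 0)"
      unfolding riffle_apply card_sorted_binary_words[OF True] card by (simp add: distrib_left)
    then show ?thesis
      using True by (simp add: shuffle_element_apply qscale_def delta_def)
  next
    case False
    then have "riffle n 2 w = 0"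
      using riffle_closed[of n 2] by (simp add: S.GA_iff sym_group_carrier)
    moreover have "w \<noteq> id" using False by auto
    ultimately show ?thesis
      using False by (simp add: shuffle_element_apply qscale_def delta_def)
  qed
qed

lemma shuffle_element_closed: "shuffle_element n \<in> carrier (QS n)"
  by (simp add: S.GA_iff sym_group_carrier shuffle_element_apply)

section \<open>Spectrum of the shuffle element and the Eulerian idempotents\<close>

lemma evp_shuffle_element_eq_0:
  assumes "n > 0" "\<And>j. j \<in> {1..n} \<Longrightarrow> poly p (2 ^ j - 2) = 0"
  shows "S.evp n (shuffle_element n) p = 0"
proof -
  have "S.evp n (riffle n 2) [:- 2, 1:] = qscale (- 2) (delta id) + riffle n 2"
    using riffle_closed[of n 2]
    by (simp only: S.evp_pCons S.evp_0 S.conv_zero qscale_simps add_0_right S.one_conv sym_group_one)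
       (use S.one_conv(2)[OF riffle_closed[of n 2]] in \<open>simp only: sym_group_one\<close>)
  also have "\<dots> = shuffle_element n"
    unfolding shuffle_element_riffle[OF assms(1)] by (auto simp: qscale_def fun_eq_iff)
  finally have "S.evp n (shuffle_element n) p = S.evp n (riffle n 2) (pcompose p [:- 2, 1:])"
    by (simp only: S.evp_pcompose)
  also have "\<dots> = 0"
    by (rule evp_riffle_eq_0[OF assms(1)]) (simp add: poly_pcompose assms(2))
  finally show ?thesis .
qed

text \<open>The polynomials \<open>L\<close> are part of the result because the commutation with
  \<open>Lambda n\<close> is proved through them.\<close>

lemma eulerian_idempotents:
  assumes "n > 0"
  obtains L where
    "\<And>j. j \<in> {1..n} \<Longrightarrow> eulerian_idempotent n j = S.evp n (shuffle_element n) (L j)"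
    "\<And>i j. i \<in> {1..n} \<Longrightarrow> j \<in> {1..n} \<Longrightarrow>
      eulerian_idempotent n i \<otimes>\<^bsub>QS n\<^esub> eulerian_idempotent n j =
        (if i = j then eulerian_idempotent n i else 0)"
    "(\<Sum>j\<in>{1..n}. eulerian_idempotent n j) = delta id"
proof -
  have inj: "inj_on (\<lambda>j. 2 ^ j - 2 :: rat) {1..n}"
    by (auto simp: inj_on_def)
  obtain L where L:
    "\<And>i j. i \<in> {1..n} \<Longrightarrow> j \<in> {1..n} \<Longrightarrow>
      S.evp n (shuffle_element n) (L i) \<otimes>\<^bsub>QS n\<^esub> S.evp n (shuffle_element n) (L j) =
        (if i = j then S.evp n (shuffle_element n) (L i) else 0)"
    "(\<Sum>j\<in>{1..n}. S.evp n (shuffle_element n) (L j)) = delta \<one>\<^bsub>sym_group n\<^esub>"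
    "\<And>j. j \<in> {1..n} \<Longrightarrow>
      (THE e. (\<exists>m a. e = (\<Sum>k<m. qscale (a k) (shuffle_element n [^]\<^bsub>QS n\<^esub> (k::nat)))) \<and>
             (\<forall>y\<in>carrier (QS n). e \<otimes>\<^bsub>QS n\<^esub> y \<in>
               {y \<in> carrier (QS n). shuffle_element n \<otimes>\<^bsub>QS n\<^esub> y = qscale (2 ^ j - 2) y}) \<and>
             (\<forall>y\<in>{y \<in> carrier (QS n). shuffle_element n \<otimes>\<^bsub>QS n\<^esub> y = qscale (2 ^ j - 2) y}.
               e \<otimes>\<^bsub>QS n\<^esub> y = y)) = S.evp n (shuffle_element n) (L j)"
    using S.spectral_decomposition[OF shuffle_element_closed finite_atLeastAtMost inj
        evp_shuffle_element_eq_0[OF assms]] by blast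
  have e: "eulerian_idempotent n j = S.evp n (shuffle_element n) (L j)" if "j \<in> {1..n}" for j
    using L(3)[OF that] by (simp only: eulerian_idempotent_def shuffle_eigenspace_def)
  show ?thesis
  proof (rule that[OF e])
    show "eulerian_idempotent n i \<otimes>\<^bsub>QS n\<^esub> eulerian_idempotent n j =
        (if i = j then eulerian_idempotent n i else 0)" if "i \<in> {1..n}" "j \<in> {1..n}" for i j
      unfolding e[OF that(1)] e[OF that(2)] by (rule L(1)[OF that])
    show "(\<Sum>j\<in>{1..n}. eulerian_idempotent n j) = delta id"
      unfolding sym_group_one[of n, symmetric] L(2)[symmetric] by (intro sum.cong refl e)
  qed
qed

section \<open>Cyclic descents\<close>

lemma n_cycle_permutes: "n_cycle n permutes {1..n}"
proof -
  have "set [1..<n + 1] = {1..n}" by auto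
  then show ?thesis using cycle_permutes[of "[1..<n + 1]"] by (simp only: n_cycle_def)
qed

lemma n_cycle_power_permutes: "(n_cycle n ^^ i) permutes {1..n}"
proof (induction i)
  case (Suc i)
  then show ?case
    unfolding funpow.simps by (rule permutes_compose[OF _ n_cycle_permutes])
qed (simp add: permutes_id[unfolded id_def] id_def)

lemma n_cycle_power_apply:
  assumes "k \<in> {1..n}"
  shows "(n_cycle n ^^ i) k = (k - 1 + i) mod n + 1"
proof -
  have "map (n_cycle n ^^ i) [1..<n + 1] = rotate i [1..<n + 1]"
    unfolding n_cycle_def by (rule cyclic_rotation) simp
  then have "map (n_cycle n ^^ i) [1..<n + 1] ! (k - 1) = rotate i [1..<n + 1] ! (k - 1)"
    by simp
  moreover have len: "length [1..<n + 1] = n" "k - 1 < n" using assms by auto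
  moreover have "[1..<n + 1] ! j = j + 1" if "j < n" for j
    using that by (subst nth_upt) auto
  moreover have "(k - 1 + i) mod n < n" using len(2) by (intro mod_less_divisor) simp
  ultimately show ?thesis
    using assms by (simp only: nth_map nth_rotate add.commute[of i]) simp
qed

lemma n_cycle_apply:
  assumes "k \<in> {1..n}"
  shows "n_cycle n k = (if k = n then 1 else k + 1)"
  using n_cycle_power_apply[OF assms, of 1] assms by auto

text \<open>The powers of the cycle form a transversal for the cosets of the stabilizer of
  \<open>n\<close> on either side; this provides the unique representative.\<close>

lemma n_cycle_power_transitive:
  assumes "x \<in> {1..n}" "y \<in> {1..n}"
  shows "\<exists>!i. i < n \<and> (n_cycle n ^^ i) x = y"
\<comment> \<open>Adding \<open>n\<close> keeps the subtraction of naturals from truncating.\<close>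
proof (rule ex1I[of _ "(y + n - x) mod n"])
  have "(x - 1 + (y + n - x) mod n) mod n = (x - 1 + (y + n - x)) mod n"
    by (rule mod_add_right_eq)
  also have "x - 1 + (y + n - x) = (y - 1) + n" using assms by auto
  also have "(y - 1 + n) mod n = y - 1"
    unfolding mod_add_self2 by (rule mod_less) (use assms in auto)
  finally show "(y + n - x) mod n < n \<and> (n_cycle n ^^ ((y + n - x) mod n)) x = y"
    unfolding n_cycle_power_apply[OF assms(1)] using assms(2) by simp
next
  fix i assume i: "i < n \<and> (n_cycle n ^^ i) x = y"
  then have "(x - 1 + i) mod n = y - 1" by (auto simp: n_cycle_power_apply[OF assms(1)])
  then have "(y + n - x) mod n = ((x - 1 + i) mod n + 1 + (n - x)) mod n"
    using assms by simp
  also have "\<dots> = (x - 1 + i + 1 + (n - x)) mod n"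
    using mod_add_left_eq[of "x - 1 + i" n "1 + (n - x)"] by (simp only: add.assoc)
  also have "x - 1 + i + 1 + (n - x) = i + n" using assms by auto
  finally show "i = (y + n - x) mod n" using i by simp
qed

lemma n_cycle_power_n: "n_cycle n ^^ n = id"
proof
  fix k show "(n_cycle n ^^ n) k = id k"
  proof (cases "k \<in> {1..n}")
    case True
    then have "(k - 1) mod n = k - 1" by (intro mod_less) auto
    then show ?thesis unfolding n_cycle_power_apply[OF True] mod_add_self2 using True by simp
  next
    case False
    then show ?thesis using permutes_not_in[OF n_cycle_power_permutes] by simp
  qed
qed

lemma permutation_sym_group: "w permutes {1..n :: nat} \<Longrightarrow> permutation w"
  by (rule permutes_imp_permutation[OF finite_atLeastAtMost])

lemma sign_n_cycle_power: "sign (n_cycle n ^^ i) = sign (n_cycle n) ^ i"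
proof (induction i)
  case (Suc i)
  show ?case
    unfolding funpow.simps sign_compose[OF permutation_sym_group[OF n_cycle_permutes]
        permutation_sym_group[OF n_cycle_power_permutes]] Suc power_Suc ..
qed simp

section \<open>Cyclic descents under rotation of positions and of values\<close>

definition cyclic_descents :: "nat \<Rightarrow> (nat \<Rightarrow> nat) \<Rightarrow> nat set" where
  "cyclic_descents n g = {k \<in> {1..n}. g k > g (n_cycle n k)}"

text \<open>The cycle itself maps one set of positions onto the other.\<close>

lemma card_cyclic_descents_rotate:
  "card (cyclic_descents n (g \<circ> n_cycle n)) = card (cyclic_descents n g)"
proof -
  have "n_cycle n ` cyclic_descents n (g \<circ> n_cycle n) = cyclic_descents n g"
  proof (intro equalityI subsetI)
    fix k assume k: "k \<in> cyclic_descents n g"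
    then have "k \<in> n_cycle n ` {1..n}" using permutes_image[OF n_cycle_permutes] by (simp add: cyclic_descents_def)
    with k show "k \<in> n_cycle n ` cyclic_descents n (g \<circ> n_cycle n)"
      by (auto simp: cyclic_descents_def)
  qed (use permutes_in_image[OF n_cycle_permutes] in \<open>auto simp: cyclic_descents_def\<close>)
  moreover have "inj_on (n_cycle n) (cyclic_descents n (g \<circ> n_cycle n))"
    by (rule inj_on_subset[OF permutes_inj[OF n_cycle_permutes] subset_UNIV])
  ultimately show ?thesis using card_image by metis
qed

text \<open>
  Raising all values by one modulo \<open>n\<close> moves the descent that follows the value \<open>n\<close> to the position
  before it and keeps all other cyclic descents.
\<close>

lemma card_cyclic_descents_shift:
  assumes n: "n \<ge> 2" and g: "g permutes {1..n}"
  shows "card (cyclic_descents n (n_cycle n \<circ> g)) = card (cyclic_descents n g)"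
proof -
  let ?c = "n_cycle n"
  \<comment> \<open>\<open>p\<close> is the place of the value \<open>n\<close>, and
    \<open>q\<close> the place before it in the cyclic order.\<close>
  define p where "p = inv' g n"
  define q where "q = inv' ?c p"
  define A where "A = {k \<in> {1..n}. k \<noteq> p \<and> ?c k \<noteq> p \<and> g k > g (?c k)}"
  note c = n_cycle_permutes[of n]
  have p: "p \<in> {1..n}" "g p = n"
    using permutes_in_image[OF permutes_inv[OF g], of n] n by (auto simp: p_def permutes_inverses[OF g])
  have q: "q \<in> {1..n}" "?c q = p"
    using permutes_in_image[OF permutes_inv[OF c], of p] p by (auto simp: q_def permutes_inverses[OF c])
  have gp: "g k = n \<longleftrightarrow> k = p" for k
    using permutes_inj[OF g] p by (metis injD)
  have cq: "?c k = p \<longleftrightarrow> k = q" for k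
    using permutes_inj[OF c] q by (metis injD)
  have c_neq: "?c k \<noteq> k" if "k \<in> {1..n}" for k
    using n_cycle_apply[OF that] n by auto
  have g_in: "g k \<in> {1..n}" "g (?c k) \<in> {1..n}" if "k \<in> {1..n}" for k
    using permutes_in_image[OF g] permutes_in_image[OF c] that by auto
  \<comment> \<open>After the shift the value \<open>n\<close> has become \<open>1\<close>, the
    smallest one: there is no descent at \<open>p\<close>, and there is one at the place before
    it.\<close>
  have less: "?c (g k) > ?c (g (?c k)) \<longleftrightarrow>
      (if k = p then False else if ?c k = p then True else g k > g (?c k))" if k: "k \<in> {1..n}" for k
    using n_cycle_apply[OF g_in(1)[OF k]] n_cycle_apply[OF g_in(2)[OF k]] gp[of k] gp[of "?c k"]
      g_in[OF k] c_neq[OF k] by auto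
  have less': "g k > g (?c k) \<longleftrightarrow>
      (if k = p then True else if ?c k = p then False else g k > g (?c k))" if k: "k \<in> {1..n}" for k
    using gp[of k] gp[of "?c k"] g_in[OF k] c_neq[OF k] by auto
  have qp: "q \<noteq> p" using c_neq[OF q(1)] q(2) by auto
  have "k \<in> cyclic_descents n (?c \<circ> g) \<longleftrightarrow> k \<in> insert q A" for k
    using less[of k] p(1) q(1) qp cq[of k]
    by (cases "k \<in> {1..n}") (auto simp: cyclic_descents_def A_def)
  then have "cyclic_descents n (?c \<circ> g) = insert q A" by blast
  moreover have "k \<in> cyclic_descents n g \<longleftrightarrow> k \<in> insert p A" for k
    using less'[of k] p(1) qp cq[of k]
    by (cases "k \<in> {1..n}") (auto simp: cyclic_descents_def A_def)
  then have "cyclic_descents n g = insert p A" by blast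
  moreover have "q \<notin> A" "p \<notin> A" "finite A" using q by (auto simp: A_def)
  ultimately show ?thesis by simp
qed

lemma card_cyclic_descents_powers:
  assumes "n \<ge> 2" "g permutes {1..n}"
  shows "card (cyclic_descents n (g \<circ> n_cycle n ^^ i)) = card (cyclic_descents n g)"
    and "card (cyclic_descents n (n_cycle n ^^ i \<circ> g)) = card (cyclic_descents n g)"
proof -
  show "card (cyclic_descents n (g \<circ> n_cycle n ^^ i)) = card (cyclic_descents n g)"
  proof (induction i)
    case (Suc i)
    have eq: "g \<circ> n_cycle n ^^ Suc i = (g \<circ> n_cycle n ^^ i) \<circ> n_cycle n"
      by (simp only: funpow_Suc_right o_assoc)
    show ?case unfolding eq card_cyclic_descents_rotate by (rule Suc)
  qed simp
  show "card (cyclic_descents n (n_cycle n ^^ i \<circ> g)) = card (cyclic_descents n g)"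
  proof (induction i)
    case (Suc i)
    have eq: "n_cycle n ^^ Suc i \<circ> g = n_cycle n \<circ> (n_cycle n ^^ i \<circ> g)"
      by (simp only: funpow.simps o_assoc)
    show ?case
      unfolding eq card_cyclic_descents_shift[OF assms(1) permutes_compose[OF assms(2) n_cycle_power_permutes]]
      by (rule Suc)
  qed simp
qed

definition descents :: "nat \<Rightarrow> (nat \<Rightarrow> nat) \<Rightarrow> nat set" where
  "descents m w = {k \<in> {1..<m}. w k > w (Suc k)}"

text \<open>As \<open>w n = n\<close>, the step from place \<open>n - 1\<close> to \<open>n\<close>
  is an ascent and the step from \<open>n\<close> back to \<open>1\<close> a descent. The remaining
  steps are those of \<open>w\<close> on \<open>{1..n-1}\<close>.\<close>

lemma card_cyclic_descents_fixing:
  assumes n: "n \<ge> 2" and w: "w permutes {1..n-1}"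
  shows "card (cyclic_descents n w) = Suc (card (descents (n - 1) w))"
proof -
  have wn: "w n = n" using permutes_not_in[OF w, of n] n by simp
  have w_less: "w k < n" if "k \<in> {1..n-1}" for k
    using permutes_in_image[OF w, of k] that n by auto
  have "w k > w (n_cycle n k) \<longleftrightarrow> k \<in> insert n (descents (n - 1) w)" if k: "k \<in> {1..n}" for k
  proof -
    consider "k = n" | "k = n - 1" | "k \<in> {1..<n-1}" using k by force
    then show ?thesis
    proof cases
      case 1
      then show ?thesis using n_cycle_apply[OF k] wn w_less[of 1] n by auto
    next
      case 2
      then have "w k < n" using w_less[of k] k by simp
      then show ?thesis using n_cycle_apply[OF k] wn 2 n by (auto simp: descents_def)
    next
      case 3
      then show ?thesis using n_cycle_apply[OF k] by (auto simp: descents_def)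
    qed
  qed
  then have "cyclic_descents n w = insert n (descents (n - 1) w)"
    using n by (auto simp: cyclic_descents_def descents_def)
  moreover have "finite (descents (n - 1) w)" "n \<notin> descents (n - 1) w"
    by (auto simp: descents_def)
  ultimately show ?thesis by simp
qed

lemma strict_mono_on_interval:
  assumes "\<And>k. k \<in> {a..<b} \<Longrightarrow> w k < w (Suc k)"
  shows "strict_mono_on {a..b} (w :: nat \<Rightarrow> nat)"
proof (rule strict_mono_onI)
  fix i j assume "i \<in> {a..b}" "j \<in> {a..b}" "i < j"
  then show "w i < w j"
  proof (induction j)
    case (Suc j)
    show ?case
    proof (cases "i = j")
      case True
      then show ?thesis using assms Suc.prems by auto
    next
      case False
      then have "w i < w j" using Suc by auto
      also have "w j < w (Suc j)" using assms Suc.prems False by auto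
      finally show ?thesis .
    qed
  qed simp
qed

lemma increasing_blocks_iff:
  assumes w: "w permutes {1..m}" and i: "i \<in> {1..m-1}"
  shows "increasing_blocks m i w \<longleftrightarrow> descents m w \<subseteq> {i}"
proof
  assume inc: "increasing_blocks m i w"
  show "descents m w \<subseteq> {i}"
  proof
    fix k assume k: "k \<in> descents m w"
    show "k \<in> {i}"
    proof (rule ccontr)
      assume "k \<notin> {i}"
      then have "k \<in> {1..i} \<and> Suc k \<in> {1..i} \<or> k \<in> {i + 1..m} \<and> Suc k \<in> {i + 1..m}"
        using k by (auto simp: descents_def)
      then have "w k < w (Suc k)"
        using inc strict_mono_onD[of "{1..i}" w k "Suc k"] strict_mono_onD[of "{i + 1..m}" w k "Suc k"]
        by (auto simp: increasing_blocks_def)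
      then show False using k by (simp add: descents_def)
    qed
  qed
next
  assume D: "descents m w \<subseteq> {i}"
  have "w k < w (Suc k)" if "k \<in> {1..<m}" "k \<noteq> i" for k
  proof -
    have "w k \<noteq> w (Suc k)" using injD[OF permutes_inj[OF w], of k "Suc k"] by auto
    moreover have "k \<notin> descents m w" using D that(2) by blast
    ultimately show ?thesis using that(1) by (simp add: descents_def)
  qed
  then show "increasing_blocks m i w"
    unfolding increasing_blocks_def using i by (intro conjI strict_mono_on_interval) auto
qed

text \<open>A block size \<open>i\<close> is admissible exactly if all descents are at
  \<open>i\<close>. Hence the coefficients of the shuffle element depend, apart from the sign, on
  the number of descents alone.\<close>

lemma card_increasing_blocks:
  assumes w: "w permutes {1..m}"
  shows "card {i \<in> {1..m-1}. increasing_blocks m i w} =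
    (if card (descents m w) = 0 then m - 1 else if card (descents m w) = 1 then 1 else 0)"
proof -
  let ?D = "descents m w"
  have D: "?D \<subseteq> {1..m-1}" "finite ?D" by (auto simp: descents_def)
  have eq: "{i \<in> {1..m-1}. increasing_blocks m i w} = {i \<in> {1..m-1}. ?D \<subseteq> {i}}"
    using increasing_blocks_iff[OF w] by blast
  consider "?D = {}" | d where "?D = {d}" | "card ?D > 1"
    using D(2) by (metis One_nat_def card_1_singletonE card_eq_0_iff less_one linorder_neqE_nat)
  then show ?thesis
  proof cases
    case 1
    then have "{i \<in> {1..m-1}. ?D \<subseteq> {i}} = {1..m-1}" by blast
    then show ?thesis unfolding eq using 1 by (simp only: card_atLeastAtMost card.empty if_True) simp
  next
    case 2
    then have "{i \<in> {1..m-1}. ?D \<subseteq> {i}} = {d}" using D by auto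
    then show ?thesis unfolding eq using 2 by simp
  next
    case 3
    have "\<not> ?D \<subseteq> {i}" for i
      using card_mono[of "{i}" ?D] 3 by auto
    then have "{i \<in> {1..m-1}. ?D \<subseteq> {i}} = {}" by blast
    then show ?thesis unfolding eq using 3 by simp
  qed
qed

text \<open>Rotating the values of \<open>u\<close> and rotating the positions of \<open>v\<close>
  give the same permutation, so \<open>u\<close> and \<open>v\<close> both have its number of cyclic
  descents.\<close>

lemma card_increasing_blocks_cyclic:
  assumes n: "n \<ge> 2" and u: "u permutes {1..n-1}" and v: "v permutes {1..n-1}"
    and eq: "n_cycle n ^^ i \<circ> u = v \<circ> n_cycle n ^^ k"
  shows "card {i \<in> {1..n-1-1}. increasing_blocks (n - 1) i u} =
    card {i \<in> {1..n-1-1}. increasing_blocks (n - 1) i v}"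
proof -
  have sub: "{1..n-1} \<subseteq> {1..n}" by auto
  have "card (cyclic_descents n u) = card (cyclic_descents n v)"
    using card_cyclic_descents_powers(2)[OF n permutes_subset[OF u sub], of i]
      card_cyclic_descents_powers(1)[OF n permutes_subset[OF v sub], of k] eq by simp
  then have "card (descents (n - 1) u) = card (descents (n - 1) v)"
    using card_cyclic_descents_fixing[OF n u] card_cyclic_descents_fixing[OF n v] by simp
  then show ?thesis
    by (simp only: card_increasing_blocks[OF u] card_increasing_blocks[OF v])
qed

section \<open>The element \<open>\<Lambda>\<^sub>n\<close>\<close>

lemma n_cycle_power_carrier: "n_cycle n ^^ i \<in> carrier (sym_group n)"
  by (simp only: sym_group_carrier n_cycle_power_permutes)

lemma inv_n_cycle_power: "inv\<^bsub>sym_group n\<^esub> (n_cycle n ^^ i) = inv' (n_cycle n ^^ i)"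
  by (rule sym_group_inv_equality[OF n_cycle_power_carrier])

lemma Lambda_closed: "Lambda n \<in> carrier (QS n)"
  unfolding Lambda_def
  by (intro qvs.subspace_sum[OF S.subspace_GA] qvs.subspace_scale[OF S.subspace_GA]
      S.delta_closed n_cycle_power_carrier)

lemma Lambda_conv:
  assumes "g permutes {1..n}"
  shows "(Lambda n \<otimes>\<^bsub>QS n\<^esub> x) g =
    (\<Sum>i<n. of_int (sign (n_cycle n) ^ i) * x (inv' (n_cycle n ^^ i) \<circ> g))"
    and "(x \<otimes>\<^bsub>QS n\<^esub> Lambda n) g =
    (\<Sum>i<n. of_int (sign (n_cycle n) ^ i) * x (g \<circ> inv' (n_cycle n ^^ i)))"
proof -
  have g: "g \<in> carrier (sym_group n)" using assms by (simp only: sym_group_carrier)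
  show "(Lambda n \<otimes>\<^bsub>QS n\<^esub> x) g =
    (\<Sum>i<n. of_int (sign (n_cycle n) ^ i) * x (inv' (n_cycle n ^^ i) \<circ> g))"
    unfolding Lambda_def S.conv_sum S.conv_scale sum_fun_apply
    by (simp only: qscale_def S.delta_conv[OF n_cycle_power_carrier g] inv_n_cycle_power sym_group_mult)
  show "(x \<otimes>\<^bsub>QS n\<^esub> Lambda n) g =
    (\<Sum>i<n. of_int (sign (n_cycle n) ^ i) * x (g \<circ> inv' (n_cycle n ^^ i)))"
    unfolding Lambda_def S.conv_sum S.conv_scale sum_fun_apply
    by (simp only: qscale_def S.conv_delta[OF n_cycle_power_carrier g] inv_n_cycle_power sym_group_mult)
qed

lemma sum_single:
  fixes F :: "'i \<Rightarrow> 'b :: comm_monoid_add"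
  assumes "finite A" "i \<in> A" "\<And>j. j \<in> A \<Longrightarrow> j \<noteq> i \<Longrightarrow> F j = 0"
  shows "sum F A = F i"
  using sum.mono_neutral_right[of A "{i}" F] assms by auto

lemma permutes_pred_iff:
  assumes "w permutes {1..n :: nat}" "n > 0"
  shows "w permutes {1..n-1} \<longleftrightarrow> w n = n"
proof
  assume "w permutes {1..n-1}"
  moreover have "n \<notin> {1..n-1}"
    using assms(2) by (cases n) auto
  ultimately show "w n = n" by (rule permutes_not_in)
next
  assume w: "w n = n"
  show "w permutes {1..n-1}"
  proof (rule permutes_superset[OF assms(1)])
    fix x assume "x \<in> {1..n} - {1..n-1}"
    then have "x = n" by auto
    then show "w x = x" using w by simp
  qed
qed

text \<open>The shuffle element of \<open>n - 1\<close> lives on permutations that fix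
  \<open>n\<close>. So at \<open>g\<close> one summand survives on either side, namely the one for
  the factorization of \<open>g\<close> as a power of the cycle times \<open>u\<close>, respectively
  as \<open>v\<close> times a power, with \<open>u\<close> and \<open>v\<close> fixing
  \<open>n\<close>. In both the total sign is that of \<open>g\<close>, and the cyclic descents
  match the rest.\<close>

lemma Lambda_commutes_shuffle_element:
  assumes n: "n \<ge> 2"
  shows "Lambda n \<otimes>\<^bsub>QS n\<^esub> shuffle_element (n - 1) = shuffle_element (n - 1) \<otimes>\<^bsub>QS n\<^esub> Lambda n"
proof
  let ?c = "\<lambda>i. n_cycle n ^^ i"
  let ?s = "shuffle_element (n - 1)"
  fix g
  show "(Lambda n \<otimes>\<^bsub>QS n\<^esub> ?s) g = (?s \<otimes>\<^bsub>QS n\<^esub> Lambda n) g"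
  proof (cases "g permutes {1..n}")
    case False
    then have "g \<notin> carrier (sym_group n)" by (simp only: sym_group_carrier not_False_eq_True)
    show ?thesis unfolding S.conv_apply(2)[OF \<open>g \<notin> _\<close>] ..
  next
    case g: True
    have n_in: "n \<in> {1..n}" using n by simp
    have cp: "?c i permutes {1..n}" for i by (rule n_cycle_power_permutes)
    have s_0: "?s w = 0" if "w permutes {1..n}" "w n \<noteq> n" for w
      using that permutes_pred_iff[OF that(1)] n by (simp add: shuffle_element_apply)
    have gn: "g n \<in> {1..n}" using permutes_in_image[OF g] n_in by blast
    have gn': "inv' g n \<in> {1..n}" using permutes_in_image[OF permutes_inv[OF g]] n_in by blast
    obtain i where i: "i < n" "?c i n = g n" "\<And>j. j < n \<Longrightarrow> ?c j n = g n \<Longrightarrow> j = i"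
      using n_cycle_power_transitive[OF n_in gn] by blast
    obtain k where k: "k < n" "?c k (inv' g n) = n" "\<And>j. j < n \<Longrightarrow> ?c j (inv' g n) = n \<Longrightarrow> j = k"
      using n_cycle_power_transitive[OF gn' n_in] by blast
    define u where "u = inv' (?c i) \<circ> g"
    define v where "v = g \<circ> inv' (?c k)"
    have u: "u permutes {1..n}" and v: "v permutes {1..n}"
      unfolding u_def v_def by (intro permutes_compose permutes_inv g cp)+
    have un: "u n = n"
      using i(2) permutes_inverses(2)[OF cp[of i], of n] by (simp add: u_def)
    have vn: "v n = n"
      using k(2) permutes_inverses(2)[OF cp[of k], of "inv' g n"] permutes_inverses(1)[OF g]
      by (simp add: v_def)
    have n0: "n > 0" using n by simp
    note u' = permutes_pred_iff[OF u n0, THEN iffD2, OF un]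
      and v' = permutes_pred_iff[OF v n0, THEN iffD2, OF vn]
    have "?c i \<circ> u = g" "v \<circ> ?c k = g"
      by (auto simp: u_def v_def fun_eq_iff permutes_inverses[OF cp])
    then have card: "card {i \<in> {1..n-1-1}. increasing_blocks (n - 1) i u} =
        card {i \<in> {1..n-1-1}. increasing_blocks (n - 1) i v}"
      by (intro card_increasing_blocks_cyclic[OF n u' v', of i k]) simp
    have sign: "sign (inv' (?c j)) = sign (n_cycle n) ^ j" for j
      using sign_inverse[OF permutation_sym_group[OF cp]] sign_n_cycle_power by simp
    have sq: "sign (n_cycle n) ^ j * (sign (n_cycle n) ^ j * x) = x" for j x
      by (simp add: mult.assoc[symmetric] power_mult_distrib[symmetric])
    have sign_u: "sign (n_cycle n) ^ i * sign u = sign g"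
      unfolding u_def sign_compose[OF permutation_sym_group[OF permutes_inv[OF cp]]
          permutation_sym_group[OF g]] sign sq ..
    have sign_v: "sign (n_cycle n) ^ k * sign v = sign g"
      unfolding v_def sign_compose[OF permutation_sym_group[OF g]
          permutation_sym_group[OF permutes_inv[OF cp]]] sign
      by (simp only: mult.left_commute[of _ "sign g"] mult.assoc sq)
         (simp add: sq[of _ 1, simplified])
    have val: "of_int (sign (n_cycle n) ^ j) * ?s w = of_int (sign (n_cycle n) ^ j * sign w) *
        of_nat (card {i \<in> {1..n-1-1}. increasing_blocks (n - 1) i w})" if "w permutes {1..n-1}" for j w
      unfolding shuffle_element_apply if_P[OF that] by simp
    have "(Lambda n \<otimes>\<^bsub>QS n\<^esub> ?s) g = of_int (sign (n_cycle n) ^ i) * ?s u"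
      unfolding Lambda_conv(1)[OF g] u_def
    proof (rule sum_single)
      fix j assume j: "j \<in> {..<n}" "j \<noteq> i"
      have "(inv' (?c j) \<circ> g) n \<noteq> n"
      proof
        assume "(inv' (?c j) \<circ> g) n = n"
        then have "?c j n = g n" using permutes_inverses(1)[OF cp[of j], of "g n"] by simp
        then show False using i(3) j by blast
      qed
      then have "?s (inv' (?c j) \<circ> g) = 0"
        by (intro s_0 permutes_compose permutes_inv g cp)
      then show "of_int (sign (n_cycle n) ^ j) * ?s (inv' (?c j) \<circ> g) = 0" by simp
    qed (use i(1) in simp_all)
    also have "\<dots> = of_int (sign (n_cycle n) ^ k) * ?s v"
      by (simp only: val[OF u'] val[OF v'] sign_u sign_v card)
    also have "\<dots> = (?s \<otimes>\<^bsub>QS n\<^esub> Lambda n) g"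
      unfolding Lambda_conv(2)[OF g] v_def
    proof (rule sum_single[symmetric])
      fix j assume j: "j \<in> {..<n}" "j \<noteq> k"
      have "(g \<circ> inv' (?c j)) n \<noteq> n"
      proof
        assume "(g \<circ> inv' (?c j)) n = n"
        then have "inv' (?c j) n = inv' g n"
          using permutes_inverses(2)[OF g, of "inv' (?c j) n"] by simp
        then have "?c j (inv' g n) = n" using permutes_inverses(1)[OF cp[of j], of n] by simp
        then show False using k(3) j by blast
      qed
      then have "?s (g \<circ> inv' (?c j)) = 0"
        by (intro s_0 permutes_compose permutes_inv g cp)
      then show "of_int (sign (n_cycle n) ^ j) * ?s (g \<circ> inv' (?c j)) = 0" by simp
    qed (use k(1) in simp_all)
    finally show ?thesis .
  qed
qed

section \<open>Whitehouse's modules\<close>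

text \<open>Shifting the summation index by one closes up, because the \<open>n\<close>-th power of
  the cycle is the identity and so the \<open>n\<close>-th power of its sign is 1.\<close>

lemma n_cycle_shift_Lambda:
  "delta (n_cycle n) \<otimes>\<^bsub>QS n\<^esub> Lambda n = qscale (of_int (sign (n_cycle n))) (Lambda n)"
proof -
  let ?c = "n_cycle n"
  let ?s = "of_int (sign ?c) :: rat"
  let ?F = "\<lambda>i. qscale (of_int (sign ?c ^ i)) (delta (?c ^^ i)) :: (nat \<Rightarrow> nat) \<Rightarrow> rat"
  have c: "?c \<in> carrier (sym_group n)" by (simp only: sym_group_carrier n_cycle_permutes)
  have s: "?s * ?s = 1" by (simp flip: of_int_mult)
  have F_Suc: "qscale (of_int (sign ?c ^ i)) (delta (?c ^^ Suc i)) = qscale ?s (?F (Suc i))" for i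
    by (simp add: s flip: mult.assoc)
  have "sign ?c ^ n = 1"
    unfolding sign_n_cycle_power[symmetric] n_cycle_power_n by simp
  then have F_n: "?F n = ?F 0"
    unfolding n_cycle_power_n by simp
  have "?F 0 + (\<Sum>i<n. ?F (Suc i)) = (\<Sum>i<n. ?F i) + ?F n"
    by (rule trans[OF sum.lessThan_Suc_shift[of ?F n, symmetric] sum.lessThan_Suc[of ?F n]])
  then have shift: "(\<Sum>i<n. ?F (Suc i)) = (\<Sum>i<n. ?F i)"
    unfolding F_n by (simp only: add.commute[of "?F 0"] add_right_cancel)
  have "delta ?c \<otimes>\<^bsub>QS n\<^esub> Lambda n = (\<Sum>i<n. qscale (of_int (sign ?c ^ i)) (delta (?c ^^ Suc i)))"
    unfolding Lambda_def S.conv_sum S.conv_scale S.delta_conv_delta[OF c n_cycle_power_carrier]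
    by (simp only: sym_group_mult funpow.simps)
  also have "\<dots> = qscale ?s (\<Sum>i<n. ?F (Suc i))"
    unfolding F_Suc qvs.scale_sum_right ..
  finally show ?thesis unfolding shift Lambda_def .
qed

lemma n_cycle_power_shift_Lambda:
  "delta (n_cycle n ^^ i) \<otimes>\<^bsub>QS n\<^esub> Lambda n = qscale (of_int (sign (n_cycle n) ^ i)) (Lambda n)"
proof (induction i)
  case 0
  show ?case
    by (simp only: funpow.simps(1) power_0 of_int_1 qscale_simps
        S.one_conv(1)[OF Lambda_closed, unfolded sym_group_one])
next
  case (Suc i)
  have c: "n_cycle n \<in> carrier (sym_group n)" by (simp only: sym_group_carrier n_cycle_permutes)
  have "delta (n_cycle n ^^ Suc i) = delta (n_cycle n) \<otimes>\<^bsub>QS n\<^esub> delta (n_cycle n ^^ i)"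
    unfolding S.delta_conv_delta[OF c n_cycle_power_carrier] by (simp only: sym_group_mult funpow.simps)
  then show ?case
    by (simp only: S.conv_assoc Suc S.conv_scale n_cycle_shift_Lambda qvs.scale_scale power_Suc2 of_int_mult)
qed

text \<open>This equivariance determines a vector in the image of \<open>Lambda n\<close> by its
  values on a transversal for the left action of the cycle.\<close>

lemma Lambda_image_shift:
  assumes "g permutes {1..n}"
  shows "(Lambda n \<otimes>\<^bsub>QS n\<^esub> y) (inv' (n_cycle n ^^ i) \<circ> g) =
    of_int (sign (n_cycle n) ^ i) * (Lambda n \<otimes>\<^bsub>QS n\<^esub> y) g"
proof -
  have g: "g \<in> carrier (sym_group n)" using assms by (simp only: sym_group_carrier)
  have "delta (n_cycle n ^^ i) \<otimes>\<^bsub>QS n\<^esub> (Lambda n \<otimes>\<^bsub>QS n\<^esub> y) =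
      qscale (of_int (sign (n_cycle n) ^ i)) (Lambda n \<otimes>\<^bsub>QS n\<^esub> y)"
    unfolding S.conv_assoc[symmetric] n_cycle_power_shift_Lambda S.conv_scale ..
  from fun_cong[OF this, of g] show ?thesis
    by (simp only: S.delta_conv[OF n_cycle_power_carrier g] inv_n_cycle_power sym_group_mult qscale_def)
qed

text \<open>For \<open>k\<close> in \<open>{1..n}\<close>, the permutations with
  \<open>g k = n\<close> form a right coset of the stabilizer of \<open>n\<close>, and this coset
  meets every orbit of left multiplication by the cycle exactly once.\<close>

definition coset_part :: "nat \<Rightarrow> nat \<Rightarrow> ((nat \<Rightarrow> nat) \<Rightarrow> rat) \<Rightarrow> (nat \<Rightarrow> nat) \<Rightarrow> rat" where
  "coset_part n k x = (\<lambda>g. if g k = n then x g else 0)"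

text \<open>For exactly one power of the cycle does its inverse send \<open>g k\<close> to
  \<open>n\<close>, so a single summand of \<open>Lambda n\<close> survives.\<close>

lemma Lambda_coset_part:
  assumes g: "g permutes {1..n}" and k: "k \<in> {1..n}" and i: "i < n" "(n_cycle n ^^ i) n = g k"
  shows "(Lambda n \<otimes>\<^bsub>QS n\<^esub> coset_part n k x) g =
    of_int (sign (n_cycle n) ^ i) * x (inv' (n_cycle n ^^ i) \<circ> g)"
proof -
  let ?c = "\<lambda>i. n_cycle n ^^ i"
  have c: "?c j permutes {1..n}" for j by (rule n_cycle_power_permutes)
  have n_in: "n \<in> {1..n}" using k by simp
  have "g k \<in> {1..n}" using permutes_in_image[OF g] k by blast
  then have unique: "j = i" if "j < n" "?c j n = g k" for j
    using n_cycle_power_transitive[OF n_in, of "g k"] that i by blast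
  have iff: "(inv' (?c j) \<circ> g) k = n \<longleftrightarrow> ?c j n = g k" for j
    unfolding comp_apply by (rule permutes_inv_eq[OF c])
  have "(Lambda n \<otimes>\<^bsub>QS n\<^esub> coset_part n k x) g =
      of_int (sign (n_cycle n) ^ i) * coset_part n k x (inv' (?c i) \<circ> g)"
    unfolding Lambda_conv(1)[OF g]
  proof (rule sum_single[OF finite_lessThan])
    show "i \<in> {..<n}" using i(1) by simp
    fix j assume j: "j \<in> {..<n}" "j \<noteq> i"
    have "(inv' (?c j) \<circ> g) k \<noteq> n"
      unfolding iff using unique[of j] j by blast
    then show "of_int (sign (n_cycle n) ^ j) * coset_part n k x (inv' (?c j) \<circ> g) = 0"
      unfolding coset_part_def by (simp only: if_False mult_zero_right)
  qed
  also have "coset_part n k x (inv' (?c i) \<circ> g) = x (inv' (?c i) \<circ> g)"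
    unfolding coset_part_def iff[of i] using i(2) by (simp only: if_True refl)
  finally show ?thesis .
qed

text \<open>Restricting an equivariant vector to a transversal and spreading it out again by
  \<open>Lambda n\<close> loses nothing; the two signs that occur cancel.\<close>

lemma Lambda_coset_part_image:
  assumes k: "k \<in> {1..n}" and v: "v = Lambda n \<otimes>\<^bsub>QS n\<^esub> y"
  shows "Lambda n \<otimes>\<^bsub>QS n\<^esub> coset_part n k v = v"
proof
  fix g
  show "(Lambda n \<otimes>\<^bsub>QS n\<^esub> coset_part n k v) g = v g"
  proof (cases "g permutes {1..n}")
    case g: True
    have "n \<in> {1..n}" "g k \<in> {1..n}" using permutes_in_image[OF g] k by auto
    then obtain i where i: "i < n" "(n_cycle n ^^ i) n = g k"
      using n_cycle_power_transitive by blast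
    have "sign (n_cycle n) ^ i * sign (n_cycle n) ^ i = 1"
      by (simp flip: power_mult_distrib)
    then have sq: "of_int (sign (n_cycle n) ^ i) * (of_int (sign (n_cycle n) ^ i) * x) = x" for x :: rat
      by (simp only: mult.assoc[symmetric] of_int_mult[symmetric] of_int_1 mult_1_left)
    show ?thesis
      unfolding Lambda_coset_part[OF g k i] unfolding v Lambda_image_shift[OF g] by (rule sq)
  next
    case False
    then have "g \<notin> carrier (sym_group n)" by (simp only: sym_group_carrier not_False_eq_True)
    show ?thesis unfolding v S.conv_apply(2)[OF \<open>g \<notin> _\<close>] ..
  qed
qed

lemma Lambda_coset_part_apply:
  assumes g: "g permutes {1..n}" and k: "k \<in> {1..n}" "g k = n"
  shows "(Lambda n \<otimes>\<^bsub>QS n\<^esub> coset_part n k x) g = x g"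
proof -
  have "0 < n" "(n_cycle n ^^ 0) n = g k" using k by auto
  from Lambda_coset_part[OF g k(1) this] show ?thesis by simp
qed

text \<open>\<open>e\<close> lives on the stabilizer of \<open>n\<close>, and left multiplication by
  the stabilizer preserves the condition \<open>g k = n\<close>.\<close>

lemma conv_coset_part:
  assumes e: "e \<in> carrier (QS (n - 1))" and n: "n > 0"
  shows "e \<otimes>\<^bsub>QS n\<^esub> coset_part n k x = coset_part n k (e \<otimes>\<^bsub>QS n\<^esub> x)"
proof
  fix g
  show "(e \<otimes>\<^bsub>QS n\<^esub> coset_part n k x) g = coset_part n k (e \<otimes>\<^bsub>QS n\<^esub> x) g"
  proof (cases "g \<in> carrier (sym_group n)")
    case True
    have "e h * coset_part n k x (inv\<^bsub>sym_group n\<^esub> h \<otimes>\<^bsub>sym_group n\<^esub> g) =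
        (if g k = n then e h * x (inv\<^bsub>sym_group n\<^esub> h \<otimes>\<^bsub>sym_group n\<^esub> g) else 0)"
      if h: "h \<in> carrier (sym_group n)" for h
    proof (cases "h permutes {1..n-1}")
      case hn: True
      have hp: "h permutes {1..n}" using h by (simp only: sym_group_carrier)
      have "h n = n" using hn permutes_pred_iff[OF hp n] by blast
      then have "inv' h (g k) = n \<longleftrightarrow> g k = n"
        using permutes_inv_eq[OF hp, of "g k" n] by auto
      then show ?thesis
        unfolding coset_part_def sym_group_inv_equality[OF h] sym_group_mult comp_apply
        by (simp only: if_distrib[of "\<lambda>c. e h * c"] mult_zero_right)
    next
      case False
      then have "h \<notin> carrier (sym_group (n - 1))"
        by (simp only: sym_group_carrier not_False_eq_True)
      then have "e h = 0" using e unfolding S.GA_iff by blast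
      then show ?thesis by (simp only: mult_zero_left if_cancel)
    qed
    then have "(e \<otimes>\<^bsub>QS n\<^esub> coset_part n k x) g = (\<Sum>h\<in>carrier (sym_group n).
        if g k = n then e h * x (inv\<^bsub>sym_group n\<^esub> h \<otimes>\<^bsub>sym_group n\<^esub> g) else 0)"
      unfolding S.conv_apply(1)[OF True] by (intro sum.cong refl)
    also have "\<dots> = coset_part n k (e \<otimes>\<^bsub>QS n\<^esub> x) g"
      unfolding coset_part_def S.conv_apply(1)[OF True] by (cases "g k = n") simp_all
    finally show ?thesis .
  next
    case False
    then show ?thesis unfolding coset_part_def S.conv_apply(2)[OF False] by (simp only: if_cancel)
  qed
qed

lemma coset_part_sum:
  assumes "x \<in> carrier (QS n)" "n > 0"
  shows "(\<Sum>k\<in>{1..n}. coset_part n k x) = x"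
proof
  fix g
  show "(\<Sum>k\<in>{1..n}. coset_part n k x) g = x g"
  proof (cases "g permutes {1..n}")
    case g: True
    have in_n: "inv' g n \<in> {1..n}"
      using permutes_in_image[OF permutes_inv[OF g]] assms(2) by auto
    have iff: "g k = n \<longleftrightarrow> k = inv' g n" for k
      using permutes_inv_eq[OF g, of n k] by auto
    have "(\<Sum>k\<in>{1..n}. coset_part n k x g) = coset_part n (inv' g n) x g"
    proof (rule sum_single[OF finite_atLeastAtMost in_n])
      fix k assume "k \<noteq> inv' g n"
      then show "coset_part n k x g = 0" unfolding coset_part_def iff by (simp only: if_False)
    qed
    also have "\<dots> = x g" unfolding coset_part_def iff by (simp only: if_True refl)
    finally show ?thesis unfolding sum_fun_apply .
  next
    case False
    then have "g \<notin> carrier (sym_group n)" by (simp only: sym_group_carrier not_False_eq_True)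
    then have "x g = 0" using assms(1) unfolding S.GA_iff by blast
    then show ?thesis unfolding sum_fun_apply coset_part_def by (simp only: if_cancel sum.neutral_const)
  qed
qed

section \<open>The reflection module and its tensor products\<close>

lemma fd_reflection:
  assumes "n > 0"
  shows "fd_rmodule (sym_group n) (reflection_rmodule n)"
proof -
  let ?V = "vecs (reflection_rmodule n)"
  have V: "x \<in> ?V \<longleftrightarrow> (\<forall>i. i \<notin> {1..n} \<longrightarrow> x i = 0) \<and> (\<Sum>i\<in>{1..n}. x i) = 0" for x
    by (simp add: reflection_rmodule_def)
  have act: "act (reflection_rmodule n) x g = x \<circ> g" for x g
    by (simp add: reflection_rmodule_def)
  define u :: "nat \<Rightarrow> nat \<Rightarrow> rat" where "u k = delta k - delta n" for k
  have sub: "qvs.subspace ?V"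
    by (rule qvs.subspaceI) (simp_all add: V qscale_def sum.distrib sum_distrib_left[symmetric])
  have u: "u k \<in> ?V" if "k \<in> {1..n}" for k
    using that assms unfolding V u_def by (auto simp: delta_def sum_subtractf)
  have "x = (\<Sum>k\<in>{1..n}. qscale (x k) (u k))" if x: "x \<in> ?V" for x
  proof
    fix i
    have "(\<Sum>k\<in>{1..n}. qscale (x k) (u k)) i =
        (\<Sum>k\<in>{1..n}. if k = i then x k else 0) - (\<Sum>k\<in>{1..n}. x k * delta n i)"
      unfolding sum_fun_apply sum_subtractf[symmetric]
      by (intro sum.cong) (auto simp: u_def qscale_def delta_def)
    also have "(\<Sum>k\<in>{1..n}. x k * delta n i) = 0"
      unfolding sum_distrib_right[symmetric] using x by (simp add: V)
    also have "(\<Sum>k\<in>{1..n}. if k = i then x k else 0) = x i"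
      using x by (simp add: V)
    finally show "x i = (\<Sum>k\<in>{1..n}. qscale (x k) (u k)) i" by simp
  qed
  moreover have "(\<Sum>k\<in>{1..n}. qscale (x k) (u k)) \<in> qvs.span (u ` {1..n})" for x
    by (intro qvs.span_sum qvs.span_scale qvs.span_base) auto
  ultimately have "?V \<subseteq> qvs.span (u ` {1..n})" by (metis subsetI)
  moreover have "qvs.span (u ` {1..n}) \<subseteq> ?V"
    using u by (intro qvs.span_minimal sub) auto
  ultimately have span: "?V = qvs.span (u ` {1..n})" by blast
  show ?thesis
  proof (rule fd_rmoduleI[OF _ span])
    fix g assume "g \<in> carrier (sym_group n)"
    then have g: "g permutes {1..n}" by (simp only: sym_group_carrier)
    show "linear_on ?V (\<lambda>x. act (reflection_rmodule n) x g)"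
      by (simp add: linear_on_def act fun_eq_iff qscale_def)
    fix x assume x: "x \<in> ?V"
    have "(\<Sum>i\<in>{1..n}. x (g i)) = (\<Sum>i\<in>{1..n}. x i)"
      using sum.permute[OF g, of x] by (simp add: comp_def)
    then show "act (reflection_rmodule n) x g \<in> ?V"
      using x permutes_not_in[OF g] unfolding V act comp_apply by metis
  qed (auto simp: act sym_group_one sym_group_mult)
qed

text \<open>In the sum of the tensors of \<open>u k = delta k - delta n\<close> with the rows of
  \<open>z\<close>, the correction at \<open>n\<close> is the sum of all rows, which
  vanishes.\<close>

lemma reflection_tensorI:
  assumes F: "qvs.subspace F" and n: "n > 0"
    and rows: "\<And>k. k \<in> {1..n} \<Longrightarrow> (\<lambda>j. z (k, j)) \<in> F"
    and supp: "\<And>k j. k \<notin> {1..n} \<Longrightarrow> z (k, j) = 0"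
    and sum: "\<And>j. (\<Sum>k\<in>{1..n}. z (k, j)) = 0"
  shows "z \<in> tensor_span (vecs (reflection_rmodule n)) F"
proof -
  define u :: "nat \<Rightarrow> nat \<Rightarrow> rat" where "u k = delta k - delta n" for k
  have u: "u k \<in> vecs (reflection_rmodule n)" if "k \<in> {1..n}" for k
    using that n unfolding u_def by (auto simp: reflection_rmodule_def delta_def sum_subtractf)
  have "z = (\<Sum>k\<in>{1..n}. pure_tensor (u k) (\<lambda>j. z (k, j)))"
  proof (rule ext, clarify)
    fix i j
    have "(\<Sum>k\<in>{1..n}. pure_tensor (u k) (\<lambda>j. z (k, j))) (i, j) =
        (\<Sum>k\<in>{1..n}. if k = i then z (k, j) else 0) - (\<Sum>k\<in>{1..n}. delta n i * z (k, j))"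
      unfolding sum_fun_apply sum_subtractf[symmetric]
      by (intro sum.cong) (auto simp: u_def pure_tensor_def delta_def)
    also have "(\<Sum>k\<in>{1..n}. delta n i * z (k, j)) = 0"
      unfolding sum_distrib_left[symmetric] sum by simp
    also have "(\<Sum>k\<in>{1..n}. if k = i then z (k, j) else 0) = z (i, j)"
      using supp[of i j] by simp
    finally show "z (i, j) = (\<Sum>k\<in>{1..n}. pure_tensor (u k) (\<lambda>j. z (k, j))) (i, j)" by simp
  qed
  moreover have "(\<Sum>k\<in>{1..n}. pure_tensor (u k) (\<lambda>j. z (k, j))) \<in>
      tensor_span (vecs (reflection_rmodule n)) F"
    by (intro qvs.subspace_sum subspace_tensor_span pure_tensor_in_tensor_span u rows)
  ultimately show ?thesis by metis
qed

lemma subspace_reflection: "n > 0 \<Longrightarrow> qvs.subspace (vecs (reflection_rmodule n))"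
  by (rule fd_rmoduleD(2)[OF fd_reflection])

text \<open>
  An element \<open>z\<close> of \<open>V \<otimes> F\<close> is a family of vectors \<open>z\<^sub>k\<close> of \<open>F\<close> with sum zero. Every element of \<open>F\<close>
  is determined by its values at the \<open>g\<close> with \<open>g k = n\<close>, because these form a transversal for the
  left action of the cycle; so \<open>z\<close> can be glued to one element of the group algebra.
\<close>

lemma whitehouse_exact:
  assumes n: "n > 0" and e: "e \<in> carrier (QS (n - 1))" and ee: "e \<otimes>\<^bsub>QS n\<^esub> e = e"
    and comm: "Lambda n \<otimes>\<^bsub>QS n\<^esub> e = e \<otimes>\<^bsub>QS n\<^esub> Lambda n"
  defines "F \<equiv> right_ideal_rmodule (sym_group n) (Lambda n \<otimes>\<^bsub>QS n\<^esub> e)"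
  shows "short_exact (sym_group n) (tensor_rmodule (reflection_rmodule n) F)
    (right_ideal_rmodule (sym_group n) e) F"
proof -
  let ?V = "reflection_rmodule n"
  let ?E = "right_ideal_rmodule (sym_group n) e"
  let ?L = "Lambda n"
  let ?T = "tensor_span (vecs ?V) (vecs F)"
  \<comment> \<open>The gluing: at \<open>g\<close> the component with index
    \<open>k = inv' g n\<close> is used.\<close>
  define f where "f z = (\<lambda>g. if g \<in> carrier (sym_group n) then z (inv' g n, g) else (0 :: rat))" for z
  have E: "vecs ?E = {x \<in> carrier (QS n). e \<otimes>\<^bsub>QS n\<^esub> x = x}"
    by (rule S.right_ideal_idempotent[OF ee])
  have F: "vecs F = (\<lambda>x. (?L \<otimes>\<^bsub>QS n\<^esub> e) \<otimes>\<^bsub>QS n\<^esub> x) ` carrier (QS n)"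
    unfolding F_def by (rule S.vecs_right_ideal)
  have fdF: "fd_rmodule (sym_group n) F" unfolding F_def by (rule S.fd_right_ideal)
  have fdV: "fd_rmodule (sym_group n) ?V" by (rule fd_reflection[OF n])
  note subF = fd_rmoduleD(2)[OF fdF]
  have F_Lambda: "\<exists>y. v = ?L \<otimes>\<^bsub>QS n\<^esub> y" if "v \<in> vecs F" for v
    using that unfolding F S.conv_assoc by blast
  \<comment> \<open>Here the commutation enters: \<open>e\<close> fixes every vector of
    \<open>F\<close>, and so it fixes what is glued from such vectors.\<close>
  have F_e: "e \<otimes>\<^bsub>QS n\<^esub> v = v" if v: "v \<in> vecs F" for v
  proof -
    obtain y where y: "v = (?L \<otimes>\<^bsub>QS n\<^esub> e) \<otimes>\<^bsub>QS n\<^esub> y" using v unfolding F by blast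
    have "e \<otimes>\<^bsub>QS n\<^esub> (?L \<otimes>\<^bsub>QS n\<^esub> e) = ?L \<otimes>\<^bsub>QS n\<^esub> e"
      unfolding S.conv_assoc[symmetric] comm[symmetric] unfolding S.conv_assoc ee ..
    then show ?thesis unfolding y S.conv_assoc[symmetric] by simp
  qed
  have Lambda_E: "?L \<otimes>\<^bsub>QS n\<^esub> x \<in> vecs F" if "x \<in> carrier (QS n)" "e \<otimes>\<^bsub>QS n\<^esub> x = x" for x
    unfolding F using that by (intro image_eqI[of _ _ x]) (simp_all only: S.conv_assoc)
  have row: "(\<lambda>g. z (k, g)) \<in> vecs F" if "z \<in> ?T" for z k
    by (rule row_in_subspace[OF subF that])
  have col: "(\<lambda>k. z (k, g)) \<in> vecs ?V" if "z \<in> ?T" for z g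
    by (rule column_in_subspace[OF subspace_reflection[OF n] that])
  have col_sum: "(\<Sum>k\<in>{1..n}. z (k, g)) = 0" and col_supp: "k \<notin> {1..n} \<Longrightarrow> z (k, g) = 0"
    if "z \<in> ?T" for z k g
    using col[OF that, of g] unfolding reflection_rmodule_def by auto
  have part_f: "coset_part n k (f z) = coset_part n k (\<lambda>g. z (k, g))" if z: "z \<in> ?T" for z k
  proof
    fix g
    show "coset_part n k (f z) g = coset_part n k (\<lambda>g. z (k, g)) g"
    proof (cases "g \<in> carrier (sym_group n)")
      case True
      then have "g k = n \<Longrightarrow> inv' g n = k"
        using permutes_inv_eq[of g "{1..n}" n k] unfolding sym_group_carrier by simp
      then show ?thesis using True by (simp add: coset_part_def f_def)
    next
      case False
      have "(\<lambda>g. z (k, g)) \<in> carrier (QS n)"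
        using row[OF z] S.right_ideal_subset unfolding F_def by blast
      then have "z (k, g) = 0" using False unfolding S.GA_iff by blast
      then show ?thesis using False by (simp add: coset_part_def f_def)
    qed
  qed
  have f_GA: "f z \<in> carrier (QS n)" for z
    unfolding S.GA_iff by (simp add: f_def)
  \<comment> \<open>The components of \<open>z\<close> are recovered from the coset parts of the
    glued element, which makes the gluing injective.\<close>
  have rows: "?L \<otimes>\<^bsub>QS n\<^esub> coset_part n k (f z) = (\<lambda>g. z (k, g))" if z: "z \<in> ?T" and k: "k \<in> {1..n}" for z k
  proof -
    obtain y where "(\<lambda>g. z (k, g)) = ?L \<otimes>\<^bsub>QS n\<^esub> y" using F_Lambda[OF row[OF z]] by blast
    from Lambda_coset_part_image[OF k this] show ?thesis unfolding part_f[OF z] .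
  qed
  have f_E: "e \<otimes>\<^bsub>QS n\<^esub> f z = f z" if z: "z \<in> ?T" for z
  proof -
    have "e \<otimes>\<^bsub>QS n\<^esub> f z = (\<Sum>k\<in>{1..n}. coset_part n k (e \<otimes>\<^bsub>QS n\<^esub> f z))"
      by (rule coset_part_sum[OF S.conv_closed n, symmetric])
    also have "\<dots> = (\<Sum>k\<in>{1..n}. coset_part n k (f z))"
    proof (intro sum.cong refl)
      fix k
      show "coset_part n k (e \<otimes>\<^bsub>QS n\<^esub> f z) = coset_part n k (f z)"
        unfolding conv_coset_part[OF e n, symmetric] part_f[OF z]
        unfolding conv_coset_part[OF e n] F_e[OF row[OF z]] ..
    qed
    also have "\<dots> = f z" by (rule coset_part_sum[OF f_GA n])
    finally show ?thesis .
  qed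
  \<comment> \<open>\<open>Lambda n\<close> turns the \<open>k\<close>-th piece into the
    \<open>k\<close>-th component, so the sum-zero condition of the reflection module becomes
    membership in the kernel.\<close>
  have f_Lambda: "?L \<otimes>\<^bsub>QS n\<^esub> f z = 0" if z: "z \<in> ?T" for z
  proof -
    have "?L \<otimes>\<^bsub>QS n\<^esub> f z = ?L \<otimes>\<^bsub>QS n\<^esub> (\<Sum>k\<in>{1..n}. coset_part n k (f z))"
      unfolding coset_part_sum[OF f_GA n] ..
    also have "\<dots> = (\<Sum>k\<in>{1..n}. (\<lambda>g. z (k, g)))"
      unfolding S.conv_sum by (intro sum.cong refl rows[OF z])
    also have "\<dots> = 0"
      by (rule ext) (simp only: sum_fun_apply col_sum[OF z] zero_fun_apply)
    finally show ?thesis .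
  qed
  have "rmodule_hom (sym_group n) (tensor_rmodule ?V F) ?E f"
  proof (rule rmodule_homI)
    show "f z \<in> vecs ?E" if "z \<in> vecs (tensor_rmodule ?V F)" for z
      using that f_GA f_E unfolding E vecs_tensor by blast
    show "linear_on (vecs (tensor_rmodule ?V F)) f"
      by (simp add: linear_on_def f_def fun_eq_iff qscale_def)
    fix z s assume "z \<in> vecs (tensor_rmodule ?V F)" and s: "s \<in> carrier (sym_group n)"
    have sp: "s permutes {1..n}" using s by (simp only: sym_group_carrier)
    have act: "act (tensor_rmodule ?V F) z s (k, g) = ((\<lambda>g. z (s k, g)) \<otimes>\<^bsub>QS n\<^esub> delta s) g" for k g
      by (simp add: tensor_rmodule_def reflection_rmodule_def F_def S.act_right_ideal)
    show "f (act (tensor_rmodule ?V F) z s) = act ?E (f z) s"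
    proof
      fix g
      show "f (act (tensor_rmodule ?V F) z s) g = act ?E (f z) s g"
      proof (cases "g \<in> carrier (sym_group n)")
        case True
        then have g: "g permutes {1..n}" by (simp only: sym_group_carrier)
        have gs: "g \<circ> inv' s \<in> carrier (sym_group n)"
          unfolding sym_group_carrier by (intro permutes_compose permutes_inv sp g)
        have "inv' (g \<circ> inv' s) = s \<circ> inv' g"
          using o_inv_distrib[OF permutes_bij[OF g] permutes_bij[OF permutes_inv[OF sp]]]
            permutes_inv_inv[OF sp] by simp
        \<comment> \<open>Right multiplication moves the coset index by \<open>s\<close>, just as
          \<open>s\<close> moves the coordinates of the reflection module.\<close>
        then have "inv' (g \<circ> inv' s) n = s (inv' g n)" by simp
        then show ?thesis
          using True gs
          by (simp add: f_def act S.act_right_ideal S.conv_delta[OF s True]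
              sym_group_inv_equality[OF s] sym_group_mult)
      next
        case False
        then show ?thesis
          unfolding S.act_right_ideal S.conv_apply(2)[OF False] by (simp add: f_def)
      qed
    qed
  qed
  moreover have "rmodule_hom (sym_group n) ?E F (\<lambda>x. ?L \<otimes>\<^bsub>QS n\<^esub> x)"
  proof (rule rmodule_homI[OF _ S.linear_on_conv(1)])
    show "?L \<otimes>\<^bsub>QS n\<^esub> x \<in> vecs F" if "x \<in> vecs ?E" for x
      using that Lambda_E unfolding E by blast
    show "?L \<otimes>\<^bsub>QS n\<^esub> act ?E x g = act F (?L \<otimes>\<^bsub>QS n\<^esub> x) g" for x g
      unfolding F_def S.act_right_ideal S.conv_assoc ..
  qed
  moreover have "inj_on f (vecs (tensor_rmodule ?V F))"
    unfolding vecs_tensor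
  proof (rule inj_onI, rule ext, clarify)
    fix z z' k g assume z: "z \<in> ?T" "z' \<in> ?T" "f z = f z'"
    show "z (k, g) = z' (k, g)"
    proof (cases "k \<in> {1..n}")
      case True
      have "(\<lambda>g. z (k, g)) = (\<lambda>g. z' (k, g))"
        unfolding rows[OF z(1) True, symmetric] rows[OF z(2) True, symmetric] z(3) ..
      then show ?thesis by (rule fun_cong)
    next
      case False
      then show ?thesis using col_supp[OF z(1)] col_supp[OF z(2)] by simp
    qed
  qed
  moreover have "(\<lambda>x. ?L \<otimes>\<^bsub>QS n\<^esub> x) ` vecs ?E = vecs F"
  proof
    show "(\<lambda>x. ?L \<otimes>\<^bsub>QS n\<^esub> x) ` vecs ?E \<subseteq> vecs F"
      using Lambda_E unfolding E by blast
    show "vecs F \<subseteq> (\<lambda>x. ?L \<otimes>\<^bsub>QS n\<^esub> x) ` vecs ?E"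
      unfolding F S.vecs_right_ideal S.conv_assoc image_image ..
  qed
  moreover have "f ` vecs (tensor_rmodule ?V F) = {x \<in> vecs ?E. ?L \<otimes>\<^bsub>QS n\<^esub> x = 0}"
    unfolding vecs_tensor
  proof (intro equalityI subsetI)
    fix x assume "x \<in> f ` ?T"
    then show "x \<in> {x \<in> vecs ?E. ?L \<otimes>\<^bsub>QS n\<^esub> x = 0}"
      using f_GA f_E f_Lambda unfolding E by blast
  next
    fix x assume "x \<in> {x \<in> vecs ?E. ?L \<otimes>\<^bsub>QS n\<^esub> x = 0}"
    then have x: "x \<in> carrier (QS n)" "e \<otimes>\<^bsub>QS n\<^esub> x = x" "?L \<otimes>\<^bsub>QS n\<^esub> x = 0"
      unfolding E by auto
    \<comment> \<open>Undoes the gluing: component \<open>k\<close> is the equivariant extension of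
      the piece of \<open>x\<close> on the coset \<open>g k = n\<close>.\<close>
    define z where "z = (\<lambda>(k, g). if k \<in> {1..n} then (?L \<otimes>\<^bsub>QS n\<^esub> coset_part n k x) g else 0)"
    have part_GA: "coset_part n k x \<in> carrier (QS n)" for k
      using x(1) unfolding S.GA_iff by (simp add: coset_part_def)
    have "z \<in> ?T"
    proof (rule reflection_tensorI[OF subF n])
      fix k assume k: "k \<in> {1..n}"
      have "e \<otimes>\<^bsub>QS n\<^esub> coset_part n k x = coset_part n k x"
        unfolding conv_coset_part[OF e n] x(2) ..
      from Lambda_E[OF part_GA this] show "(\<lambda>g. z (k, g)) \<in> vecs F"
        using k by (simp add: z_def)
    next
      fix g
      have "(\<Sum>k\<in>{1..n}. z (k, g)) = (\<Sum>k\<in>{1..n}. ?L \<otimes>\<^bsub>QS n\<^esub> coset_part n k x) g"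
        unfolding sum_fun_apply by (intro sum.cong refl) (simp add: z_def)
      also have "\<dots> = 0"
        unfolding S.conv_sum(2)[symmetric] coset_part_sum[OF x(1) n] x(3) by simp
      finally show "(\<Sum>k\<in>{1..n}. z (k, g)) = 0" .
    qed (simp only: z_def prod.case if_False)
    moreover have "f z = x"
    proof
      fix g
      show "f z g = x g"
      proof (cases "g \<in> carrier (sym_group n)")
        case True
        then have g: "g permutes {1..n}" by (simp only: sym_group_carrier)
        have k: "inv' g n \<in> {1..n}" "g (inv' g n) = n"
          using permutes_in_image[OF permutes_inv[OF g], of n] n permutes_inverses(1)[OF g] by auto
        have "f z g = (?L \<otimes>\<^bsub>QS n\<^esub> coset_part n (inv' g n) x) g"
          using True k(1) by (simp add: f_def z_def)
        also have "\<dots> = x g" by (rule Lambda_coset_part_apply[OF g k])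
        finally show ?thesis .
      next
        case False
        then have "x g = 0" using x(1) unfolding S.GA_iff by blast
        then show ?thesis using False by (simp add: f_def)
      qed
    qed
    ultimately show "x \<in> f ` ?T" by blast
  qed
  ultimately show ?thesis
    unfolding short_exact_def by (intro exI[of _ f] exI[of _ "\<lambda>x. ?L \<otimes>\<^bsub>QS n\<^esub> x"] conjI)
qed

section \<open>Comparing coefficients\<close>

lemma abelian_monoid_power_series:
  assumes "abelian_monoid R"
  shows "abelian_monoid (power_series_ring R)"
proof -
  interpret R: abelian_monoid R by fact
  show ?thesis
    by (rule abelian_monoidI) (auto simp: power_series_ring_def Pi_iff R.a_ac)
qed

lemma finsum_power_series:
  assumes R: "abelian_monoid R" and "finite A" "\<And>j. j \<in> A \<Longrightarrow> p j \<in> UNIV \<rightarrow> carrier R"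
  shows "(\<Oplus>\<^bsub>power_series_ring R\<^esub>j\<in>A. p j) k = (\<Oplus>\<^bsub>R\<^esub>j\<in>A. p j k)"
  using assms(2,3)
proof (induction A rule: finite_induct)
  case empty
  interpret R: abelian_monoid R by fact
  interpret P: abelian_monoid "power_series_ring R" by (rule abelian_monoid_power_series[OF R])
  show ?case by (simp only: P.finsum_empty R.finsum_empty) (simp add: power_series_ring_def)
next
  case (insert j A)
  interpret R: abelian_monoid R by fact
  interpret P: abelian_monoid "power_series_ring R" by (rule abelian_monoid_power_series[OF R])
  have p: "p i \<in> carrier (power_series_ring R)" "p i k \<in> carrier R" if "i \<in> insert j A" for i k
    using insert.prems[OF that] by (auto simp: power_series_ring_def)
  have "(\<Oplus>\<^bsub>power_series_ring R\<^esub>j\<in>insert j A. p j) =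
      p j \<oplus>\<^bsub>power_series_ring R\<^esub> (\<Oplus>\<^bsub>power_series_ring R\<^esub>j\<in>A. p j)"
    by (rule P.finsum_insert) (use insert.hyps p in auto)
  moreover have "(\<Oplus>\<^bsub>R\<^esub>j\<in>insert j A. p j k) = p j k \<oplus>\<^bsub>R\<^esub> (\<Oplus>\<^bsub>R\<^esub>j\<in>A. p j k)"
    by (rule R.finsum_insert) (use insert.hyps p in auto)
  moreover have "(\<Oplus>\<^bsub>power_series_ring R\<^esub>j\<in>A. p j) k = (\<Oplus>\<^bsub>R\<^esub>j\<in>A. p j k)"
    by (rule insert.IH) (use insert.prems in auto)
  ultimately show ?case by (simp add: power_series_ring_def)
qed

text \<open>This is the shape of a Cauchy product whose first factor, here \<open>1 + t V\<close>,
  lives in degrees 0 and 1.\<close>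

lemma (in abelian_monoid) finsum_two_terms:
  assumes "x \<in> carrier G" "y \<in> carrier G"
  shows "(\<Oplus>i\<in>{..Suc k}. if i = 0 then x else if i = Suc 0 then y else \<zero>) = x \<oplus> y"
proof (induction k)
  case 0
  show ?case using assms by (simp add: a_comm)
next
  case (Suc k)
  have "(\<Oplus>i\<in>{..Suc (Suc k)}. if i = 0 then x else if i = Suc 0 then y else \<zero>) =
      \<zero> \<oplus> (\<Oplus>i\<in>{..Suc k}. if i = 0 then x else if i = Suc 0 then y else \<zero>)"
    using assms by (subst finsum_Suc) auto
  then show ?case unfolding Suc using assms by simp
qed

text \<open>The exponents reverse the indices. Degree 0 is the equation for \<open>a n\<close>, to
  which only the summand \<open>1\<close> contributes, and degree \<open>n - 1\<close> the one for
  \<open>a 1\<close>, to which only \<open>t V\<close> contributes; hence the separate cases. The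
  product laws are assumed only for the coefficients that occur, which is the form in which
  \<open>rep_ring\<close> provides them.\<close>

lemma power_series_identity_iff:
  fixes R (structure)
  assumes R: "abelian_group R" and n: "n \<ge> 2"
    and a: "\<And>j. a j \<in> carrier R" and f: "\<And>j. f j \<in> carrier R" and V: "V \<in> carrier R"
    and one: "\<one> \<in> carrier R" "\<one> \<otimes> \<zero> = \<zero>" "\<And>j. \<one> \<otimes> f j = f j"
    and V_mult: "V \<otimes> \<zero> = \<zero>" "\<And>j. V \<otimes> f j \<in> carrier R"
    and zero: "\<And>x. x \<in> carrier R \<Longrightarrow> \<zero> \<otimes> x = \<zero>"
  shows "(\<Oplus>\<^bsub>power_series_ring R\<^esub>j\<in>{1..n}. ps_monom R (a j) (n - j)) =
      (\<one>\<^bsub>power_series_ring R\<^esub> \<oplus>\<^bsub>power_series_ring R\<^esub> ps_monom R V 1)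
        \<otimes>\<^bsub>power_series_ring R\<^esub>
      (\<Oplus>\<^bsub>power_series_ring R\<^esub>j\<in>{1..n-1}. ps_monom R (f j) (n - 1 - j))
    \<longleftrightarrow> (\<forall>j\<in>{1..n-1}. a j = (if j = 1 then \<zero> else f (j - 1)) \<oplus> V \<otimes> f j) \<and> a n = f (n - 1)"
    (is "?A = ?P \<otimes>\<^bsub>_\<^esub> ?F \<longleftrightarrow> _")
proof -
  interpret R: abelian_group R by fact
  note aR = R.abelian_monoid_axioms
  have A: "?A k = (if k < n then a (n - k) else \<zero>)" for k
  proof -
    have "?A k = (\<Oplus>j\<in>{1..n}. if k = n - j then a j else \<zero>)"
      using a by (subst finsum_power_series[OF aR]) (auto simp: ps_monom_def)
    also have "\<dots> = (if k < n then a (n - k) else \<zero>)"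
    proof (cases "k < n")
      case True
      have "(\<Oplus>j\<in>{1..n}. if k = n - j then a j else \<zero>) = (\<Oplus>j\<in>{1..n}. if n - k = j then a j else \<zero>)"
        using True a by (intro R.finsum_cong') auto
      also have "\<dots> = a (n - k)"
        using True a by (intro R.finsum_singleton) auto
      finally show ?thesis using True by simp
    next
      case False
      have "(\<Oplus>j\<in>{1..n}. if k = n - j then a j else \<zero>) = (\<Oplus>j\<in>{1..n}. \<zero>)"
        using False by (intro R.finsum_cong') auto
      then show ?thesis using False by simp
    qed
    finally show ?thesis .
  qed
  \<comment> \<open>The series runs through the \<open>f j\<close> backwards: degree
    \<open>k\<close> carries \<open>j = n - 1 - k\<close>.\<close>
  define Q where "Q k = (if k < n - 1 then f (n - 1 - k) else \<zero>)" for k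
  have F: "?F k = Q k" for k
  proof -
    have "?F k = (\<Oplus>j\<in>{1..n-1}. if k = n - 1 - j then f j else \<zero>)"
      using f by (subst finsum_power_series[OF aR]) (auto simp: ps_monom_def)
    also have "\<dots> = Q k"
    proof (cases "k < n - 1")
      case True
      have "(\<Oplus>j\<in>{1..n-1}. if k = n - 1 - j then f j else \<zero>) =
          (\<Oplus>j\<in>{1..n-1}. if n - 1 - k = j then f j else \<zero>)"
        using True f by (intro R.finsum_cong') auto
      also have "\<dots> = f (n - 1 - k)"
        using True f by (intro R.finsum_singleton) auto
      finally show ?thesis using True by (simp add: Q_def)
    next
      case False
      have "(\<Oplus>j\<in>{1..n-1}. if k = n - 1 - j then f j else \<zero>) = (\<Oplus>j\<in>{1..n-1}. \<zero>)"
        using False by (intro R.finsum_cong') auto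
      then show ?thesis using False by (simp add: Q_def)
    qed
    finally show ?thesis .
  qed
  have Q: "Q k \<in> carrier R" "\<one> \<otimes> Q k = Q k" "V \<otimes> Q k \<in> carrier R" for k
    using f one V_mult by (auto simp: Q_def)
  have P: "?P i = (if i = 0 then \<one> else if i = Suc 0 then V else \<zero>)" for i
    using one V by (simp add: power_series_ring_def ps_monom_def)
  have prod: "(?P \<otimes>\<^bsub>power_series_ring R\<^esub> ?F) k = (\<Oplus>i\<in>{..k}. ?P i \<otimes> Q (k - i))" for k
    unfolding F[symmetric] by (simp add: power_series_ring_def)
  have B0: "(?P \<otimes>\<^bsub>power_series_ring R\<^esub> ?F) 0 = Q 0"
    unfolding prod P using Q by simp
  have B: "(?P \<otimes>\<^bsub>power_series_ring R\<^esub> ?F) (Suc k) = Q (Suc k) \<oplus> V \<otimes> Q k" for k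
  proof -
    have "(\<Oplus>i\<in>{..Suc k}. ?P i \<otimes> Q (Suc k - i)) =
        (\<Oplus>i\<in>{..Suc k}. if i = 0 then Q (Suc k) else if i = Suc 0 then V \<otimes> Q k else \<zero>)"
      unfolding P using Q zero by (intro R.finsum_cong') auto
    then show ?thesis unfolding prod using R.finsum_two_terms[OF Q(1,3)] by simp
  qed
  have coeff0: "?A 0 = (?P \<otimes>\<^bsub>power_series_ring R\<^esub> ?F) 0 \<longleftrightarrow> a n = f (n - 1)"
    unfolding A B0 Q_def using n by simp
  have coeff: "?A (Suc k) = (?P \<otimes>\<^bsub>power_series_ring R\<^esub> ?F) (Suc k) \<longleftrightarrow>
      (Suc k < n \<longrightarrow> a (n - Suc k) =
        (if n - Suc k = 1 then \<zero> else f (n - Suc k - 1)) \<oplus> V \<otimes> f (n - Suc k))" for k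
  proof (cases "Suc k < n")
    case True
    have "Q (Suc k) = (if n - Suc k = 1 then \<zero> else f (n - Suc k - 1))"
      using True by (auto simp: Q_def)
    moreover have "k < n - 1" "n - 1 - k = n - Suc k" using True by auto
    then have "Q k = f (n - Suc k)" by (simp only: Q_def if_True)
    ultimately show ?thesis unfolding A B using True by simp
  next
    case False
    then have "Q (Suc k) = \<zero>" "Q k = \<zero>" by (auto simp: Q_def)
    then show ?thesis unfolding A B using False V_mult by simp
  qed
  have all_nat: "(\<forall>k. p k) \<longleftrightarrow> p 0 \<and> (\<forall>k. p (Suc k))" for p :: "nat \<Rightarrow> bool"
    by (metis nat.exhaust)
  have "?A = ?P \<otimes>\<^bsub>power_series_ring R\<^esub> ?F \<longleftrightarrow>
      (\<forall>k. ?A k = (?P \<otimes>\<^bsub>power_series_ring R\<^esub> ?F) k)"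
    by (rule fun_eq_iff)
  also have "\<dots> \<longleftrightarrow> ?A 0 = (?P \<otimes>\<^bsub>power_series_ring R\<^esub> ?F) 0 \<and>
      (\<forall>k. ?A (Suc k) = (?P \<otimes>\<^bsub>power_series_ring R\<^esub> ?F) (Suc k))"
    by (rule all_nat)
  also have "\<dots> \<longleftrightarrow> a n = f (n - 1) \<and> (\<forall>k. Suc k < n \<longrightarrow> a (n - Suc k) =
        (if n - Suc k = 1 then \<zero> else f (n - Suc k - 1)) \<oplus> V \<otimes> f (n - Suc k))"
    unfolding coeff0 coeff ..
  also have "(\<forall>k. Suc k < n \<longrightarrow> a (n - Suc k) =
        (if n - Suc k = 1 then \<zero> else f (n - Suc k - 1)) \<oplus> V \<otimes> f (n - Suc k)) \<longleftrightarrow>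
      (\<forall>j\<in>{1..n-1}. a j = (if j = 1 then \<zero> else f (j - 1)) \<oplus> V \<otimes> f j)" (is "?L \<longleftrightarrow> ?R")
  proof
    assume L: ?L
    show ?R
    proof
      fix j assume j: "j \<in> {1..n-1}"
      define k where "k = n - j - 1"
      have "Suc k < n" "n - Suc k = j" using j by (auto simp: k_def)
      with L show "a j = (if j = 1 then \<zero> else f (j - 1)) \<oplus> V \<otimes> f j" by metis
    qed
  next
    assume R: ?R
    show ?L
    proof (intro allI impI)
      fix k assume "Suc k < n"
      then have "n - Suc k \<in> {1..n-1}" by auto
      with R show "a (n - Suc k) = (if n - Suc k = 1 then \<zero> else f (n - Suc k - 1)) \<oplus> V \<otimes> f (n - Suc k)"
        by (rule bspec)
    qed
  qed
  finally show ?thesis by blast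
qed

text \<open>
  Once \<open>u\<^sub>j = v\<^sub>j + f\<^sub>j\<close>, the relation \<open>a\<^sub>j = f\<^sub>j\<^sub>-\<^sub>1 + v\<^sub>j\<close> says that \<open>f\<close> increases by \<open>u\<^sub>j - a\<^sub>j\<close>; the
  relation for \<open>a\<^sub>n\<close> is the comparison of the total sums.
\<close>

lemma (in abelian_group) telescoping_iff:
  fixes n :: nat
  assumes n: "n \<ge> 2"
    and carr: "\<And>j. a j \<in> carrier G" "\<And>j. f j \<in> carrier G" "\<And>j. v j \<in> carrier G" "\<And>j. u j \<in> carrier G"
    and u: "\<And>j. j \<in> {1..n-1} \<Longrightarrow> u j = v j \<oplus> f j"
    and total: "(\<Oplus>j\<in>{1..n}. a j) = (\<Oplus>j\<in>{1..n-1}. u j)"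
  shows "(\<forall>j\<in>{1..n-1}. f j = (\<Oplus>i\<in>{1..j}. u i \<ominus> a i)) \<longleftrightarrow>
    (\<forall>j\<in>{1..n-1}. a j = (if j = 1 then \<zero> else f (j - 1)) \<oplus> v j) \<and> a n = f (n - 1)"
proof -
  define f' where "f' j = (if j = 1 then \<zero> else f (j - 1))" for j
  define D where "D j = (\<Oplus>i\<in>{1..j}. u i \<ominus> a i)" for j
  have f': "f' j \<in> carrier G" for j using carr by (simp add: f'_def)
  have D_carr: "D j \<in> carrier G" for j
    unfolding D_def using carr by (intro finsum_closed) auto
  have D_0: "D 0 = \<zero>" by (simp add: D_def)
  have D_Suc: "D (Suc j) = D j \<oplus> (u (Suc j) \<ominus> a (Suc j))" for j
  proof -
    have "{1..Suc j} = insert (Suc j) {1..j}" by auto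
    then have "D (Suc j) = (u (Suc j) \<ominus> a (Suc j)) \<oplus> D j"
      unfolding D_def using carr by (simp only:) (rule finsum_insert; auto)
    then show ?thesis using carr D_carr by (simp add: a_comm)
  qed
  \<comment> \<open>By \<open>u j = v j \<oplus> f j\<close> the term \<open>f j\<close> occurs on
    both sides and cancels.\<close>
  have step: "f j = f' j \<oplus> (u j \<ominus> a j) \<longleftrightarrow> a j = f' j \<oplus> v j" if "j \<in> {1..n-1}" for j
  proof -
    have "f' j \<oplus> (u j \<ominus> a j) = (f' j \<oplus> v j \<ominus> a j) \<oplus> f j"
      unfolding u[OF that] minus_eq using carr f' by (simp add: a_ac)
    moreover have "f j = (f' j \<oplus> v j \<ominus> a j) \<oplus> f j \<longleftrightarrow> f' j \<oplus> v j \<ominus> a j = \<zero>"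
      using carr f' add.r_cancel_one'[of "f j" "f' j \<oplus> v j \<ominus> a j"] by simp
    moreover have "\<zero> = f' j \<oplus> v j \<ominus> a j \<longleftrightarrow> f' j \<oplus> v j = \<zero> \<oplus> a j"
      unfolding minus_eq using carr f' by (intro add.inv_solve_right) auto
    then have "f' j \<oplus> v j \<ominus> a j = \<zero> \<longleftrightarrow> f' j \<oplus> v j = a j"
      using carr by (auto dest: sym)
    ultimately show ?thesis by auto
  qed
  have sys: "(\<forall>j\<in>{1..n-1}. f j = D j) \<longleftrightarrow> (\<forall>j\<in>{1..n-1}. f j = f' j \<oplus> (u j \<ominus> a j))"
  proof
    assume L: "\<forall>j\<in>{1..n-1}. f j = D j"
    show "\<forall>j\<in>{1..n-1}. f j = f' j \<oplus> (u j \<ominus> a j)"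
    proof
      fix j assume j: "j \<in> {1..n-1}"
      then obtain i where i: "j = Suc i" by (cases j) auto
      have "f' j = D i"
        using L j i D_0 by (cases i) (auto simp: f'_def)
      then show "f j = f' j \<oplus> (u j \<ominus> a j)" using L j i D_Suc by auto
    qed
  next
    assume R: "\<forall>j\<in>{1..n-1}. f j = f' j \<oplus> (u j \<ominus> a j)"
    have "j \<in> {1..n-1} \<Longrightarrow> f j = D j" for j
    proof (induction j)
      case (Suc i)
      have "f' (Suc i) = D i"
        using Suc D_0 by (cases i) (auto simp: f'_def)
      then show ?case using R Suc.prems D_Suc by metis
    qed simp
    then show "\<forall>j\<in>{1..n-1}. f j = D j" by blast
  qed
  \<comment> \<open>Adding the \<open>a j\<close> back to \<open>D (n - 1)\<close> gives the sum of
    the \<open>u j\<close>, which \<open>total\<close> equates with the sum of all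
    \<open>a j\<close>; what remains is \<open>a n\<close>.\<close>
  have last: "a n = f (n - 1)" if "\<forall>j\<in>{1..n-1}. f j = D j"
  proof -
    have "{1..n} = insert n {1..n-1}" using n by auto
    then have "(\<Oplus>j\<in>{1..n}. a j) = a n \<oplus> (\<Oplus>j\<in>{1..n-1}. a j)"
      using carr n by (simp only:) (rule finsum_insert; auto)
    moreover have "D (n - 1) \<oplus> (\<Oplus>j\<in>{1..n-1}. a j) = (\<Oplus>j\<in>{1..n-1}. (u j \<ominus> a j) \<oplus> a j)"
      unfolding D_def using carr by (intro finsum_addf[symmetric]) auto
    moreover have "(\<Oplus>j\<in>{1..n-1}. (u j \<ominus> a j) \<oplus> a j) = (\<Oplus>j\<in>{1..n-1}. u j)"
    proof (rule finsum_cong')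
      show "(u j \<ominus> a j) \<oplus> a j = u j" for j
        unfolding minus_eq using carr by (simp add: a_assoc l_neg)
    qed (use carr in auto)
    ultimately have "a n \<oplus> (\<Oplus>j\<in>{1..n-1}. a j) = D (n - 1) \<oplus> (\<Oplus>j\<in>{1..n-1}. a j)"
      using total by simp
    moreover have "(\<Oplus>j\<in>{1..n-1}. a j) \<in> carrier G" using carr by (intro finsum_closed) auto
    ultimately have "a n = D (n - 1)" using carr D_carr by simp
    moreover have "n - 1 \<in> {1..n-1}" using n by simp
    ultimately show ?thesis using that by metis
  qed
  show ?thesis
    unfolding f'_def[symmetric] D_def[symmetric] using sys step last by blast
qed

text \<open>The record equation lets facts about a subgroup of \<open>sym_group n\<close> be read as
  facts about \<open>sym_group (n - 1)\<close>.\<close>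

lemma sym_group_subgroup:
  "subgroup (carrier (sym_group (n - 1))) (sym_group n)"
  "(sym_group n)\<lparr>carrier := carrier (sym_group (n - 1))\<rparr> = sym_group (n - 1)"
proof -
  show "(sym_group n)\<lparr>carrier := carrier (sym_group (n - 1))\<rparr> = sym_group (n - 1)"
    by (simp add: sym_group_def)
  have "{1..n-1} \<subseteq> {1..n}" by auto
  then have sub: "p permutes {1..n-1} \<Longrightarrow> p permutes {1..n}" for p
    by (rule permutes_subset[rotated])
  show "subgroup (carrier (sym_group (n - 1))) (sym_group n)"
  proof (rule group.subgroupI[OF sym_group_is_group])
    show "carrier (sym_group (n - 1)) \<subseteq> carrier (sym_group n)"
      using sub by (auto simp: sym_group_def)
    have "id \<in> carrier (sym_group (n - 1))" by (simp only: sym_group_carrier permutes_id)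
    then show "carrier (sym_group (n - 1)) \<noteq> {}" by blast
    show "inv\<^bsub>sym_group n\<^esub> p \<in> carrier (sym_group (n - 1))" if "p \<in> carrier (sym_group (n - 1))" for p
    proof -
      have "p \<in> carrier (sym_group n)" using that sub by (auto simp: sym_group_def)
      then show ?thesis using sym_group_inv_closed[OF that] by simp
    qed
    show "p \<otimes>\<^bsub>sym_group n\<^esub> q \<in> carrier (sym_group (n - 1))"
      if "p \<in> carrier (sym_group (n - 1))" "q \<in> carrier (sym_group (n - 1))" for p q
      using that permutes_compose by (auto simp: sym_group_def)
  qed
qed

theorem proposition1:
  fixes n :: nat
  assumes "n \<ge> 2"
  shows
    "(\<forall>j\<in>{1..n-1}.
        F_class n j = (\<Oplus>\<^bsub>RS n\<^esub>i\<in>{1..j}. E_ind_class n i \<ominus>\<^bsub>RS n\<^esub> E_class n i))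
     \<longleftrightarrow>
     (\<Oplus>\<^bsub>power_series_ring (RS n)\<^esub>j\<in>{1..n}. ps_monom (RS n) (E_class n j) (n - j)) =
       (\<one>\<^bsub>power_series_ring (RS n)\<^esub> \<oplus>\<^bsub>power_series_ring (RS n)\<^esub> ps_monom (RS n) (V_class n) 1)
       \<otimes>\<^bsub>power_series_ring (RS n)\<^esub>
       (\<Oplus>\<^bsub>power_series_ring (RS n)\<^esub>j\<in>{1..n-1}. ps_monom (RS n) (F_class n j) (n - 1 - j))"
proof -
  let ?G = "sym_group n" and ?I = "right_ideal_rmodule (sym_group n)"
  let ?e = "eulerian_idempotent (n - 1)"
  interpret R: abelian_group "RS n" by (rule abelian_group_rep_ring)
  have n: "n > 0" "n - 1 > 0" using assms by auto
  note G = sym_group_is_group[of n]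
  note conv = S.conv_subgroup[OF sym_group_subgroup(1), unfolded sym_group_subgroup(2)]
  obtain L where
    e: "\<And>j. j \<in> {1..n-1} \<Longrightarrow> ?e j = S.evp (n - 1) (shuffle_element (n - 1)) (L j)" and
    orth: "\<And>i j. i \<in> {1..n-1} \<Longrightarrow> j \<in> {1..n-1} \<Longrightarrow>
      ?e i \<otimes>\<^bsub>QS (n - 1)\<^esub> ?e j = (if i = j then ?e i else 0)" and
    sum_e: "(\<Sum>j\<in>{1..n-1}. ?e j) = delta id"
    using eulerian_idempotents[OF n(2)] by metis
  have e_closed: "?e j \<in> carrier (QS (n - 1))" if "j \<in> {1..n-1}" for j
    unfolding e[OF that] by (rule S.evp_closed)
  have orth': "?e i \<otimes>\<^bsub>QS n\<^esub> ?e j = (if i = j then ?e i else 0)"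
    if "i \<in> {1..n-1}" "j \<in> {1..n-1}" for i j
    unfolding conv[OF e_closed[OF that(1)] e_closed[OF that(2)], symmetric] by (rule orth[OF that])
  have idem: "?e j \<otimes>\<^bsub>QS n\<^esub> ?e j = ?e j" if "j \<in> {1..n-1}" for j
    using orth'[OF that that] by simp
  \<comment> \<open>The idempotents are polynomials in the shuffle element, and these have the same
    value in the larger algebra.\<close>
  have comm: "Lambda n \<otimes>\<^bsub>QS n\<^esub> ?e j = ?e j \<otimes>\<^bsub>QS n\<^esub> Lambda n" if "j \<in> {1..n-1}" for j
    unfolding e[OF that]
      S.evp_subgroup[OF sym_group_subgroup(1), unfolded sym_group_subgroup(2), OF shuffle_element_closed]
    by (rule S.evp_commute[OF Lambda_commutes_shuffle_element[OF assms] Lambda_closed])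
  have fdF: "fd_rmodule ?G (whitehouse_rmodule n j)" for j
    unfolding whitehouse_rmodule_def by (rule S.fd_right_ideal)
  have fdE: "fd_rmodule ?G (eulerian_rmodule n j)" for j
    unfolding eulerian_rmodule_def by (rule S.fd_right_ideal)
  have fdV: "fd_rmodule ?G (reflection_rmodule n)" by (rule fd_reflection[OF n(1)])
  have closed: "E_class n j \<in> carrier (RS n)" "F_class n j \<in> carrier (RS n)" "V_class n \<in> carrier (RS n)" for j
    by (intro rep_class_closed fdE fdF fdV)+
  define v where "v j = V_class n \<otimes>\<^bsub>RS n\<^esub> F_class n j" for j
  \<comment> \<open>The ideal in \<open>QS n\<close> stands in for the induced module; its class
    lies in the ring for every \<open>j\<close>, as \<open>telescoping_iff\<close> requires.\<close>
  define u where "u j = rep_class ?G (?I (?e j))" for j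
  have v: "v j = rep_class ?G (tensor_rmodule (reflection_rmodule n) (whitehouse_rmodule n j))" for j
    unfolding v_def by (rule rep_class_mult[OF G fdV fdF])
  have fdVF: "fd_rmodule ?G (tensor_rmodule (reflection_rmodule n) (whitehouse_rmodule n j))" for j
    by (rule fd_tensor[OF G fdV fdF])
  have v_closed: "v j \<in> carrier (RS n)" for j
    unfolding v by (rule rep_class_closed[OF fdVF])
  have u_closed: "u j \<in> carrier (RS n)" for j
    unfolding u_def by (rule rep_class_closed[OF S.fd_right_ideal])
  have u: "E_ind_class n j = u j" if j: "j \<in> {1..n-1}" for j
  proof -
    have "rmodule_iso ?G (?I (?e j))
        (induced_rmodule ?G (carrier (sym_group (n - 1))) (eulerian_rmodule (n - 1) j))"
      using S.induced_right_ideal[OF sym_group_subgroup(1), unfolded sym_group_subgroup(2),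
          OF e_closed[OF j] idem[OF j]]
      unfolding eulerian_rmodule_def .
    from rep_class_iso[OF S.fd_right_ideal fd_rmodule_iso[OF G S.fd_right_ideal this] this]
    show ?thesis unfolding u_def ..
  qed
  have u_eq: "u j = v j \<oplus>\<^bsub>RS n\<^esub> F_class n j" if j: "j \<in> {1..n-1}" for j
    unfolding u_def v
    by (rule rep_class_exact[OF fdVF S.fd_right_ideal fdF
          whitehouse_exact[OF n(1) e_closed[OF j] idem[OF j] comm[OF j], folded whitehouse_rmodule_def]])
  \<comment> \<open>This total and the next agree because the idempotents of either algebra add up
    to the same unit \<open>delta id\<close>.\<close>
  have total_u: "(\<Oplus>\<^bsub>RS n\<^esub>j\<in>{1..n-1}. u j) = rep_class ?G (?I (delta id))"
  proof -
    have S: "Suc (n - 2) = n - 1" using assms by simp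
    show ?thesis
      unfolding u_def sum_e[symmetric]
      by (rule S.rep_class_orthogonal_sums[where m = "n - 2", unfolded S, symmetric]) (rule orth')
  qed
  have total_E: "(\<Oplus>\<^bsub>RS n\<^esub>j\<in>{1..n}. E_class n j) = rep_class ?G (?I (delta id))"
  proof -
    have S: "Suc (n - 1) = n" using n(1) by simp
    have orthE: "eulerian_idempotent n i \<otimes>\<^bsub>QS n\<^esub> eulerian_idempotent n j =
        (if i = j then eulerian_idempotent n i else 0)" if "i \<in> {1..n}" "j \<in> {1..n}" for i j
      by (rule eulerian_idempotents[OF n(1)]) (use that in blast)
    have sumE: "(\<Sum>j\<in>{1..n}. eulerian_idempotent n j) = delta id"
      by (rule eulerian_idempotents[OF n(1)])
    show ?thesis
      unfolding eulerian_rmodule_def sumE[symmetric]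
      by (rule S.rep_class_orthogonal_sums[where m = "n - 1", unfolded S, symmetric]) (rule orthE)
  qed
  have "(\<Oplus>\<^bsub>RS n\<^esub>i\<in>{1..j}. E_ind_class n i \<ominus>\<^bsub>RS n\<^esub> E_class n i) =
      (\<Oplus>\<^bsub>RS n\<^esub>i\<in>{1..j}. u i \<ominus>\<^bsub>RS n\<^esub> E_class n i)" if "j \<in> {1..n-1}" for j
  proof (rule R.finsum_cong')
    fix i assume "i \<in> {1..j}"
    then have "i \<in> {1..n-1}" using that by auto
    from u[OF this] show "E_ind_class n i \<ominus>\<^bsub>RS n\<^esub> E_class n i = u i \<ominus>\<^bsub>RS n\<^esub> E_class n i"
      by simp
  qed (use u_closed closed in auto)
  then have "(\<forall>j\<in>{1..n-1}.
        F_class n j = (\<Oplus>\<^bsub>RS n\<^esub>i\<in>{1..j}. E_ind_class n i \<ominus>\<^bsub>RS n\<^esub> E_class n i)) \<longleftrightarrow>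
      (\<forall>j\<in>{1..n-1}. F_class n j = (\<Oplus>\<^bsub>RS n\<^esub>i\<in>{1..j}. u i \<ominus>\<^bsub>RS n\<^esub> E_class n i))"
    by (intro ball_cong refl) simp
  also have "\<dots> \<longleftrightarrow> (\<forall>j\<in>{1..n-1}. E_class n j =
        (if j = 1 then \<zero>\<^bsub>RS n\<^esub> else F_class n (j - 1)) \<oplus>\<^bsub>RS n\<^esub> v j) \<and> E_class n n = F_class n (n - 1)"
    by (rule R.telescoping_iff[OF assms closed(1,2) v_closed u_closed u_eq trans[OF total_E total_u[symmetric]]])
  also have "\<dots> \<longleftrightarrow>
      (\<Oplus>\<^bsub>power_series_ring (RS n)\<^esub>j\<in>{1..n}. ps_monom (RS n) (E_class n j) (n - j)) =
       (\<one>\<^bsub>power_series_ring (RS n)\<^esub> \<oplus>\<^bsub>power_series_ring (RS n)\<^esub> ps_monom (RS n) (V_class n) 1)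
       \<otimes>\<^bsub>power_series_ring (RS n)\<^esub>
       (\<Oplus>\<^bsub>power_series_ring (RS n)\<^esub>j\<in>{1..n-1}. ps_monom (RS n) (F_class n j) (n - 1 - j))"
    unfolding v_def
  proof (rule power_series_identity_iff[symmetric, OF abelian_group_rep_ring assms closed(1,2,3)
        rep_ring_one_closed rep_ring_mult_zero(1)[OF G rep_ring_one_closed]
        rep_ring_one_mult[OF G fdF] rep_ring_mult_zero(1)[OF G closed(3)]])
    show "V_class n \<otimes>\<^bsub>RS n\<^esub> F_class n j \<in> carrier (RS n)" for j
      using v_closed unfolding v_def .
    show "\<zero>\<^bsub>RS n\<^esub> \<otimes>\<^bsub>RS n\<^esub> x = \<zero>\<^bsub>RS n\<^esub>" if "x \<in> carrier (RS n)" for x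
      by (rule rep_ring_mult_zero(2)[OF G that])
  qed
  finally show ?thesis .
qed

end
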